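(* For $n$ odd, $n\ge3$, and $\xi=e^{2\pi i/n}$, the Markov chain obtained by tensoring irreducible modules of the quantum group $\mathfrak u_\xi(\mathfrak{sl}_2)$ with the two-dimensional irreducible module $V_1$ is the chain $K$ on $\{0,1,\dots,n-1\}$ (where $a$ stands for the irreducible module $V_a$ of dimension $a+1$) given by $$K(a,a-1)=\tfrac12\left(1-\tfrac1{a+1}\right)\ (1\le a\le n-2),\qquad K(a,a+1)=\tfrac12\left(1+\tfrac1{a+1}\right)\ (0\le a\le n-2),$$ $$K(n-1,n-2)=1-\tfrac1n,\qquad K(n-1,0)=\tfrac1n$$ (all other entries $0$), with stationary distribution $\pi(j)=\frac{2(j+1)}{n^2}$ for $0\le j\le n-2$ and $\pi(n-1)=\frac1n$. Moreover, there exist explicit continuous functions $f_1,f_2:[0,\infty)\to[0,\infty)$, not depending on $n$, such that, for the chain started at $0$, $$f_1(\ell/n^2)\le\|K^\ell-\pi\|_{TV}\ \text{ for all }\ell,\qquad \|K^\ell-\pi\|_{TV}\le f_2(\ell/n^2)\ \text{ for all }\ell\ge n^2.$$ Here $f_1$ is monotone decreasing and strictly positive at $0$, and $f_2$ is positive, strictly decreasing, and tends to $0$ at infinity.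
   Context: $\mathfrak u_\xi(\mathfrak{sl}_2)$ is the $n^3$-dimensional Hopf algebra over $\mathbb C$ generated by $e,f,k$ with relations $e^n=0$, $f^n=0$, $k^n=1$, $kek^{-1}=\xi^2e$, $kfk^{-1}=\xi^{-2}f$, $ef-fe=\frac{k-k^{-1}}{\xi-\xi^{-1}}$, and coproduct $\Delta(e)=e\otimes k+1\otimes e$, $\Delta(f)=f\otimes1+k^{-1}\otimes f$, $\Delta(k)=k\otimes k$. Its irreducible modules up to isomorphism are $V_0,\dots,V_{n-1}$, where $V_r$ has basis $v_0,\dots,v_r$ with $kv_j=\xi^{r-2j}v_j$, $ev_j=[r-j+1]v_{j-1}$, $fv_j=[j+1]v_{j+1}$ ($v_s=0$ for $s\notin\{0,\dots,r\}$) and $[m]=\frac{\xi^m-\xi^{-m}}{\xi-\xi^{-1}}$. The tensor chain moves from $V_a$ to $V_b$ with probability $\frac{[V_1\otimes V_a:V_b]\dim V_b}{2\dim V_a}$, where $[\,\cdot:V_b]$ denotes composition-factor multiplicity. $\|K^\ell-\pi\|_{TV}=\frac12\sum_{y}|K^\ell(0,y)-\pi(y)|$. *)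

theory Defs
  imports Complex_Main "HOL-Algebra.Module" "HOL-Algebra.AbelCoset" "HOL-Library.Function_Algebras"
begin

section \<open>Modules over the small quantum group of sl2\<close>

definition xi :: "nat \<Rightarrow> complex" where
  "xi n = exp (2 * of_real pi * \<i> / of_nat n)"

definition qint :: "nat \<Rightarrow> int \<Rightarrow> complex" where
  "qint n m = (xi n powi m - xi n powi (- m)) / (xi n - inverse (xi n))"

definition complex_ring :: "complex ring" where
  "complex_ring = \<lparr>carrier = UNIV, mult = (*), one = 1, zero = 0, add = (+)\<rparr>"

text \<open>The algebra is given by generators \<open>e, f, k\<close> and relations, so a module over it is a
  complex vector space together with three linear operators that satisfy the relations. The fields
  \<open>mult\<close> and \<open>one\<close> inherited from the HOL-Algebra record of modules play no role.\<close>

record 'v umod = "(complex, 'v) module" +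
  act_e :: "'v \<Rightarrow> 'v"
  act_f :: "'v \<Rightarrow> 'v"
  act_k :: "'v \<Rightarrow> 'v"

definition linear_endo :: "('v, 'm) umod_scheme \<Rightarrow> ('v \<Rightarrow> 'v) \<Rightarrow> bool" where
  "linear_endo M g \<longleftrightarrow>
     (\<forall>x\<in>carrier M. g x \<in> carrier M) \<and>
     (\<forall>x\<in>carrier M. \<forall>y\<in>carrier M. g (x \<oplus>\<^bsub>M\<^esub> y) = g x \<oplus>\<^bsub>M\<^esub> g y) \<and>
     (\<forall>c. \<forall>x\<in>carrier M. g (c \<odot>\<^bsub>M\<^esub> x) = c \<odot>\<^bsub>M\<^esub> g x)"

text \<open>Since \<open>k\<^sup>n = 1\<close>, the inverse of \<open>k\<close> is its power with exponent \<open>n - 1\<close>.\<close>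

definition act_kinv :: "nat \<Rightarrow> ('v, 'm) umod_scheme \<Rightarrow> 'v \<Rightarrow> 'v" where
  "act_kinv n M = act_k M ^^ (n - 1)"

definition umodule :: "nat \<Rightarrow> ('v, 'm) umod_scheme \<Rightarrow> bool" where
  "umodule n M \<longleftrightarrow>
     module complex_ring M \<and>
     linear_endo M (act_e M) \<and> linear_endo M (act_f M) \<and> linear_endo M (act_k M) \<and>
     (\<forall>x\<in>carrier M.
        (act_e M ^^ n) x = \<zero>\<^bsub>M\<^esub> \<and>
        (act_f M ^^ n) x = \<zero>\<^bsub>M\<^esub> \<and>
        (act_k M ^^ n) x = x \<and>
        act_k M (act_e M (act_kinv n M x)) = (xi n powi 2) \<odot>\<^bsub>M\<^esub> act_e M x \<and>
        act_k M (act_f M (act_kinv n M x)) = (xi n powi (-2)) \<odot>\<^bsub>M\<^esub> act_f M x \<and>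
        act_e M (act_f M x) \<ominus>\<^bsub>M\<^esub> act_f M (act_e M x) =
          (1 / (xi n - inverse (xi n))) \<odot>\<^bsub>M\<^esub> (act_k M x \<ominus>\<^bsub>M\<^esub> act_kinv n M x))"

definition usubmodule :: "'v umod \<Rightarrow> 'v set \<Rightarrow> bool" where
  "usubmodule M W \<longleftrightarrow>
     submodule W complex_ring M \<and>
     act_e M ` W \<subseteq> W \<and> act_f M ` W \<subseteq> W \<and> act_k M ` W \<subseteq> W"

text \<open>The quotient by a submodule consists of the additive cosets. On a coset the unions below
  are unions of copies of one and the same coset.\<close>

definition uquotient :: "'v umod \<Rightarrow> 'v set \<Rightarrow> 'v set umod" where
  "uquotient M W =
     \<lparr>carrier = a_rcosets\<^bsub>M\<^esub> W, mult = undefined, one = undefined,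
      zero = W, add = set_add M,
      smult = (\<lambda>c X. \<Union>x\<in>X. W +>\<^bsub>M\<^esub> (c \<odot>\<^bsub>M\<^esub> x)),
      act_e = (\<lambda>X. \<Union>x\<in>X. W +>\<^bsub>M\<^esub> act_e M x),
      act_f = (\<lambda>X. \<Union>x\<in>X. W +>\<^bsub>M\<^esub> act_f M x),
      act_k = (\<lambda>X. \<Union>x\<in>X. W +>\<^bsub>M\<^esub> act_k M x)\<rparr>"

definition uiso :: "'v umod \<Rightarrow> 'w umod \<Rightarrow> bool" where
  "uiso M N \<longleftrightarrow>
     (\<exists>h. bij_betw h (carrier M) (carrier N) \<and>
          (\<forall>x\<in>carrier M. \<forall>y\<in>carrier M. h (x \<oplus>\<^bsub>M\<^esub> y) = h x \<oplus>\<^bsub>N\<^esub> h y) \<and>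
          (\<forall>c. \<forall>x\<in>carrier M. h (c \<odot>\<^bsub>M\<^esub> x) = c \<odot>\<^bsub>N\<^esub> h x) \<and>
          (\<forall>x\<in>carrier M. h (act_e M x) = act_e N (h x) \<and>
                          h (act_f M x) = act_f N (h x) \<and>
                          h (act_k M x) = act_k N (h x)))"

definition uirreducible :: "nat \<Rightarrow> 'v umod \<Rightarrow> bool" where
  "uirreducible n M \<longleftrightarrow>
     umodule n M \<and> carrier M \<noteq> {\<zero>\<^bsub>M\<^esub>} \<and>
     (\<forall>W. usubmodule M W \<longrightarrow> W = {\<zero>\<^bsub>M\<^esub>} \<or> W = carrier M)"

definition comp_factor :: "'v umod \<Rightarrow> 'v set list \<Rightarrow> nat \<Rightarrow> 'v set umod" where
  "comp_factor M Ws i = uquotient (M\<lparr>carrier := Ws ! Suc i\<rparr>) (Ws ! i)"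

definition comp_series :: "nat \<Rightarrow> 'v umod \<Rightarrow> 'v set list \<Rightarrow> bool" where
  "comp_series n M Ws \<longleftrightarrow>
     umodule n M \<and> Ws \<noteq> [] \<and> hd Ws = {\<zero>\<^bsub>M\<^esub>} \<and> last Ws = carrier M \<and>
     (\<forall>W\<in>set Ws. usubmodule M W) \<and>
     (\<forall>i. Suc i < length Ws \<longrightarrow>
        Ws ! i \<subseteq> Ws ! Suc i \<and> uirreducible n (comp_factor M Ws i))"

text \<open>By Jordan-Hoelder the number below does not depend on the composition series.\<close>

definition comp_mult :: "nat \<Rightarrow> 'v umod \<Rightarrow> 'w umod \<Rightarrow> nat" where
  "comp_mult n M S =
     (THE m. \<exists>Ws. comp_series n M Ws \<and>
        m = card {i. Suc i < length Ws \<and> uiso (comp_factor M Ws i) S})"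

section \<open>The modules $V_r$ and tensor products\<close>

definition fscale :: "complex \<Rightarrow> ('i \<Rightarrow> complex) \<Rightarrow> ('i \<Rightarrow> complex)" where
  "fscale c v = (\<lambda>i. c * v i)"

text \<open>\<open>vbasis r s\<close> is the basis vector \<open>v\<^sub>s\<close> of \<open>V\<^sub>r\<close>, with \<open>v\<^sub>s = 0\<close> for \<open>s\<close> outside \<open>0..r\<close>;
  an element of \<open>V\<^sub>r\<close> is its coordinate function. \<open>lin_ext r g\<close> is the linear map with
  \<open>v\<^sub>j \<mapsto> g j\<close>.\<close>

definition vbasis :: "nat \<Rightarrow> int \<Rightarrow> nat \<Rightarrow> complex" where
  "vbasis r s = (\<lambda>i. if int i = s \<and> i \<le> r then 1 else 0)"

definition lin_ext :: "nat \<Rightarrow> (nat \<Rightarrow> nat \<Rightarrow> complex) \<Rightarrow> (nat \<Rightarrow> complex) \<Rightarrow> (nat \<Rightarrow> complex)" where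
  "lin_ext r g v = (\<Sum>j\<le>r. fscale (v j) (g j))"

definition V :: "nat \<Rightarrow> nat \<Rightarrow> (nat \<Rightarrow> complex) umod" where
  "V n r =
     \<lparr>carrier = {v. \<forall>j>r. v j = 0}, mult = undefined, one = undefined,
      zero = 0, add = (+), smult = fscale,
      act_e = lin_ext r (\<lambda>j. fscale (qint n (int r - int j + 1)) (vbasis r (int j - 1))),
      act_f = lin_ext r (\<lambda>j. fscale (qint n (int j + 1)) (vbasis r (int j + 1))),
      act_k = lin_ext r (\<lambda>j. fscale (xi n powi (int r - 2 * int j)) (vbasis r (int j)))\<rparr>"

text \<open>Tensor products are only needed for spaces of coordinate functions: if \<open>M\<close> and \<open>N\<close> are the
  spaces of functions supported on finite sets \<open>I\<close> and \<open>J\<close>, then \<open>M \<otimes> N\<close> is the space of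
  functions supported on \<open>I \<times> J\<close>, the tensor of \<open>u\<close> and \<open>w\<close> being \<open>\<lambda>(i, j). u i * w j\<close>.
  The operator \<open>A \<otimes> B\<close> applies \<open>B\<close> in the second variable and then \<open>A\<close> in the first one.
  The actions are given by the coproduct
  \<open>e \<mapsto> e \<otimes> k + 1 \<otimes> e\<close>, \<open>f \<mapsto> f \<otimes> 1 + k\<^sup>-\<^sup>1 \<otimes> f\<close>, \<open>k \<mapsto> k \<otimes> k\<close>.\<close>

definition op_tensor ::
  "(('i \<Rightarrow> complex) \<Rightarrow> ('i \<Rightarrow> complex)) \<Rightarrow> (('j \<Rightarrow> complex) \<Rightarrow> ('j \<Rightarrow> complex)) \<Rightarrow>
   ('i \<times> 'j \<Rightarrow> complex) \<Rightarrow> ('i \<times> 'j \<Rightarrow> complex)" where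
  "op_tensor A B t = (\<lambda>(i, j). A (\<lambda>i'. B (\<lambda>j'. t (i', j')) j) i)"

definition utensor ::
  "nat \<Rightarrow> ('i \<Rightarrow> complex) umod \<Rightarrow> ('j \<Rightarrow> complex) umod \<Rightarrow> ('i \<times> 'j \<Rightarrow> complex) umod" where
  "utensor n M N =
     \<lparr>carrier = {t. (\<forall>j. (\<lambda>i. t (i, j)) \<in> carrier M) \<and> (\<forall>i. (\<lambda>j. t (i, j)) \<in> carrier N)},
      mult = undefined, one = undefined,
      zero = 0, add = (+), smult = fscale,
      act_e = (\<lambda>t. op_tensor (act_e M) (act_k N) t + op_tensor id (act_e N) t),
      act_f = (\<lambda>t. op_tensor (act_f M) id t + op_tensor (act_kinv n M) (act_f N) t),
      act_k = op_tensor (act_k M) (act_k N)\<rparr>"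

definition udim :: "('i \<Rightarrow> complex) umod \<Rightarrow> nat" where
  "udim M = vector_space.dim fscale (carrier M)"

definition tensor_chain :: "nat \<Rightarrow> nat \<Rightarrow> nat \<Rightarrow> real" where
  "tensor_chain n a b =
     real (comp_mult n (utensor n (V n 1) (V n a)) (V n b)) * real (udim (V n b)) /
       (2 * real (udim (V n a)))"

section \<open>The chain and total variation distance\<close>

text \<open>Chains on \<open>{0, \<dots>, n - 1}\<close> are given by their transition probabilities.\<close>

definition K :: "nat \<Rightarrow> nat \<Rightarrow> nat \<Rightarrow> real" where
  "K n a b =
     (if 1 \<le> a \<and> a \<le> n - 2 \<and> b = a - 1 then 1 / 2 * (1 - 1 / (real a + 1))
      else if a \<le> n - 2 \<and> b = a + 1 then 1 / 2 * (1 + 1 / (real a + 1))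
      else if a = n - 1 \<and> b = n - 2 then 1 - 1 / real n
      else if a = n - 1 \<and> b = 0 then 1 / real n
      else 0)"

definition stat :: "nat \<Rightarrow> nat \<Rightarrow> real" where
  "stat n j = (if j \<le> n - 2 then 2 * (real j + 1) / (real n)\<^sup>2 else 1 / real n)"

definition stochastic :: "nat \<Rightarrow> (nat \<Rightarrow> nat \<Rightarrow> real) \<Rightarrow> bool" where
  "stochastic n P \<longleftrightarrow> (\<forall>a<n. (\<forall>b<n. 0 \<le> P a b) \<and> (\<Sum>b<n. P a b) = 1)"

definition stationary :: "nat \<Rightarrow> (nat \<Rightarrow> nat \<Rightarrow> real) \<Rightarrow> (nat \<Rightarrow> real) \<Rightarrow> bool" where
  "stationary n P p \<longleftrightarrow>
     (\<forall>a<n. 0 \<le> p a) \<and> (\<Sum>a<n. p a) = 1 \<and> (\<forall>b<n. (\<Sum>a<n. p a * P a b) = p b)"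

primrec chain_power :: "nat \<Rightarrow> (nat \<Rightarrow> nat \<Rightarrow> real) \<Rightarrow> nat \<Rightarrow> nat \<Rightarrow> nat \<Rightarrow> real" where
  "chain_power n P 0 a b = (if a = b then 1 else 0)"
| "chain_power n P (Suc l) a b = (\<Sum>c<n. chain_power n P l a c * P c b)"

definition tv_dist :: "nat \<Rightarrow> (nat \<Rightarrow> real) \<Rightarrow> (nat \<Rightarrow> real) \<Rightarrow> real" where
  "tv_dist n p q = 1 / 2 * (\<Sum>y<n. \<bar>p y - q y\<bar>)"

end

theory Submission
  imports Defs
begin

text \<open>
  Composition multiplicities are well defined by the Jordan-Hoelder theorem, so it suffices to exhibit
  one composition series of each \<open>V\<^sub>1 \<otimes> V\<^sub>a\<close>. There is an exact sequence
  \<open>0 \<rightarrow> V\<^bsub>a+1\<^esub> \<rightarrow> V\<^sub>1 \<otimes> V\<^sub>a \<rightarrow> V\<^bsub>a-1\<^esub> \<rightarrow> 0\<close>, where for \<open>a = n - 1\<close> the module \<open>V\<^sub>n\<close> given by the same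
  formulas is no longer irreducible but has the factors \<open>V\<^sub>0, V\<^sub>0, V\<^bsub>n-2\<^esub>\<close>.

  For the chain put \<open>x = a + 1\<close>. The test function \<open>x\<^sup>2\<close> grows by at most 3 per step in expectation,
  while its stationary mean is about \<open>n\<^sup>2 / 2\<close>; this gives the lower bound. For the upper bound,
  \<open>\<mu>\<^sub>l(x) / x\<close> (doubled at \<open>x = n\<close>) obeys simple averaging over neighbours with boundary conditions
  \<open>R(0) = R(n)\<close> and \<open>R(n + 1) = R(n - 1)\<close>. It is solved by a finite Fourier sum with frequencies
  \<open>2 \<pi> j / n\<close>, in which the doubling of the eigenvalues produces terms linear in \<open>l\<close> and in \<open>n - x\<close>.
\<close>

section \<open>The Markov chain\<close>

text \<open>With x = a + 1, an interior step from x to y has probability y / (2 x), so dividing a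
  law by x turns \<open>K\<close> into plain averaging; the step down from n has twice that weight,
  which explains the different normalisation there. Oddness of n enters twice. The square of
  \<open>xi n\<close> still has order n, so the quantum integer [m] vanishes only for multiples of
  n; and doubling permutes the nonzero residues, so that the contributions of the nonzero
  frequencies can be bounded by a geometric series. The restriction l >= n^2 makes it possible to
  absorb the terms linear in l and n - x into an exponential. On the algebraic side, the two
  summands in the coproduct of e or f commute only up to a power of xi, so their n-th powers on the
  tensor product are not visibly zero; the embedded copy of \<open>V_(a+1)\<close> supplies the
  nilpotency. Multiplicities are found by splitting off one irreducible quotient after another, and
  for a = n - 1 a filtration of \<open>V_n\<close> is pulled back to the tensor product.\<close>

lemma sum_K:
  assumes n: "3 \<le> n"
    and p: "\<And>a. a < n - 1 \<Longrightarrow> p a = real (a + 1) * R (a + 1)" "p (n - 1) = real n * R n / 2"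
    and R0: "R 0 = R n" and b: "b < n"
  shows "(\<Sum>a<n. p a * K n a b) =
    (if b = n - 1 then real n * R (n - 1) / 2 else real (b + 1) * ((R b + R (b + 2)) / 2))"
proof -
  \<comment> \<open>State 0 takes mass from 1 and from the wrap at n - 1, where
    \<open>R 0 = R n\<close> supplies the missing left neighbour. State n - 2 takes mass from n - 1
    with twice the generic weight, which the halved \<open>p (n - 1)\<close> compensates. State n -
    1 has the single predecessor n - 2.\<close>
  consider "b = 0" | "1 \<le> b" "b \<le> n - 3" | "b = n - 2" | "b = n - 1"
    using n b by atomize_elim arith
  then show ?thesis
  proof cases
    case 1
    have "(\<Sum>a<n. p a * K n a b) = (\<Sum>a\<in>{1, n - 1}. p a * K n a b)"
      using n 1 by (intro sum.mono_neutral_right) (auto simp: K_def)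
    also have "\<dots> = p 1 * (1 / 4) + p (n - 1) * (1 / real n)"
      using n 1 by (auto simp: K_def)
    finally show ?thesis
      using n 1 p(1)[of 1] p(2) R0 by (simp add: numeral_2_eq_2)
  next
    case 2
    then obtain c where c: "b = Suc c" by (cases b) auto
    have "(\<Sum>a<n. p a * K n a b) = (\<Sum>a\<in>{c, c + 2}. p a * K n a b)"
      using n 2 c by (intro sum.mono_neutral_right) (auto simp: K_def)
    also have "\<dots> = p c * (1 / 2 * (1 + 1 / (real c + 1))) + p (c + 2) * (1 / 2 * (1 - 1 / (real c + 3)))"
      using n 2 c by (auto simp: K_def)
    also have "\<dots> = (real c + 1) * (1 / 2 * (1 + 1 / (real c + 1))) * R (c + 1)
        + (real c + 3) * (1 / 2 * (1 - 1 / (real c + 3))) * R (c + 3)"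
    proof -
      have "p c = (real c + 1) * R (c + 1)" "p (c + 2) = (real c + 3) * R (c + 3)"
        using n 2 c p(1)[of c] p(1)[of "c + 2"] by (simp_all add: numeral_3_eq_3)
      then show ?thesis by (simp only: mult_ac)
    qed
    also have "(real c + 1) * (1 / 2 * (1 + 1 / (real c + 1))) = (real c + 2) / 2"
      by (simp add: field_simps)
    also have "(real c + 3) * (1 / 2 * (1 - 1 / (real c + 3))) = (real c + 2) / 2"
      by (simp add: field_simps)
    also have "(real c + 2) / 2 * R (c + 1) + (real c + 2) / 2 * R (c + 3)
      = real (b + 1) * ((R b + R (b + 2)) / 2)"
      using c by (simp add: field_simps numeral_3_eq_3)
    finally show ?thesis using 2 n by auto
  next
    case 3
    then obtain c where c: "b = Suc c" "n = c + 3" using n by (auto dest!: le_Suc_ex)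
    have "(\<Sum>a<n. p a * K n a b) = (\<Sum>a\<in>{c, c + 2}. p a * K n a b)"
      using c by (intro sum.mono_neutral_right) (auto simp: K_def)
    also have "\<dots> = p c * (1 / 2 * (1 + 1 / (real c + 1))) + p (c + 2) * (1 - 1 / (real c + 3))"
      using c by (auto simp: K_def)
    also have "\<dots> = (real c + 1) * (1 / 2 * (1 + 1 / (real c + 1))) * R (c + 1)
        + (real c + 3) * (1 / 2 * (1 - 1 / (real c + 3))) * R (c + 3)"
    proof -
      have "p c = (real c + 1) * R (c + 1)" "p (c + 2) = (real c + 3) * R (c + 3) / 2"
        using c p(1)[of c] p(2) by (simp_all add: numeral_3_eq_3)
      then show ?thesis
        by (simp only: mult_ac times_divide_eq_left times_divide_eq_right mult_1_left mult_1_right)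
    qed
    also have "(real c + 1) * (1 / 2 * (1 + 1 / (real c + 1))) = (real c + 2) / 2"
      by (simp add: field_simps)
    also have "(real c + 3) * (1 / 2 * (1 - 1 / (real c + 3))) = (real c + 2) / 2"
      by (simp add: field_simps)
    also have "(real c + 2) / 2 * R (c + 1) + (real c + 2) / 2 * R (c + 3)
      = real (b + 1) * ((R b + R (b + 2)) / 2)"
      using c by (simp add: field_simps numeral_3_eq_3)
    finally show ?thesis using 3 n by auto
  next
    case 4
    have "(\<Sum>a<n. p a * K n a b) = (\<Sum>a\<in>{n - 2}. p a * K n a b)"
      using n 4 by (intro sum.mono_neutral_right) (auto simp: K_def)
    also have "\<dots> = p (n - 2) * (1 / 2 * (1 + 1 / (real n - 1)))"
      using n 4 by (auto simp: K_def of_nat_diff)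
    also have "\<dots> = real n * R (n - 1) / 2"
    proof -
      have "n - 2 + 1 = n - 1" using n by simp
      then have "p (n - 2) = (real n - 1) * R (n - 1)"
        using n p(1)[of "n - 2"] by (simp add: of_nat_diff del: One_nat_def)
      moreover have "(real n - 1) * (1 / 2 * (1 + 1 / (real n - 1))) = real n / 2"
        using n by (simp add: field_simps)
      ultimately show ?thesis by (metis mult.assoc mult.commute times_divide_eq_left)
    qed
    finally show ?thesis using 4 by simp
  qed
qed

lemma sum_stat: 
  assumes "3 \<le> n" shows "(\<Sum>a<n. stat n a) = 1"
proof -
  obtain m where m: "n = Suc m" "m \<ge> 2" using assms by (cases n) auto
  have "(\<Sum>a<m. stat n a) = (\<Sum>a<m. 2 / (real n)\<^sup>2 * (real a + 1))"
    using m by (intro sum.cong) (auto simp: stat_def)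
  also have "\<dots> = 2 / (real n)\<^sup>2 * (\<Sum>a<m. real a + 1)"
    by (simp only: sum_distrib_left)
  also have "(\<Sum>a<m. real a + 1) = real m * (real m + 1) / 2"
    by (induction m) (auto simp: field_simps)
  also have "2 / (real n)\<^sup>2 * \<dots> = 1 - 1 / real n"
    using m by (simp add: divide_simps power2_eq_square)
  finally have "(\<Sum>a<m. stat n a) = 1 - 1 / real n" .
  moreover have "stat n m = 1 / real n" using m by (auto simp: stat_def)
  ultimately show ?thesis using m by simp
qed

text \<open>The constant density 2 / n^2 is invariant under the averaging of \<open>sum_K\<close>
  and meets the wrap condition; multiplied by x, and halved at x = n, it is
  \<open>stat\<close>.\<close>

lemma stationary_stat:
  assumes "3 \<le> n" shows "stationary n (K n) (stat n)"
proof -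
  have "(\<Sum>a<n. stat n a * K n a b) = stat n b" if b: "b < n" for b
  proof -
    have "(\<Sum>a<n. stat n a * K n a b) =
      (if b = n - 1 then real n * (2 / (real n)\<^sup>2) / 2
       else real (b + 1) * ((2 / (real n)\<^sup>2 + 2 / (real n)\<^sup>2) / 2))"
      using assms b
      by (intro sum_K[where R = "\<lambda>_. 2 / (real n)\<^sup>2"]) (auto simp: stat_def power2_eq_square)
    also have "\<dots> = stat n b"
      using assms b by (auto simp: stat_def power2_eq_square)
    finally show ?thesis .
  qed
  then show ?thesis
    using sum_stat[OF assms] by (auto simp: stationary_def stat_def)
qed

lemma K_row:
  assumes n: "3 \<le> n" and a: "a < n"
  shows "(\<Sum>b<n. K n a b * g b) = 
     (if a = 0 then g 1 else if a = n - 1 then (1 - 1 / real n) * g (n - 2) + 1 / real n * g 0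
      else 1 / 2 * (1 - 1 / (real a + 1)) * g (a - 1) + 1 / 2 * (1 + 1 / (real a + 1)) * g (a + 1))"
proof -
  consider "a = 0" | "1 \<le> a" "a \<le> n - 2" | "a = n - 1"
    using n a by atomize_elim arith
  then show ?thesis
  proof cases
    case 1
    have "(\<Sum>b<n. K n a b * g b) = (\<Sum>b\<in>{1}. K n a b * g b)"
      using n 1 by (intro sum.mono_neutral_right) (auto simp: K_def)
    then show ?thesis using 1 n by (simp add: K_def)
  next
    case 2
    have "(\<Sum>b<n. K n a b * g b) = (\<Sum>b\<in>{a - 1, a + 1}. K n a b * g b)"
      using n 2 by (intro sum.mono_neutral_right) (auto simp: K_def)
    moreover have "a \<noteq> 0" "a \<noteq> n - 1" "a - 1 \<noteq> a + 1" using 2 n by arith+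
    ultimately show ?thesis using 2 n by (simp add: K_def)
  next
    case 3
    have "(\<Sum>b<n. K n a b * g b) = (\<Sum>b\<in>{n - 2, 0}. K n a b * g b)"
      using n 3 by (intro sum.mono_neutral_right) (auto simp: K_def)
    moreover have "a \<noteq> 0" "n - 2 \<noteq> 0" "\<not> a \<le> n - 2" using 3 n by arith+
    ultimately show ?thesis using 3 n by (simp add: K_def)
  qed
qed

lemma stochastic_K:
  assumes n: "3 \<le> n" shows "stochastic n (K n)"
proof -
  have "0 \<le> K n a b" for a b
    using n by (auto simp: K_def intro!: mult_nonneg_nonneg)
  moreover have "(\<Sum>b<n. K n a b) = 1" if "a < n" for a
  proof -
    have "1 / 2 * (1 - 1 / (real a + 1)) + 1 / 2 * (1 + 1 / (real a + 1)) = 1"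
      by (simp add: algebra_simps)
    then show ?thesis using K_row[OF n that, of "\<lambda>_. 1"] by (simp split: if_splits)
  qed
  ultimately show ?thesis by (simp add: stochastic_def)
qed

section \<open>Lower bound through the second moment\<close>

lemma chain_power_nonneg:
  assumes "3 \<le> n" "b < n" shows "0 \<le> chain_power n (K n) l a b"
  using assms(2) stochastic_K[OF assms(1)]
  by (induction l arbitrary: b) (auto intro!: sum_nonneg simp: stochastic_def)

lemma chain_power_expect:
  "(\<Sum>b<n. chain_power n P (Suc l) a b * g b) =
    (\<Sum>c<n. chain_power n P l a c * (\<Sum>b<n. P c b * g b))"
  by (simp add: sum_distrib_left sum_distrib_right mult.assoc) (rule sum.swap)

lemma sum_chain_power:
  assumes "3 \<le> n" "a < n" shows "(\<Sum>b<n. chain_power n (K n) l a b) = 1"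
proof (induction l)
  case 0 then show ?case using assms by simp
next
  case (Suc l)
  have "(\<Sum>b<n. chain_power n (K n) (Suc l) a b) = (\<Sum>c<n. chain_power n (K n) l a c * (\<Sum>b<n. K n c b))"
    using chain_power_expect[of n "K n" l a "\<lambda>_. 1"] by simp
  also have "\<dots> = (\<Sum>c<n. chain_power n (K n) l a c)"
    using stochastic_K[OF assms(1)] by (simp add: stochastic_def)
  finally show ?case using Suc by simp
qed

text \<open>In the interior ((x - 1)^3 + (x + 1)^3) / (2 x) = x^2 + 3, so the drift is exactly 3,
  and x = 1 gives 4 = 1 + 3. From x = n the chain only moves to smaller values, so the same bound
  holds there.\<close>

lemma chain_power_square_moment:
  assumes n: "3 \<le> n"
  shows "(\<Sum>b<n. chain_power n (K n) l 0 b * (real b + 1)\<^sup>2) \<le> 1 + 3 * real l"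
proof (induction l)
  case 0 
  have "(\<Sum>b<n. chain_power n (K n) 0 0 b * (real b + 1)\<^sup>2) = 
    (\<Sum>b<n. if b = 0 then 1 else 0)"
    by (intro sum.cong) auto
  then show ?case using n by simp
next
  case (Suc l)
  have *: "(\<Sum>b<n. K n c b * (real b + 1)\<^sup>2) \<le> (real c + 1)\<^sup>2 + 3" if "c < n" for c
  proof -
    consider "c = 0" | "c \<noteq> 0" "c \<noteq> n - 1" | "c = n - 1" "c \<noteq> 0"
      by blast
    then show ?thesis
    proof cases
      case 1
      then show ?thesis using K_row[OF n that, of "\<lambda>b. (real b + 1)\<^sup>2"] by simp
    next
      case 2
      define x where "x = real c + 1"
      have "(\<Sum>b<n. K n c b * (real b + 1)\<^sup>2)
          = 1 / 2 * (1 - 1 / x) * (x - 1)\<^sup>2 + 1 / 2 * (1 + 1 / x) * (x + 1)\<^sup>2"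
      proof -
        have "real (c - 1) + 1 = x - 1" "real (c + 1) + 1 = x + 1" using 2 by (auto simp: x_def)
        then show ?thesis using 2 unfolding K_row[OF n that, of "\<lambda>b. (real b + 1)\<^sup>2"] x_def by simp
      qed
      also have "\<dots> = x\<^sup>2 + 3"
      proof -
        have "x \<noteq> 0" unfolding x_def by simp
        then show ?thesis by (simp add: field_simps power2_eq_square)
      qed
      finally show ?thesis by (simp add: x_def)
    next
      case 3
      have r: "real c = real n - 1" "real (n - 2) = real n - 2" using 3 n by (auto simp: of_nat_diff)
      have "(\<Sum>b<n. K n c b * (real b + 1)\<^sup>2) = (1 - 1 / real n) * (real n - 1)\<^sup>2 + 1 / real n"
        using K_row[OF n that, of "\<lambda>b. (real b + 1)\<^sup>2"] 3 r by simp
      also have "\<dots> \<le> 1 * (real n)\<^sup>2 + 1"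
        using n by (intro add_mono mult_mono power_mono) auto
      finally show ?thesis using r by simp
    qed
  qed
  have "(\<Sum>b<n. chain_power n (K n) (Suc l) 0 b * (real b + 1)\<^sup>2) =
    (\<Sum>c<n. chain_power n (K n) l 0 c * (\<Sum>b<n. K n c b * (real b + 1)\<^sup>2))"
    by (rule chain_power_expect)
  also have "\<dots> \<le> (\<Sum>c<n. chain_power n (K n) l 0 c * ((real c + 1)\<^sup>2 + 3))"
    using * chain_power_nonneg[OF n] by (intro sum_mono mult_left_mono) auto
  also have "\<dots> = (\<Sum>c<n. chain_power n (K n) l 0 c * (real c + 1)\<^sup>2) + 3 * (\<Sum>c<n. chain_power n (K n) l 0 c)"
    by (simp add: algebra_simps sum.distrib sum_distrib_left)
  also have "\<dots> \<le> 1 + 3 * real l + 3" using Suc sum_chain_power[OF n, of 0] n by simp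
  finally show ?case by simp
qed

lemma stat_square_moment:
  assumes n: "3 \<le> n"
  shows "(\<Sum>a<n. stat n a * (real a + 1)\<^sup>2) = ((real n)\<^sup>2 + 1) / 2"
proof -
  obtain m where m: "n = Suc m" "m \<ge> 2" using assms by (cases n) auto
  have "(\<Sum>a<m. stat n a * (real a + 1)\<^sup>2) = (\<Sum>a<m. 2 / (real n)\<^sup>2 * (real a + 1)^3)"
    using m by (intro sum.cong) (auto simp: stat_def power3_eq_cube power2_eq_square)
  also have "\<dots> = 2 / (real n)\<^sup>2 * (\<Sum>a<m. (real a + 1)^3)"
    by (simp only: sum_distrib_left)
  also have "(\<Sum>a<m. (real a + 1)^3) = (real m * (real m + 1))\<^sup>2 / 4"
    by (induction m) (auto simp: field_simps power3_eq_cube power2_eq_square)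
  also have "2 / (real n)\<^sup>2 * \<dots> = (real m)\<^sup>2 / 2"
    using m by (simp add: divide_simps power_mult_distrib)
  finally have "(\<Sum>a<m. stat n a * (real a + 1)\<^sup>2) = (real m)\<^sup>2 / 2" .
  moreover have "stat n m * (real m + 1)\<^sup>2 = real m + 1"
    using m by (auto simp: stat_def power2_eq_square)
  ultimately show ?thesis using m by (simp add: field_simps power2_eq_square)
qed

lemma tv_dist_ge_expect_diff:
  assumes "\<And>y. y < n \<Longrightarrow> 0 \<le> g y \<and> g y \<le> 1" and "(\<Sum>y<n. p y) = (\<Sum>y<n. q y)"
  shows "(\<Sum>y<n. q y * g y) - (\<Sum>y<n. p y * g y) \<le> tv_dist n p q"
proof -
  \<comment> \<open>Equal total masses allow g to be shifted by 1/2, and |g - 1/2| <= 1/2 then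
    produces the factor 1/2 of \<open>tv_dist\<close>.\<close>
  have "(\<Sum>y<n. q y * g y) - (\<Sum>y<n. p y * g y) = (\<Sum>y<n. (q y - p y) * (g y - 1 / 2))"
    using assms(2) by (simp add: algebra_simps sum.distrib sum_subtractf sum_divide_distrib[symmetric])
  also have "\<dots> \<le> (\<Sum>y<n. \<bar>p y - q y\<bar> * (1 / 2))"
  proof (intro sum_mono)
    fix y assume "y \<in> {..<n}"
    then have "\<bar>g y - 1 / 2\<bar> \<le> 1 / 2" using assms(1)[of y] by (intro abs_leI) auto
    then have "\<bar>q y - p y\<bar> * \<bar>g y - 1 / 2\<bar> \<le> \<bar>p y - q y\<bar> * (1 / 2)"
      by (intro mult_mono) auto
    then show "(q y - p y) * (g y - 1 / 2) \<le> \<bar>p y - q y\<bar> * (1 / 2)"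
      by (metis abs_ge_self abs_mult order_trans)
  qed
  finally show ?thesis by (simp add: tv_dist_def sum_distrib_left mult.commute sum_divide_distrib)
qed

text \<open>The test function is x^2 / n^2, with values in [0, 1]. The means differ by at least 1/2
  - 1/(2 n^2) - 3 l / n^2, and n >= 3 makes the first two terms at least 4/9.\<close>

lemma tv_dist_lower:
  assumes n: "3 \<le> n"
  shows "4 / 9 - 3 * (real l / (real n)\<^sup>2) \<le> tv_dist n (chain_power n (K n) l 0) (stat n)"
proof -
  let ?g = "\<lambda>y. (real y + 1)\<^sup>2 / (real n)\<^sup>2"
  have "(real y + 1)\<^sup>2 \<le> (real n)\<^sup>2" if "y < n" for y
    using that by (intro power_mono) auto
  then have "(\<Sum>y<n. stat n y * ?g y) - (\<Sum>y<n. chain_power n (K n) l 0 y * ?g y)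
      \<le> tv_dist n (chain_power n (K n) l 0) (stat n)"
    using n sum_chain_power[OF n, of 0 l] sum_stat[OF n] by (intro tv_dist_ge_expect_diff) auto
  moreover have "(\<Sum>y<n. stat n y * ?g y) = ((real n)\<^sup>2 + 1) / 2 / (real n)\<^sup>2"
    unfolding stat_square_moment[OF n, symmetric] by (simp add: sum_divide_distrib)
  moreover have "(\<Sum>y<n. chain_power n (K n) l 0 y * ?g y) \<le> (1 + 3 * real l) / (real n)\<^sup>2"
    using divide_right_mono[OF chain_power_square_moment[OF n, of l], of "(real n)\<^sup>2"]
    by (simp add: sum_divide_distrib)
  moreover have "4 / 9 - 3 * (real l / (real n)\<^sup>2) \<le> ((real n)\<^sup>2 + 1) / 2 / (real n)\<^sup>2 - (1 + 3 * real l) / (real n)\<^sup>2"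
  proof -
    have "3\<^sup>2 \<le> (real n)\<^sup>2" using n by (intro power_mono) auto
    then have "1 / (real n)\<^sup>2 \<le> 1 / 9" using n by (intro divide_left_mono) auto
    moreover have "((real n)\<^sup>2 + 1) / 2 / (real n)\<^sup>2 = 1 / 2 + 1 / (real n)\<^sup>2 / 2"
      using n by (simp add: add_divide_distrib)
    moreover have "(1 + 3 * real l) / (real n)\<^sup>2 = 1 / (real n)\<^sup>2 + 3 * (real l / (real n)\<^sup>2)"
      by (simp add: add_divide_distrib)
    moreover have "4 / 9 - 3 * v \<le> 1 / 2 + u / 2 - (u + 3 * v)" if "u \<le> 1 / 9" for u v :: real
      using that by simp
    ultimately show ?thesis by metis
  qed
  ultimately show ?thesis by linarith
qed

section \<open>Fourier solution of the averaging recursion\<close>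

lemma sum_cos_roots_of_unity:
  fixes m n :: nat
  assumes n: "0 < n"
  shows "(\<Sum>j<n. cos (real m * (2 * pi * real j / real n))) = (if n dvd m then real n else 0)"
proof -
  define w where "w = cis (2 * pi * real m / real n)"
  have cw: "cos (real m * (2 * pi * real j / real n)) = Re (w ^ j)" for j
    by (simp add: w_def DeMoivre field_simps)
  have wn: "w ^ n = 1"
    using n by (simp add: w_def DeMoivre)
  show ?thesis
  proof (cases "n dvd m")
    case True
    then obtain k where k: "m = n * k" by auto
    have "w = cis (2 * pi * real k)" unfolding w_def using n k by (simp add: field_simps)
    then have "w = 1" using cis_multiple_2pi[of "real k"] by simp
    then show ?thesis using True by (simp only: cw) simp
  next
    case False
    have "w \<noteq> 1"
    proof
      assume "w = 1"
      then have "cos (2 * pi * real m / real n) = 1" unfolding w_def by (simp add: complex_eq_iff)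
      then obtain x :: int where "2 * pi * real m / real n = of_int x * 2 * pi"
        by (auto simp: cos_one_2pi_int)
      then have "real m = of_int x * real n" using n by (simp add: field_simps)
      then have "int m = x * int n"
        by (metis of_int_eq_iff of_int_mult of_int_of_nat_eq)
      then have "int n dvd int m" by simp
      then show False using False by simp
    qed
    then have "(\<Sum>j<n. w ^ j) = 0" using geometric_sum[of w n] wn by simp
    then show ?thesis using False unfolding cw by (metis Re_sum zero_complex.sel(1))
  qed
qed

text \<open>With \<open>t = 2 \<pi> j / n\<close>, the vectors \<open>x cos (x t)\<close> and \<open>x (n - x) sin (x t)\<close>, halved at \<open>x = n\<close>, span
  the generalized left eigenspace of \<open>K n\<close> for the eigenvalue \<open>cos t\<close>. For \<open>l = 0\<close> the term with
  \<open>cos t ^ (l - 1)\<close> vanishes because of the factor \<open>l\<close>.\<close>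

definition spectral_term :: "real \<Rightarrow> nat \<Rightarrow> real \<Rightarrow> real \<Rightarrow> real" where
  "spectral_term N l x t =
     (cos t ^ (l + 1) - real l * cos t ^ (l - 1) * (sin t)\<^sup>2) * cos (x * t) +
     (N - x) * cos t ^ l * sin t * sin (x * t)"

text \<open>For j = 0 the summand is 1 for all l and x, which yields the stationary density 2 / n^2;
  the other frequencies carry the deviation from it. The prefactor is fixed by the initial value in
  \<open>spectral_density_0\<close>.\<close>

definition spectral_density :: "nat \<Rightarrow> nat \<Rightarrow> nat \<Rightarrow> real" where
  "spectral_density n l x =
     2 / (real n)\<^sup>2 * (\<Sum>j<n. spectral_term n l x (2 * pi * real j / real n))"

text \<open>Averaging over x - 1 and x + 1 multiplies cos(x t) and sin(x t) by cos t, but the factor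
  N - x in addition feeds - sin t times the sine coefficient B into the cosine coefficient A. This
  Jordan block creates the term linear in l.\<close>

lemma spectral_term_Suc:
  "spectral_term N (Suc l) x t = (spectral_term N l (x - 1) t + spectral_term N l (x + 1) t) / 2"
proof -
  have c: "cos ((x - 1) * t) + cos ((x + 1) * t) = 2 * cos t * cos (x * t)"
    and s: "(N - (x - 1)) * sin ((x - 1) * t) + (N - (x + 1)) * sin ((x + 1) * t) =
      2 * (N - x) * cos t * sin (x * t) - 2 * sin t * cos (x * t)"
    by (simp_all add: algebra_simps cos_add cos_diff sin_add sin_diff)
  have p: "real l * cos t ^ (l - 1) * cos t = real l * cos t ^ l" by (cases l) auto
  define A where "A = cos t ^ (l + 1) - real l * cos t ^ (l - 1) * (sin t)\<^sup>2"
  define B where "B = cos t ^ l * sin t"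
  have "spectral_term N l (x - 1) t + spectral_term N l (x + 1) t
      = A * (cos ((x - 1) * t) + cos ((x + 1) * t))
        + B * ((N - (x - 1)) * sin ((x - 1) * t) + (N - (x + 1)) * sin ((x + 1) * t))"
    unfolding spectral_term_def A_def B_def by (simp add: algebra_simps)
  also have "\<dots> = 2 * ((A * cos t - B * sin t) * cos (x * t) + (N - x) * (B * cos t) * sin (x * t))"
    unfolding c s by (simp add: algebra_simps)
  also have "A * cos t - B * sin t = cos t ^ (Suc l + 1) - real (Suc l) * cos t ^ (Suc l - 1) * (sin t)\<^sup>2"
  proof -
    have "A * cos t = cos t ^ (Suc l + 1) - (real l * cos t ^ (l - 1) * cos t) * (sin t)\<^sup>2"
      by (simp add: A_def algebra_simps)
    then show ?thesis unfolding p by (simp add: B_def algebra_simps power2_eq_square)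
  qed
  also have "B * cos t = cos t ^ Suc l * sin t" by (simp add: B_def)
  finally show ?thesis by (simp add: spectral_term_def)
qed

lemma spectral_density_Suc:
  "spectral_density n (Suc l) (Suc x) = (spectral_density n l x + spectral_density n l (x + 2)) / 2"
proof -
  have "real (Suc x) - 1 = real x" "real (Suc x) + 1 = real (x + 2)" by auto
  then have "spectral_density n (Suc l) (Suc x) = 2 / (real n)\<^sup>2 *
    (\<Sum>j<n. (spectral_term n l x (2 * pi * real j / real n) + spectral_term n l (x + 2) (2 * pi * real j / real n)) / 2)"
    by (simp only: spectral_density_def spectral_term_Suc)
  then show ?thesis
    by (simp add: spectral_density_def sum.distrib sum_divide_distrib[symmetric] distrib_left)
qed

lemma cos_sin_reflect:
  assumes "0 < n"
  shows "cos ((real n + x) * (2 * pi * real j / real n)) = cos (x * (2 * pi * real j / real n))"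
    and "sin ((real n + x) * (2 * pi * real j / real n)) = sin (x * (2 * pi * real j / real n))"
proof -
  have "(real n + x) * (2 * pi * real j / real n) = x * (2 * pi * real j / real n) + 2 * pi * real j"
    using assms by (simp add: field_simps)
  moreover have "cos (2 * pi * real j) = 1" "sin (2 * pi * real j) = 0"
    using cos_int_2pin[of "int j"] sin_int_2pin[of "int j"] by simp_all
  ultimately show "cos ((real n + x) * (2 * pi * real j / real n)) = cos (x * (2 * pi * real j / real n))"
    "sin ((real n + x) * (2 * pi * real j / real n)) = sin (x * (2 * pi * real j / real n))"
    by (simp_all only: cos_add sin_add)
qed

text \<open>At x = 0 and x = n the sine vanishes, and the cosine has period n in x. Between n + 1
  and n - 1 both N - x and the sine change sign, so their product agrees.\<close>

lemma spectral_density_boundary: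
  assumes "0 < n"
  shows "spectral_density n l 0 = spectral_density n l n"
    and "spectral_density n l (n + 1) = spectral_density n l (n - 1)"
proof -
  have "spectral_term n l 0 (2 * pi * real j / real n) = spectral_term n l n (2 * pi * real j / real n)" for j
    using cos_sin_reflect[OF assms, of 0 j] by (simp add: spectral_term_def)
  then show "spectral_density n l 0 = spectral_density n l n"
    by (simp add: spectral_density_def)
  have "spectral_term n l (real n + 1) (2 * pi * real j / real n)
      = spectral_term n l (real n + - 1) (2 * pi * real j / real n)" for j
    unfolding spectral_term_def cos_sin_reflect[OF assms] by simp
  then show "spectral_density n l (n + 1) = spectral_density n l (n - 1)"
    using assms by (simp add: spectral_density_def of_nat_diff algebra_simps)
qed

text \<open>Product formulas turn the term for l = 0 into cosines of (x - 1) t and (x + 1) t.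
  Orthogonality keeps the first only at x = 1; the second would survive at x = n - 1, but its
  coefficient n - x - 1 vanishes there.\<close>

lemma spectral_density_0:
  assumes n: "3 \<le> n" and x: "1 \<le> x" "x \<le> n"
  shows "spectral_density n 0 x = (if x = 1 then 1 else 0)"
proof -
  obtain y where y: "x = Suc y" using x by (cases x) auto
  have *: "spectral_term n 0 x t = (real n - real x + 1) / 2 * cos (real y * t)
      - (real n - real x - 1) / 2 * cos (real (y + 2) * t)" for t
  proof -
    have "real y * t = real x * t - t" "real (y + 2) * t = real x * t + t"
      using y by (auto simp: algebra_simps)
    then have c: "cos (real y * t) = cos (real x * t) * cos t + sin (real x * t) * sin t"
      "cos (real (y + 2) * t) = cos (real x * t) * cos t - sin (real x * t) * sin t"
      by (simp_all only: cos_add cos_diff)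
    show ?thesis
      unfolding c by (simp add: spectral_term_def field_simps)
  qed
  have "spectral_density n 0 x = 2 / (real n)\<^sup>2 *
     ((real n - real x + 1) / 2 * (if n dvd y then real n else 0)
      - (real n - real x - 1) / 2 * (if n dvd y + 2 then real n else 0))"
    using n unfolding spectral_density_def *
    by (simp only: sum_subtractf sum_distrib_left[symmetric] sum_cos_roots_of_unity)
  moreover have "n dvd y \<longleftrightarrow> x = 1" using x y by (auto dest: dvd_imp_le)
  moreover have "n dvd y + 2 \<longleftrightarrow> x = n - 1"
  proof
    assume "n dvd y + 2"
    then obtain k where k: "y + 2 = n * k" by auto
    have "k \<noteq> 0" using k by (intro notI) simp
    moreover have "\<not> 2 \<le> k"
    proof
      assume "2 \<le> k"
      then have "n * 2 \<le> n * k" by simp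
      then show False using k y x n by linarith
    qed
    ultimately have "k = 1" by linarith
    then show "x = n - 1" using k y by simp
  qed (use y n in auto)
  ultimately show ?thesis using n by (auto simp: power2_eq_square of_nat_diff)
qed

lemma chain_power_eq_spectral_density:
  assumes n: "3 \<le> n" and b: "b < n"
  shows "chain_power n (K n) l 0 b =
    (if b = n - 1 then real n * spectral_density n l n / 2 else real (b + 1) * spectral_density n l (b + 1))"
  using b
proof (induction l arbitrary: b)
  case 0
  then show ?case using n by (auto simp: spectral_density_0)
next
  case (Suc l)
  let ?R = "spectral_density n l"
  have "chain_power n (K n) (Suc l) 0 b = 
    (if b = n - 1 then real n * ?R (n - 1) / 2 else real (b + 1) * ((?R b + ?R (b + 2)) / 2))"
    unfolding chain_power.simps using n Suc.prems spectral_density_boundary(1)[of n l]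
    by (intro sum_K) (auto simp: Suc.IH)
  \<comment> \<open>Reflection at n makes the densities at both neighbours of n equal, so their
    average is the value that \<open>sum_K\<close> gives at b = n - 1.\<close>
  moreover have "spectral_density n (Suc l) n = ?R (n - 1)"
    using n spectral_density_Suc[of n l "n - 1"] spectral_density_boundary(2)[of n l] by simp
  ultimately show ?case using spectral_density_Suc[of n l b] by simp
qed

section \<open>Upper bound: decay of the nonzero frequencies\<close>

definition spectral_bound :: "nat \<Rightarrow> nat \<Rightarrow> real \<Rightarrow> real" where
  "spectral_bound n l t = \<bar>cos t\<bar> ^ (l + 1) + real l * \<bar>cos t\<bar> ^ (l - 1) * (sin t)\<^sup>2 + real n * \<bar>cos t\<bar> ^ l * \<bar>sin t\<bar>"

lemma abs_spectral_term_le: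
  assumes "1 \<le> x" "x \<le> n"
  shows "\<bar>spectral_term n l x t\<bar> \<le> spectral_bound n l t"
proof -
  have "\<bar>spectral_term n l x t\<bar> \<le>
      \<bar>cos t ^ (l + 1) * cos (x * t)\<bar> + \<bar>real l * cos t ^ (l - 1) * (sin t)\<^sup>2 * cos (x * t)\<bar>
      + \<bar>(n - x) * cos t ^ l * sin t * sin (x * t)\<bar>"
    unfolding spectral_term_def left_diff_distrib by linarith
  also have "\<dots> \<le> \<bar>cos t\<bar> ^ (l + 1) * 1 + real l * \<bar>cos t\<bar> ^ (l - 1) * (sin t)\<^sup>2 * 1
      + real n * \<bar>cos t\<bar> ^ l * \<bar>sin t\<bar> * 1"
    unfolding abs_mult power_abs using assms
    by (intro add_mono mult_mono) auto
  finally show ?thesis by (simp add: spectral_bound_def)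
qed

lemma spectral_density_deviation:
  assumes "0 < n" "1 \<le> x" "x \<le> n"
  shows "\<bar>spectral_density n l x - 2 / (real n)\<^sup>2\<bar> \<le>
    2 / (real n)\<^sup>2 * (\<Sum>j=1..<n. spectral_bound n l (2 * pi * real j / real n))"
proof -
  have "(\<Sum>j<n. spectral_term n l x (2 * pi * real j / real n))
      = 1 + (\<Sum>j=1..<n. spectral_term n l x (2 * pi * real j / real n))"
    using assms(1) by (simp add: lessThan_atLeast0 sum.atLeast_Suc_lessThan spectral_term_def)
  then have "spectral_density n l x - 2 / (real n)\<^sup>2 =
      2 / (real n)\<^sup>2 * (\<Sum>j=1..<n. spectral_term n l x (2 * pi * real j / real n))"
    by (simp add: spectral_density_def distrib_left)
  moreover have "\<bar>\<Sum>j=1..<n. spectral_term n l x (2 * pi * real j / real n)\<bar>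
      \<le> (\<Sum>j=1..<n. spectral_bound n l (2 * pi * real j / real n))"
    using assms by (intro order.trans[OF sum_abs] sum_mono abs_spectral_term_le) auto
  ultimately show ?thesis by (simp add: abs_mult divide_right_mono)
qed

text \<open>Each of the n states has weight at most n, so the deviations add up to at most n^2 times
  2 / n^2 times the sum of the majorants; the factor 1/2 of \<open>tv_dist\<close> cancels the
  2.\<close>

lemma tv_dist_le_spectral_bound:
  assumes n: "3 \<le> n"
  shows "tv_dist n (chain_power n (K n) l 0) (stat n)
    \<le> (\<Sum>j=1..<n. spectral_bound n l (2 * pi * real j / real n))" (is "_ \<le> ?S")
proof -
  have "\<bar>chain_power n (K n) l 0 y - stat n y\<bar> \<le> real n * (2 / (real n)\<^sup>2 * ?S)" if y: "y < n" for y
  proof -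
    let ?d = "spectral_density n l (y + 1) - 2 / (real n)\<^sup>2"
    have "\<bar>chain_power n (K n) l 0 y - stat n y\<bar> \<le> \<bar>real n * ?d\<bar>"
    proof (cases "y = n - 1")
      case True
      then have "chain_power n (K n) l 0 y - stat n y = real n * ?d / 2"
        using n y by (simp add: chain_power_eq_spectral_density stat_def field_simps power2_eq_square)
      then show ?thesis by simp
    next
      case False
      then have "chain_power n (K n) l 0 y - stat n y = real (y + 1) * ?d"
      proof -
        have "y \<le> n - 2" using False y by arith
        then have "stat n y = real (y + 1) * (2 / (real n)\<^sup>2)" by (simp add: stat_def)
        then show ?thesis
          using n y False by (simp only: chain_power_eq_spectral_density right_diff_distrib if_False)
      qed
      then show ?thesis using y by (simp add: abs_mult mult_right_mono)
    qed
    also have "\<dots> \<le> real n * (2 / (real n)\<^sup>2 * ?S)"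
      unfolding abs_mult using y n spectral_density_deviation[of n "y + 1" l]
      by (intro mult_mono) auto
    finally show ?thesis .
  qed
  then have "(\<Sum>y<n. \<bar>chain_power n (K n) l 0 y - stat n y\<bar>) \<le> (\<Sum>y<n. real n * (2 / (real n)\<^sup>2 * ?S))"
    by (intro sum_mono) auto
  then show ?thesis using n by (simp add: tv_dist_def power2_eq_square field_simps)
qed

text \<open>With a = sin^2 t one has |cos t| <= exp(-a/2), and l - 1 >= l/2 gives exp(-l a/4) for
  all three powers. The factors l a and n |sin t| <= 1 + l a, the latter from n^2 <= l, cost half of
  this exponent through 1 + y <= 8 exp(y/8).\<close>

lemma spectral_bound_le_exp:
  assumes n: "3 \<le> n" and l: "n\<^sup>2 \<le> l"
  shows "spectral_bound n l t \<le> 16 * exp (- (real l * (sin t)\<^sup>2 / 8))"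
proof -
  define a where "a = (sin t)\<^sup>2"
  have a: "0 \<le> a" by (simp add: a_def)
  have l2: "2 \<le> l"
  proof -
    have "3\<^sup>2 \<le> n\<^sup>2" using n by (intro power_mono) auto
    then show ?thesis using l by simp
  qed
  have c: "\<bar>cos t\<bar> \<le> exp (- (a / 2))"
  proof (rule power2_le_imp_le)
    have "\<bar>cos t\<bar>\<^sup>2 = 1 - a" by (simp add: a_def cos_squared_eq)
    also have "\<dots> \<le> exp (- a)" using exp_ge_add_one_self[of "- a"] by simp
    also have "\<dots> = (exp (- (a / 2)))\<^sup>2" by (simp add: exp_double[symmetric])
    finally show "\<bar>cos t\<bar>\<^sup>2 \<le> (exp (- (a / 2)))\<^sup>2" .
  qed simp
  define E where "E = exp (- (real l * a / 4))"
  have pw: "\<bar>cos t\<bar> ^ k \<le> E" if "l - 1 \<le> k" for k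
  proof -
    have "\<bar>cos t\<bar> ^ k \<le> exp (- (a / 2)) ^ k" using c by (intro power_mono) auto
    also have "\<dots> = exp (- (real k * a / 2))" by (simp add: exp_of_nat_mult[symmetric])
    also have "\<dots> \<le> E"
    proof -
      have "real l \<le> 2 * real k" using that l2 by linarith
      then have "real l * a \<le> 2 * real k * a" using a by (intro mult_right_mono) auto
      then show ?thesis by (simp add: E_def mult_ac)
    qed
    finally show ?thesis .
  qed
  have ns: "real n * \<bar>sin t\<bar> \<le> 1 + real l * a"
  proof -
    have "real n * \<bar>sin t\<bar> \<le> 1 + (real n * \<bar>sin t\<bar>)\<^sup>2"
    proof -
      have "0 \<le> (real n * \<bar>sin t\<bar> - 1)\<^sup>2 + (real n * \<bar>sin t\<bar>)\<^sup>2 + 1" by simp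
      then show ?thesis by (simp add: power2_eq_square algebra_simps)
    qed
    also have "(real n * \<bar>sin t\<bar>)\<^sup>2 \<le> real l * a"
    proof -
      have "real (n\<^sup>2) \<le> real l" using l by (simp only: of_nat_le_iff)
      then show ?thesis using a by (simp add: a_def power_mult_distrib mult_right_mono)
    qed
    finally show ?thesis by simp
  qed
  have "spectral_bound n l t = \<bar>cos t\<bar> ^ (l + 1) + \<bar>cos t\<bar> ^ (l - 1) * (real l * a) + \<bar>cos t\<bar> ^ l * (real n * \<bar>sin t\<bar>)"
    by (simp add: spectral_bound_def a_def mult_ac)
  also have "\<dots> \<le> E + E * (real l * a) + E * (1 + real l * a)"
    using pw[of "l + 1"] pw[of "l - 1"] pw[of l] ns a
    by (intro add_mono mult_mono) (auto simp: E_def)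
  also have "\<dots> = 2 * (E * (1 + real l * a))" by (simp add: algebra_simps)
  also have "\<dots> \<le> 2 * (E * (8 * exp (real l * a / 8)))"
  proof -
    have "1 + real l * a \<le> 8 * exp (real l * a / 8)"
      using exp_ge_add_one_self[of "real l * a / 8"] by linarith
    then show ?thesis by (simp add: E_def)
  qed
  also have "\<dots> = 16 * exp (- (real l * a / 8))"
    by (simp add: E_def exp_add[symmetric] algebra_simps)
  finally show ?thesis by (simp add: a_def)
qed

lemma sin_ge_half:
  fixes x :: real
  assumes "0 \<le> x" "x \<le> pi / 3" shows "x / 2 \<le> sin x"
proof -
  have "sin 0 - 0 / 2 \<le> sin x - x / 2"
  proof (rule DERIV_nonneg_imp_nondecreasing[OF assms(1)])
    fix y assume y: "0 \<le> y" "y \<le> x"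
    have "cos (pi / 3) \<le> cos y" using y assms by (intro cos_monotone_0_pi_le) auto
    then have "0 \<le> cos y - 1 / 2" by (simp add: cos_60)
    moreover have "((\<lambda>y. sin y - y / 2) has_real_derivative cos y - 1 / 2) (at y)"
      by (auto intro!: derivative_eq_intros)
    ultimately show "\<exists>z. ((\<lambda>y. sin y - y / 2) has_real_derivative z) (at y) \<and> 0 \<le> z"
      by blast
  qed
  then show ?thesis by simp
qed

text \<open>A weakened chord bound u <= sin(pi u) on [0, 1/2], extended by the symmetry about pi/2.
  Up to 1/3 the bound of \<open>sin_ge_half\<close> is enough because pi >= 2; beyond it
  monotonicity gives at least sin(pi/6) = 1/2.\<close>

lemma sin_pi_fraction_ge:
  assumes "m < n"
  shows "real (min m (n - m)) / real n \<le> sin (pi * real m / real n)"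
proof -
  have *: "u \<le> sin (pi * u)" if "0 \<le> u" "u \<le> 1 / 2" for u :: real
  proof (cases "u \<le> 1 / 3")
    case True
    then have "pi * u / 2 \<le> sin (pi * u)" using that by (intro sin_ge_half) auto
    moreover have "u \<le> pi * u / 2"
      using mult_right_mono[OF pi_ge_two that(1)] by simp
    ultimately show ?thesis by linarith
  next
    case False
    then have "sin (pi / 6) \<le> sin (pi * u)"
      using that by (intro sin_monotone_2pi_le) auto
    then show ?thesis using that by (simp add: sin_30)
  qed
  show ?thesis
  proof (cases "2 * m \<le> n")
    case True
    then have "real m / real n \<le> 1 / 2" using assms by (simp add: field_simps)
    then show ?thesis using *[of "real m / real n"] True by (simp add: min_absorb1)
  next
    case False
    then have "real (n - m) / real n \<le> 1 / 2" using assms by (simp add: field_simps)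
    moreover have "pi * (real (n - m) / real n) = pi - pi * real m / real n"
      using assms by (simp add: of_nat_diff field_simps)
    then have "sin (pi * (real (n - m) / real n)) = sin (pi * real m / real n)" by simp
    ultimately show ?thesis using *[of "real (n - m) / real n"] False assms by (simp add: min_absorb2)
  qed
qed

text \<open>2 is invertible modulo an odd n. For even n the frequency j = n/2 would have sin t = 0
  and no decay.\<close>

lemma bij_betw_double_mod:
  fixes n :: nat
  assumes "odd n"
  shows "bij_betw (\<lambda>j. 2 * j mod n) {1..<n} {1..<n}"
proof -
  have "inj_on (\<lambda>j. 2 * j mod n) {1..<n}"
  proof
    have *: "x = y" if xy: "x \<le> y" "y < n" "2 * y mod n = 2 * x mod n" for x y :: nat
    proof -
      have "n dvd 2 * y - 2 * x" using xy by (simp add: mod_eq_dvd_iff_nat)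
      then have "n dvd 2 * (y - x)" by (simp add: right_diff_distrib')
      then have "n dvd y - x" using assms by (simp add: coprime_dvd_mult_right_iff)
      then show ?thesis using xy by (auto dest: dvd_imp_le)
    qed
    fix x y assume "x \<in> {1..<n}" "y \<in> {1..<n}" "2 * x mod n = 2 * y mod n"
    then show "x = y" using *[of x y] *[of y x] by (cases "x \<le> y") auto
  qed
  moreover have "(\<lambda>j. 2 * j mod n) ` {1..<n} \<subseteq> {1..<n}"
  proof safe
    fix j assume j: "j \<in> {1..<n}"
    have "\<not> n dvd 2 * j"
    proof
      assume "n dvd 2 * j"
      then have "n dvd j" using assms by (simp add: coprime_dvd_mult_right_iff)
      then show False using j by (auto dest: dvd_imp_le)
    qed
    then show "2 * j mod n \<in> {1..<n}" using j by (auto simp: mod_greater_zero_iff_not_dvd Suc_le_eq)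
  qed
  ultimately show ?thesis by (simp add: bij_betw_def endo_inj_surj)
qed

lemma abs_sin_double_mod:
  assumes "0 < n"
  shows "\<bar>sin (2 * pi * real j / real n)\<bar> = \<bar>sin (pi * real (2 * j mod n) / real n)\<bar>"
proof -
  have "real (2 * j) = real (2 * j mod n) + real n * real (2 * j div n)"
    by (metis mod_mult_div_eq of_nat_add of_nat_mult)
  then have "2 * pi * real j / real n = pi * real (2 * j mod n) / real n + pi * real (2 * j div n)"
    using assms by (simp add: field_simps)
  then show ?thesis
    by (simp add: sin_add abs_mult)
qed

text \<open>Let m be the distance from 2 j to the nearest multiple of n. Since |sin(2 pi j / n)| >=
  m / n, frequency j contributes at most 16 q^m. Reindexing by doubling and bounding the power with
  the minimum by the sum of both powers leaves two equal geometric sums, at most 32 q / (1 - q); 1 /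
  (1 - q) <= 9 gives 288 = 32 times 9.\<close>

lemma tv_dist_upper:
  assumes n: "3 \<le> n" "odd n" and l: "n\<^sup>2 \<le> l"
  shows "tv_dist n (chain_power n (K n) l 0) (stat n) \<le> 288 * exp (- (real l / (real n)\<^sup>2 / 8))"
proof -
  define q where "q = exp (- (real l / (real n)\<^sup>2 / 8))"
  have "real (n\<^sup>2) \<le> real l" using l by (simp only: of_nat_le_iff)
  then have t1: "1 \<le> real l / (real n)\<^sup>2" using n by simp
  have q: "0 < q" "q \<le> 8 / 9"
  proof -
    \<comment> \<open>Here l >= n^2 keeps q away from 1: exp(1/8) >= 9/8.\<close>
    have "q \<le> exp (- (1 / 8))" using t1 by (simp add: q_def)
    also have "\<dots> \<le> 8 / 9" using exp_ge_add_one_self[of "1 / 8"] by (simp add: exp_minus field_simps)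
    finally show "q \<le> 8 / 9" .
  qed (simp add: q_def)
  have b: "spectral_bound n l (2 * pi * real j / real n) \<le> 16 * q ^ min (2 * j mod n) (n - 2 * j mod n)" for j
  proof -
    define m where "m = min (2 * j mod n) (n - 2 * j mod n)"
    have "real m / real n \<le> \<bar>sin (2 * pi * real j / real n)\<bar>"
      using sin_pi_fraction_ge[of "2 * j mod n" n] n unfolding abs_sin_double_mod[of n j] m_def by (simp add: abs_sin_double_mod)
    then have "(real m / real n)\<^sup>2 \<le> \<bar>sin (2 * pi * real j / real n)\<bar>\<^sup>2" by (intro power_mono) auto
    then have "real l * (real m / real n)\<^sup>2 \<le> real l * (sin (2 * pi * real j / real n))\<^sup>2"
      by (intro mult_left_mono) auto
    moreover have "real m * (real l / (real n)\<^sup>2) \<le> real l * (real m / real n)\<^sup>2"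
    proof -
      \<comment> \<open>Replacing m^2 by m trades a Gaussian sum for a geometric one.\<close>
      have "real m \<le> (real m)\<^sup>2" by (cases m) (auto simp: power2_eq_square)
      then have "real m * (real l / (real n)\<^sup>2) \<le> (real m)\<^sup>2 * (real l / (real n)\<^sup>2)"
        by (intro mult_right_mono) auto
      then show ?thesis by (simp add: power_divide mult.commute)
    qed
    ultimately have "exp (- (real l * (sin (2 * pi * real j / real n))\<^sup>2 / 8)) \<le> exp (real m * - (real l / (real n)\<^sup>2 / 8))"
      by simp
    also have "\<dots> = q ^ m" by (simp only: q_def exp_of_nat_mult)
    finally show ?thesis
      using spectral_bound_le_exp[OF n(1) l, of "2 * pi * real j / real n"] by (simp add: m_def)
  qed
  have "tv_dist n (chain_power n (K n) l 0) (stat n) \<le> (\<Sum>j=1..<n. 16 * q ^ min (2 * j mod n) (n - 2 * j mod n))"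
    using b by (intro order.trans[OF tv_dist_le_spectral_bound[OF n(1)]] sum_mono)
  also have "\<dots> = (\<Sum>m=1..<n. 16 * q ^ min m (n - m))"
    by (rule sum.reindex_bij_betw[OF bij_betw_double_mod[OF n(2)]])
  also have "\<dots> \<le> (\<Sum>m=1..<n. 16 * q ^ m + 16 * q ^ (n - m))"
    using q by (intro sum_mono) (auto simp: min_def)
  also have "\<dots> = 32 * (\<Sum>m=1..<n. q ^ m)"
  proof -
    have "(\<Sum>m=1..<n. q ^ (n - m)) = (\<Sum>m=1..<n. q ^ m)"
      by (rule sum.reindex_bij_witness[of _ "\<lambda>m. n - m" "\<lambda>m. n - m"]) auto
    then show ?thesis by (simp add: sum.distrib sum_distrib_left[symmetric])
  qed
  also have "(\<Sum>m=1..<n. q ^ m) = q * (\<Sum>m<n-1. q ^ m)"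
    by (simp add: sum_distrib_left sum.reindex_bij_witness[of _ Suc "\<lambda>m. m - 1"])
       (rule sum.reindex_bij_witness[of _ Suc "\<lambda>m. m - 1"]; auto simp: power_eq_if)
  also have "(\<Sum>m<n-1. q ^ m) \<le> 9"
  proof -
    have "(\<Sum>m<n-1. q ^ m) = (1 - q ^ (n - 1)) / (1 - q)"
      using q by (simp add: sum_gp_strict)
    also have "\<dots> \<le> 1 / (1 / 9)" using q by (intro frac_le) auto
    finally show ?thesis by simp
  qed
  finally show ?thesis using q by (simp add: q_def)
qed

section \<open>Quotients and composition series\<close>

lemma complex_ring_simps [simp]:
  "carrier complex_ring = UNIV" "x \<otimes>\<^bsub>complex_ring\<^esub> y = x * y" "x \<oplus>\<^bsub>complex_ring\<^esub> y = x + y"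
  "\<one>\<^bsub>complex_ring\<^esub> = 1" "\<zero>\<^bsub>complex_ring\<^esub> = 0"
  by (simp_all add: complex_ring_def)

lemma cring_complex_ring: "cring complex_ring"
  by (rule cringI)
     (auto intro!: abelian_groupI comm_monoidI simp: algebra_simps exI[of _ "- _"]
       intro: exI[of _ "- _"] left_minus)

lemma linear_endo_funpow_closed:
  "linear_endo M g \<Longrightarrow> x \<in> carrier M \<Longrightarrow> (g ^^ m) x \<in> carrier M"
  by (induction m) (auto simp: linear_endo_def)

lemma minus_eq_smult:
  assumes M: "module complex_ring M" and "x \<in> carrier M" "y \<in> carrier M"
  shows "x \<ominus>\<^bsub>M\<^esub> y = x \<oplus>\<^bsub>M\<^esub> ((- 1) \<odot>\<^bsub>M\<^esub> y)"
proof -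
  interpret module complex_ring M by (rule M)
  have "(1 + - 1) \<odot>\<^bsub>M\<^esub> y = y \<oplus>\<^bsub>M\<^esub> ((- 1) \<odot>\<^bsub>M\<^esub> y)"
    using assms smult_l_distr[of 1 "- 1" y] smult_one[of y] by simp
  then have "(- 1) \<odot>\<^bsub>M\<^esub> y \<oplus>\<^bsub>M\<^esub> y = \<zero>\<^bsub>M\<^esub>"
    using assms smult_l_null[of y] by (simp add: M.add.m_comm)
  then have "\<ominus>\<^bsub>M\<^esub> y = (- 1) \<odot>\<^bsub>M\<^esub> y"
    using assms by (intro M.minus_equality) auto
  then show ?thesis by (simp add: a_minus_def)
qed

text \<open>Subtraction in a module goes through an additive inverse that is chosen in the carrier.
  Written with the scalar -1, the commutator relation mentions only operations that are inherited by
  submodules and preserved by homomorphisms.\<close>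

lemma umodule_iff:
  "umodule n M \<longleftrightarrow>
     module complex_ring M \<and>
     linear_endo M (act_e M) \<and> linear_endo M (act_f M) \<and> linear_endo M (act_k M) \<and>
     (\<forall>x\<in>carrier M.
        (act_e M ^^ n) x = \<zero>\<^bsub>M\<^esub> \<and>
        (act_f M ^^ n) x = \<zero>\<^bsub>M\<^esub> \<and>
        (act_k M ^^ n) x = x \<and>
        act_k M (act_e M (act_kinv n M x)) = (xi n powi 2) \<odot>\<^bsub>M\<^esub> act_e M x \<and>
        act_k M (act_f M (act_kinv n M x)) = (xi n powi (-2)) \<odot>\<^bsub>M\<^esub> act_f M x \<and>
        act_e M (act_f M x) \<oplus>\<^bsub>M\<^esub> ((- 1) \<odot>\<^bsub>M\<^esub> act_f M (act_e M x)) =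
          (1 / (xi n - inverse (xi n))) \<odot>\<^bsub>M\<^esub> (act_k M x \<oplus>\<^bsub>M\<^esub> ((- 1) \<odot>\<^bsub>M\<^esub> act_kinv n M x)))"
proof -
  have "x \<in> carrier M \<Longrightarrow> act_e M x \<in> carrier M \<and> act_f M x \<in> carrier M \<and> act_k M x \<in> carrier M
      \<and> act_kinv n M x \<in> carrier M"
    if "linear_endo M (act_e M)" "linear_endo M (act_f M)" "linear_endo M (act_k M)" for x
    using that unfolding act_kinv_def
    by (auto simp: linear_endo_funpow_closed[OF that(3)]) (auto simp: linear_endo_def)
  then show ?thesis
    unfolding umodule_def
    by (intro conj_cong ball_cong refl) (simp_all add: minus_eq_smult)
qed

section \<open>Homomorphisms, submodules and quotients\<close>

definition uhom :: "'v umod \<Rightarrow> 'w umod \<Rightarrow> ('v \<Rightarrow> 'w) \<Rightarrow> bool" where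
  "uhom M N h \<longleftrightarrow>
     (\<forall>x\<in>carrier M. h x \<in> carrier N) \<and>
     (\<forall>x\<in>carrier M. \<forall>y\<in>carrier M. h (x \<oplus>\<^bsub>M\<^esub> y) = h x \<oplus>\<^bsub>N\<^esub> h y) \<and>
     (\<forall>c. \<forall>x\<in>carrier M. h (c \<odot>\<^bsub>M\<^esub> x) = c \<odot>\<^bsub>N\<^esub> h x) \<and>
     (\<forall>x\<in>carrier M. h (act_e M x) = act_e N (h x) \<and>
                     h (act_f M x) = act_f N (h x) \<and>
                     h (act_k M x) = act_k N (h x))"

lemma uhomD:
  assumes "uhom M N h" and "x \<in> carrier M"
  shows "h x \<in> carrier N" and "y \<in> carrier M \<Longrightarrow> h (x \<oplus>\<^bsub>M\<^esub> y) = h x \<oplus>\<^bsub>N\<^esub> h y"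
    and "h (c \<odot>\<^bsub>M\<^esub> x) = c \<odot>\<^bsub>N\<^esub> h x" and "h (act_e M x) = act_e N (h x)"
    and "h (act_f M x) = act_f N (h x)" and "h (act_k M x) = act_k N (h x)"
  using assms by (auto simp: uhom_def)

lemma uiso_iff: "uiso M N \<longleftrightarrow> (\<exists>h. uhom M N h \<and> bij_betw h (carrier M) (carrier N))"
  unfolding uiso_def uhom_def by (auto simp: bij_betw_def)

locale umod =
  fixes n :: nat and M :: "'v umod" (structure)
  assumes umodule: "umodule n M"
begin

sublocale module complex_ring M
  using umodule by (simp add: umodule_def)

lemma acts_closed [simp]:
  "x \<in> carrier M \<Longrightarrow> act_e M x \<in> carrier M"
  "x \<in> carrier M \<Longrightarrow> act_f M x \<in> carrier M"
  "x \<in> carrier M \<Longrightarrow> act_k M x \<in> carrier M"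
  using umodule by (auto simp: umodule_def linear_endo_def)

lemma acts_add:
  "x \<in> carrier M \<Longrightarrow> y \<in> carrier M \<Longrightarrow> act_e M (x \<oplus> y) = act_e M x \<oplus> act_e M y"
  "x \<in> carrier M \<Longrightarrow> y \<in> carrier M \<Longrightarrow> act_f M (x \<oplus> y) = act_f M x \<oplus> act_f M y"
  "x \<in> carrier M \<Longrightarrow> y \<in> carrier M \<Longrightarrow> act_k M (x \<oplus> y) = act_k M x \<oplus> act_k M y"
  using umodule by (auto simp: umodule_def linear_endo_def)

lemma add_inv_smult:
  "x \<in> carrier M \<Longrightarrow> (- 1) \<odot> x \<oplus> x = \<zero>"
  using minus_eq_smult[OF module_axioms, of x x] by (simp add: M.add.m_comm M.minus_eq M.r_neg)

lemma usubmodule_iff: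
  "usubmodule M W \<longleftrightarrow> W \<subseteq> carrier M \<and> \<zero> \<in> W \<and> (\<forall>x\<in>W. \<forall>y\<in>W. x \<oplus> y \<in> W) \<and>
     (\<forall>c. \<forall>x\<in>W. c \<odot> x \<in> W) \<and> (\<forall>x\<in>W. act_e M x \<in> W \<and> act_f M x \<in> W \<and> act_k M x \<in> W)"
  (is "_ \<longleftrightarrow> ?R")
proof
  assume "usubmodule M W"
  then have s: "submodule W complex_ring M" "\<forall>x\<in>W. act_e M x \<in> W \<and> act_f M x \<in> W \<and> act_k M x \<in> W"
    by (auto simp: usubmodule_def)
  have "subgroup W (add_monoid M)" using s(1) by (simp add: submodule_def)
  then have "\<zero> \<in> W" using subgroup.one_closed by fastforce
  then show ?R using submoduleE[OF s(1)] s(2) by auto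
next
  assume R: ?R
  have "\<ominus> a = (- 1) \<odot> a" if "a \<in> W" for a
    using that R add_inv_smult by (intro M.minus_equality) auto
  then have "submodule W complex_ring M"
    using R by (intro submoduleI) auto
  then show "usubmodule M W" using R by (auto simp: usubmodule_def)
qed

lemma usubmodule_carrier: "usubmodule M (carrier M)"
  by (simp add: usubmodule_iff)

lemma umodule_sub:
  assumes "usubmodule M U" shows "umodule n (M\<lparr>carrier := U\<rparr>)"
proof -
  have "module complex_ring (M\<lparr>carrier := U\<rparr>)"
    using assms module_axioms by (auto simp: usubmodule_def intro: submodule.submodule_is_module)
  moreover have "act_kinv n (M\<lparr>carrier := U\<rparr>) = act_kinv n M" by (simp add: act_kinv_def)
  ultimately show ?thesis
    using umodule assms unfolding umodule_iff usubmodule_iff linear_endo_def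
    by (simp add: subset_iff)
qed

lemma umod_sub: "usubmodule M U \<Longrightarrow> umod n (M\<lparr>carrier := U\<rparr>)"
  using umodule_sub by (simp add: umod_def)

lemma usubmodule_sub_iff:
  assumes "usubmodule M U"
  shows "usubmodule (M\<lparr>carrier := U\<rparr>) W \<longleftrightarrow> W \<subseteq> U \<and> usubmodule M W"
proof -
  interpret S: umod n "M\<lparr>carrier := U\<rparr>" by (rule umod_sub[OF assms])
  show ?thesis using assms by (auto simp: usubmodule_iff S.usubmodule_iff)
qed

lemma usubmodule_Int:
  "usubmodule M A \<Longrightarrow> usubmodule M B \<Longrightarrow> usubmodule M (A \<inter> B)"
  by (auto simp: usubmodule_iff)

lemma usubmodule_sum:
  assumes A: "usubmodule M A" and B: "usubmodule M B"
  shows "usubmodule M {a \<oplus> b |a b. a \<in> A \<and> b \<in> B}" (is "usubmodule M ?S")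
    and "A \<subseteq> {a \<oplus> b |a b. a \<in> A \<and> b \<in> B}" and "B \<subseteq> {a \<oplus> b |a b. a \<in> A \<and> b \<in> B}"
proof -
  note A' = A[unfolded usubmodule_iff] and B' = B[unfolded usubmodule_iff]
  have c: "a \<in> A \<Longrightarrow> a \<in> carrier M" "b \<in> B \<Longrightarrow> b \<in> carrier M" for a b
    using A' B' by auto
  show "A \<subseteq> ?S"
  proof
    fix a assume "a \<in> A"
    then have "a = a \<oplus> \<zero>" using c by simp
    then show "a \<in> ?S" using \<open>a \<in> A\<close> B' by blast
  qed
  show "B \<subseteq> ?S"
  proof
    fix b assume "b \<in> B"
    then have "b = \<zero> \<oplus> b" using c by simp
    then show "b \<in> ?S" using \<open>b \<in> B\<close> A' by blast
  qed
  have add: "x \<oplus> y \<in> ?S" if xy: "x \<in> ?S" "y \<in> ?S" for x y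
  proof -
    obtain a b a' b' where ab: "a \<in> A" "b \<in> B" "a' \<in> A" "b' \<in> B" "x = a \<oplus> b" "y = a' \<oplus> b'"
      using xy by blast
    then have "x \<oplus> y = (a \<oplus> a') \<oplus> (b \<oplus> b')" using c by (simp add: M.add.m_ac)
    moreover have "a \<oplus> a' \<in> A" "b \<oplus> b' \<in> B" using ab A' B' by auto
    ultimately show ?thesis by blast
  qed
  have lin: "g x \<in> ?S"
    if "\<And>x y. x \<in> carrier M \<Longrightarrow> y \<in> carrier M \<Longrightarrow> g (x \<oplus> y) = g x \<oplus> g y"
      "\<And>x. x \<in> A \<Longrightarrow> g x \<in> A" "\<And>x. x \<in> B \<Longrightarrow> g x \<in> B" "x \<in> ?S" for g x
    using that c by blast
  show "usubmodule M ?S"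
    unfolding usubmodule_iff
  proof (intro conjI ballI allI)
    show "?S \<subseteq> carrier M" using c by auto
    have "\<zero> = \<zero> \<oplus> \<zero>" by simp
    then show "\<zero> \<in> ?S" using A' B' by blast
    show "x \<oplus> y \<in> ?S" if "x \<in> ?S" "y \<in> ?S" for x y by (rule add[OF that])
    show "d \<odot> x \<in> ?S" if "x \<in> ?S" for d x
      by (rule lin[OF _ _ _ that]) (use A' B' in \<open>auto simp: smult_r_distr\<close>)
    show "act_e M x \<in> ?S" "act_f M x \<in> ?S" "act_k M x \<in> ?S" if "x \<in> ?S" for x
      by (rule lin[OF _ _ _ that]; use A' B' in \<open>auto simp: acts_add\<close>)+
  qed
qed

lemma usubmodule_zero: "usubmodule M {\<zero>}"
proof -
  have "g \<zero> = \<zero>" if "linear_endo M g" for g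
    using that smult_l_null[of "\<zero>"] smult_l_null[of "g \<zero>"] unfolding linear_endo_def
    by (metis M.zero_closed complex_ring_simps(5))
  then show ?thesis
    unfolding usubmodule_iff using umodule smult_r_null by (auto simp: umodule_def)
qed

lemma uhom_zero:
  assumes "uhom M N h" "umodule n' N" shows "h \<zero> = \<zero>\<^bsub>N\<^esub>"
proof -
  interpret N: umod n' N using assms by (simp add: umod_def)
  have "h (0 \<odot> \<zero>) = 0 \<odot>\<^bsub>N\<^esub> h \<zero>" using assms(1) unfolding uhom_def by blast
  moreover have "h \<zero> \<in> carrier N" using assms(1) by (auto simp: uhom_def)
  ultimately show ?thesis using smult_l_null[of \<zero>] N.smult_l_null[of "h \<zero>"] by simp
qed

lemma uhom_funpow:
  assumes "uhom M N h" "x \<in> carrier M"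
  shows "h ((act_e M ^^ m) x) = (act_e N ^^ m) (h x)"
    and "h ((act_f M ^^ m) x) = (act_f N ^^ m) (h x)"
    and "h ((act_k M ^^ m) x) = (act_k N ^^ m) (h x)"
proof -
  have c: "(act_e M ^^ m) x \<in> carrier M" "(act_f M ^^ m) x \<in> carrier M" "(act_k M ^^ m) x \<in> carrier M" for m
    using umodule assms(2) by (auto simp: umodule_def intro!: linear_endo_funpow_closed)
  show "h ((act_e M ^^ m) x) = (act_e N ^^ m) (h x)" "h ((act_f M ^^ m) x) = (act_f N ^^ m) (h x)"
    "h ((act_k M ^^ m) x) = (act_k N ^^ m) (h x)"
    by (induction m) (use assms(1) c in \<open>auto simp: uhom_def\<close>)
qed

lemma kinv_closed [simp]: "x \<in> carrier M \<Longrightarrow> act_kinv n M x \<in> carrier M"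
  using umodule by (auto simp: umodule_def act_kinv_def intro!: linear_endo_funpow_closed)

text \<open>The axioms are equations and closure conditions, and negatives are images of negatives,
  so everything passes to a surjective image. \<open>N\<close> is not yet known to be a module, so
  \<open>uhom_zero\<close> cannot supply the condition on zero.\<close>

lemma umodule_surj_image:
  assumes h: "uhom M N h" and surj: "h ` carrier M = carrier N" and zero: "h \<zero> = \<zero>\<^bsub>N\<^esub>"
  shows "umodule n N"
proof -
  note H = h[unfolded uhom_def]
  have E: "\<exists>x\<in>carrier M. y = h x" if "y \<in> carrier N" for y using that surj by auto
  have Hadd: "h x \<oplus>\<^bsub>N\<^esub> h y = h (x \<oplus> y)" and Hsm: "c \<odot>\<^bsub>N\<^esub> h x = h (c \<odot> x)"
    and He: "act_e N (h x) = h (act_e M x)" and Hf: "act_f N (h x) = h (act_f M x)" 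
    and Hk: "act_k N (h x) = h (act_k M x)" and Hki: "act_kinv n N (h x) = h (act_kinv n M x)"
    and Hc: "h x \<in> carrier N" 
    if "x \<in> carrier M" "y \<in> carrier M" for x y c
    using H that uhom_funpow(3)[OF h] by (auto simp: act_kinv_def)
  have all: "(\<forall>y\<in>carrier N. P y) \<longleftrightarrow> (\<forall>x\<in>carrier M. P (h x))" for P
    unfolding surj[symmetric] by auto
  have "abelian_group N"
  proof (rule abelian_groupI)
    show "\<zero>\<^bsub>N\<^esub> \<in> carrier N" using Hc[of \<zero> \<zero>] zero by simp
    fix x y z assume "x \<in> carrier N" "y \<in> carrier N" "z \<in> carrier N"
    then obtain a b c where abc: "a \<in> carrier M" "b \<in> carrier M" "c \<in> carrier M" "x = h a" "y = h b" "z = h c"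
      using E by metis
    show "x \<oplus>\<^bsub>N\<^esub> y \<in> carrier N" "x \<oplus>\<^bsub>N\<^esub> y \<oplus>\<^bsub>N\<^esub> z = x \<oplus>\<^bsub>N\<^esub> (y \<oplus>\<^bsub>N\<^esub> z)" "x \<oplus>\<^bsub>N\<^esub> y = y \<oplus>\<^bsub>N\<^esub> x"
      using abc by (simp_all add: Hadd Hc M.add.m_ac)
    show "\<zero>\<^bsub>N\<^esub> \<oplus>\<^bsub>N\<^esub> x = x" using abc by (simp add: zero[symmetric] Hadd)
    show "\<exists>y\<in>carrier N. y \<oplus>\<^bsub>N\<^esub> x = \<zero>\<^bsub>N\<^esub>"
      using abc by (intro bexI[of _ "h ((- 1) \<odot> a)"]) (simp_all add: Hadd Hc zero add_inv_smult)
  qed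
  then have "module complex_ring N"
  proof (rule moduleI[OF cring_complex_ring])
    fix c d x y assume "x \<in> carrier N" "y \<in> carrier N"
    then obtain a b where ab: "a \<in> carrier M" "b \<in> carrier M" "x = h a" "y = h b"
      using E by metis
    show "c \<odot>\<^bsub>N\<^esub> x \<in> carrier N" using ab by (simp add: Hsm Hc)
    show "(c \<oplus>\<^bsub>complex_ring\<^esub> d) \<odot>\<^bsub>N\<^esub> x = c \<odot>\<^bsub>N\<^esub> x \<oplus>\<^bsub>N\<^esub> d \<odot>\<^bsub>N\<^esub> x"
      using ab smult_l_distr[of c d a] by (simp add: Hsm Hadd)
    show "(c \<otimes>\<^bsub>complex_ring\<^esub> d) \<odot>\<^bsub>N\<^esub> x = c \<odot>\<^bsub>N\<^esub> (d \<odot>\<^bsub>N\<^esub> x)"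
      using ab smult_assoc1[of c d a] by (simp add: Hsm)
    show "c \<odot>\<^bsub>N\<^esub> (x \<oplus>\<^bsub>N\<^esub> y) = c \<odot>\<^bsub>N\<^esub> x \<oplus>\<^bsub>N\<^esub> c \<odot>\<^bsub>N\<^esub> y"
      using ab smult_r_distr[of c a b] by (simp add: Hsm Hadd)
    show "\<one>\<^bsub>complex_ring\<^esub> \<odot>\<^bsub>N\<^esub> x = x"
      using ab smult_one[of a] by (simp add: Hsm)
  qed
  moreover have "(act_e N ^^ n) (h x) = \<zero>\<^bsub>N\<^esub> \<and> (act_f N ^^ n) (h x) = \<zero>\<^bsub>N\<^esub> \<and> (act_k N ^^ n) (h x) = h x"
    if "x \<in> carrier M" for x
    using uhom_funpow[OF h that, of n] umodule that zero by (auto simp: umodule_def)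
  ultimately show ?thesis
    using umodule unfolding umodule_iff linear_endo_def all
    by (simp add: Hadd Hsm He Hf Hk Hki Hc)
qed

lemma usubmodule_vimage:
  assumes h: "uhom M N h" and N: "umodule n' N" and W: "usubmodule N W"
  shows "usubmodule M {x \<in> carrier M. h x \<in> W}"
proof -
  interpret N: umod n' N using N by (simp add: umod_def)
  show ?thesis
    using h W uhom_zero[OF h N] unfolding usubmodule_iff N.usubmodule_iff uhom_def by auto
qed

lemma usubmodule_image:
  assumes h: "uhom M N h" and N: "umodule n' N" and W: "usubmodule M W"
  shows "usubmodule N (h ` W)"
proof -
  interpret N: umod n' N using N by (simp add: umod_def)
  note H = h[unfolded uhom_def] and W' = W[unfolded usubmodule_iff]
  have c: "x \<in> W \<Longrightarrow> x \<in> carrier M" for x using W' by auto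
  have "h x \<oplus>\<^bsub>N\<^esub> h y \<in> h ` W" if "x \<in> W" "y \<in> W" for x y
    using that W' c uhomD(2)[OF h, of x y, symmetric] by simp
  moreover have "c \<odot>\<^bsub>N\<^esub> h x \<in> h ` W" "act_e N (h x) \<in> h ` W" "act_f N (h x) \<in> h ` W"
      "act_k N (h x) \<in> h ` W" if "x \<in> W" for x c
    using that W' c uhomD(3-6)[OF h, of x, symmetric] by simp_all
  moreover have "\<zero>\<^bsub>N\<^esub> \<in> h ` W" using uhom_zero[OF h N] W' by (metis imageI)
  moreover have "h ` W \<subseteq> carrier N" using H c by auto
  ultimately show ?thesis unfolding N.usubmodule_iff by simp
qed

lemma coset_mem: "y \<in> W +> x \<longleftrightarrow> (\<exists>w\<in>W. y = w \<oplus> x)"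
  by (auto simp: a_r_coset_def')

lemma coset_eq_iff:
  assumes "usubmodule M W" "x \<in> carrier M" "y \<in> carrier M"
  shows "W +> x = W +> y \<longleftrightarrow> (\<exists>w\<in>W. x = w \<oplus> y)"
proof
  note W = assms(1)[unfolded usubmodule_iff]
  have "x = \<zero> \<oplus> x" using assms by simp
  then have "x \<in> W +> x" using W unfolding coset_mem by blast
  then show "W +> x = W +> y \<Longrightarrow> \<exists>w\<in>W. x = w \<oplus> y" by (simp add: coset_mem)
  assume "\<exists>w\<in>W. x = w \<oplus> y"
  then obtain w where w: "w \<in> W" "x = w \<oplus> y" by auto
  have c: "v \<in> carrier M" if "v \<in> W" for v using that W by auto
  have "y = (- 1) \<odot> w \<oplus> x"
    using w c[OF w(1)] assms(3) by (simp add: M.add.m_assoc[symmetric] add_inv_smult)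
  moreover have "(- 1) \<odot> w \<in> W" using W w by blast
  ultimately have y: "v \<oplus> y = (v \<oplus> (- 1) \<odot> w) \<oplus> x" "v \<oplus> (- 1) \<odot> w \<in> W" if "v \<in> W" for v
    using that W c w assms by (auto simp: M.add.m_assoc)
  have x: "v \<oplus> x = (v \<oplus> w) \<oplus> y" "v \<oplus> w \<in> W" if "v \<in> W" for v
    using that W c w assms by (auto simp: M.add.m_assoc)
  show "W +> x = W +> y"
  proof (rule Set.set_eqI)
    fix z show "z \<in> W +> x \<longleftrightarrow> z \<in> W +> y"
      unfolding coset_mem using x y by metis
  qed
qed

lemma quotient_carrier: "carrier (uquotient M W) = (\<lambda>x. W +> x) ` carrier M"
  by (auto simp: uquotient_def A_RCOSETS_def')

lemma coset_zero: "usubmodule M W \<Longrightarrow> W +> \<zero> = W"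
  using a_coset_add_zero[of W] by (simp add: usubmodule_iff)

lemma coset_eq_self_iff:
  assumes "usubmodule M W" "x \<in> carrier M" shows "W +> x = W \<longleftrightarrow> x \<in> W"
  using coset_eq_iff[OF assms M.zero_closed] assms(1) unfolding coset_zero[OF assms(1)]
  by (auto simp: usubmodule_iff intro!: bexI[of _ x])

text \<open>Independence of the representative: w + a is sent to g w + g a with g w in W, so all
  cosets in a union from \<open>uquotient\<close> coincide.\<close>

lemma UN_coset:
  assumes W: "usubmodule M W" and a: "a \<in> carrier M"
    and g: "\<And>x. x \<in> carrier M \<Longrightarrow> g x \<in> carrier M" "\<And>w. w \<in> W \<Longrightarrow> g w \<in> W"
      "\<And>x y. x \<in> carrier M \<Longrightarrow> y \<in> carrier M \<Longrightarrow> g (x \<oplus> y) = g x \<oplus> g y"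
  shows "(\<Union>x\<in>W +> a. W +> g x) = W +> g a"
proof -
  note W' = W[unfolded usubmodule_iff]
  have "W +> g x = W +> g a" if x: "x \<in> W +> a" for x
  proof -
    obtain w where "w \<in> W" "x = w \<oplus> a" using x by (auto simp: coset_mem)
    then show ?thesis using W' a g by (subst coset_eq_iff[OF W]) (auto intro!: bexI[of _ "g w"])
  qed
  moreover have "a \<in> W +> a" using W' a unfolding coset_mem by (intro bexI[of _ "\<zero>"]) auto
  ultimately show ?thesis by blast
qed

lemma uhom_quotient:
  assumes W: "usubmodule M W"
  shows "uhom M (uquotient M W) (\<lambda>x. W +> x)"
proof -
  note W' = W[unfolded usubmodule_iff]
  have c: "v \<in> carrier M" if "v \<in> W" for v using that W' by auto
  have "W +> (x \<oplus> y) = (W +> x) <+> (W +> y)" if "x \<in> carrier M" "y \<in> carrier M" for x y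
  proof (rule Set.set_eqI)
    fix z
    have "(\<exists>w\<in>W. z = w \<oplus> (x \<oplus> y)) \<longleftrightarrow> (\<exists>v\<in>W. \<exists>w\<in>W. z = (v \<oplus> x) \<oplus> (w \<oplus> y))"
    proof
      assume "\<exists>w\<in>W. z = w \<oplus> (x \<oplus> y)"
      then obtain w where w: "w \<in> W" "z = w \<oplus> (x \<oplus> y)" by auto
      then have "z = (w \<oplus> x) \<oplus> (\<zero> \<oplus> y)" using c that by (simp add: M.add.m_assoc)
      then show "\<exists>v\<in>W. \<exists>w\<in>W. z = (v \<oplus> x) \<oplus> (w \<oplus> y)" using w W' by blast
    next
      assume "\<exists>v\<in>W. \<exists>w\<in>W. z = (v \<oplus> x) \<oplus> (w \<oplus> y)"
      then obtain v w where w: "v \<in> W" "w \<in> W" "z = (v \<oplus> x) \<oplus> (w \<oplus> y)" by auto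
      then have "z = (v \<oplus> w) \<oplus> (x \<oplus> y)" using c that by (simp add: M.add.m_ac)
      then show "\<exists>w\<in>W. z = w \<oplus> (x \<oplus> y)" using w W' by blast
    qed
    then show "z \<in> W +> (x \<oplus> y) \<longleftrightarrow> z \<in> (W +> x) <+> (W +> y)"
      by (simp add: set_add_def' a_r_coset_def')
  qed
  moreover have "(\<Union>y\<in>W +> x. W +> g y) = W +> g x" if "x \<in> carrier M" 
     "g \<in> {act_e M, act_f M, act_k M} \<union> range (\<lambda>c. (\<odot>) c)" for g x
    using that W' by (intro UN_coset[OF W that(1)]) (auto simp: acts_add smult_r_distr)
  then have "W +> g x = (\<Union>y\<in>W +> x. W +> g y)" if "x \<in> carrier M" 
     "g \<in> {act_e M, act_f M, act_k M} \<union> range (\<lambda>c. (\<odot>) c)" for g x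
     using that by metis
  ultimately show ?thesis
    unfolding uhom_def quotient_carrier by (simp add: uquotient_def)
qed

lemma umodule_quotient:
  assumes "usubmodule M W" shows "umodule n (uquotient M W)"
proof (rule umodule_surj_image[OF uhom_quotient[OF assms]])
  show "W +> \<zero> = \<zero>\<^bsub>uquotient M W\<^esub>" using coset_zero[OF assms] by (simp add: uquotient_def)
qed (simp add: quotient_carrier)

text \<open>First isomorphism theorem. Two elements have the same coset exactly if h agrees on them,
  so the value of h at a chosen representative gives a well-defined injective map on cosets.\<close>

lemma uiso_quotient_kernel:
  assumes N: "umodule n' N" and h: "uhom M N h" and surj: "h ` carrier M = carrier N"
  shows "uiso (uquotient M {x \<in> carrier M. h x = \<zero>\<^bsub>N\<^esub>}) N"
    and "usubmodule M {x \<in> carrier M. h x = \<zero>\<^bsub>N\<^esub>}"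
proof -
  interpret N: umod n' N using N by (simp add: umod_def)
  note H = h[unfolded uhom_def]
  let ?W = "{x \<in> carrier M. h x = \<zero>\<^bsub>N\<^esub>}"
  from usubmodule_vimage[OF h N N.usubmodule_zero] show W: "usubmodule M ?W" by simp
  have eq: "?W +> x = ?W +> y \<longleftrightarrow> h x = h y" if xy: "x \<in> carrier M" "y \<in> carrier M" for x y
  proof
    assume "?W +> x = ?W +> y"
    then obtain w where "w \<in> ?W" "x = w \<oplus> y" using coset_eq_iff[OF W xy] by auto
    then show "h x = h y" using H xy by auto
  next
    assume e: "h x = h y"
    have "x = (x \<oplus> (- 1) \<odot> y) \<oplus> y" using xy by (simp add: M.add.m_assoc add_inv_smult)
    moreover have "h (x \<oplus> (- 1) \<odot> y) = \<zero>\<^bsub>N\<^esub>"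
    proof -
      have "h (x \<oplus> (- 1) \<odot> y) = h (y \<oplus> (- 1) \<odot> y)" using H xy e by simp
      also have "y \<oplus> (- 1) \<odot> y = \<zero>" using xy add_inv_smult[of y] by (simp add: M.add.m_comm)
      finally show ?thesis using uhom_zero[OF h N] by simp
    qed
    ultimately show "?W +> x = ?W +> y"
      using xy unfolding coset_eq_iff[OF W xy] by (intro bexI[of _ "x \<oplus> (- 1) \<odot> y"]) auto
  qed
  define g where "g X = h (SOME x. x \<in> carrier M \<and> X = ?W +> x)" for X
  have g: "g (?W +> x) = h x" if "x \<in> carrier M" for x
  proof -
    have "h (SOME y. y \<in> carrier M \<and> ?W +> x = ?W +> y) = h x"
    proof (rule someI2[where Q = "\<lambda>y. h y = h x"])
      show "x \<in> carrier M \<and> ?W +> x = ?W +> x" using that by simp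
      show "h y = h x" if y: "y \<in> carrier M \<and> ?W +> x = ?W +> y" for y
        using eq[of x y] y \<open>x \<in> carrier M\<close> by (metis (lifting))
    qed
    then show ?thesis by (simp only: g_def)
  qed
  have q: "uhom M (uquotient M ?W) (\<lambda>x. ?W +> x)" by (rule uhom_quotient[OF W])
  have "uhom (uquotient M ?W) N g"
    unfolding uhom_def
  proof (intro conjI ballI allI)
    fix X Y c assume "X \<in> carrier (uquotient M ?W)" "Y \<in> carrier (uquotient M ?W)"
    then obtain x y where xy: "x \<in> carrier M" "y \<in> carrier M" "X = ?W +> x" "Y = ?W +> y"
      by (auto simp: quotient_carrier)
    note q' = uhomD[OF q]
    show "g X \<in> carrier N" using xy g H by auto
    show "g (X \<oplus>\<^bsub>uquotient M ?W\<^esub> Y) = g X \<oplus>\<^bsub>N\<^esub> g Y"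
      unfolding xy(3,4) q'(2)[OF xy(1,2), symmetric] using xy by (simp add: g uhomD(2)[OF h])
    show "g (c \<odot>\<^bsub>uquotient M ?W\<^esub> X) = c \<odot>\<^bsub>N\<^esub> g X"
      unfolding xy(3) q'(3)[OF xy(1), symmetric] using xy by (simp add: g uhomD(3)[OF h])
    show "g (act_e (uquotient M ?W) X) = act_e N (g X)" "g (act_f (uquotient M ?W) X) = act_f N (g X)"
       "g (act_k (uquotient M ?W) X) = act_k N (g X)"
      unfolding xy(3) q'(4-6)[OF xy(1), symmetric] using xy by (simp_all add: g uhomD(4-6)[OF h])
  qed
  moreover have "inj_on g (carrier (uquotient M ?W))"
  proof (rule inj_onI)
    fix X Y assume "X \<in> carrier (uquotient M ?W)" "Y \<in> carrier (uquotient M ?W)" and e: "g X = g Y"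
    then obtain x y where xy: "x \<in> carrier M" "y \<in> carrier M" "X = ?W +> x" "Y = ?W +> y"
      by (auto simp: quotient_carrier)
    then show "X = Y" using e eq[of x y] g by simp
  qed
  moreover have "g ` carrier (uquotient M ?W) = carrier N"
    using surj g by (auto simp: quotient_carrier image_image)
  ultimately show "uiso (uquotient M ?W) N" unfolding uiso_iff bij_betw_def by blast
qed

lemma uiso_sym:
  assumes "uiso M N" shows "uiso N M"
proof -
  obtain h where h: "uhom M N h" "bij_betw h (carrier M) (carrier N)" using assms by (auto simp: uiso_iff)
  note H = h(1)[unfolded uhom_def]
  define g where "g = inv_into (carrier M) h"
  have g: "g (h x) = x" if "x \<in> carrier M" for x
    using that h(2) by (simp add: g_def bij_betw_def)
  have all: "(\<forall>y\<in>carrier N. P y) \<longleftrightarrow> (\<forall>x\<in>carrier M. P (h x))" for P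
    unfolding bij_betw_imp_surj_on[OF h(2), symmetric] by auto
  have "uhom N M g"
    unfolding uhom_def all
  proof (intro conjI ballI allI)
    fix x y c assume xy: "x \<in> carrier M" "y \<in> carrier M"
    show "g (h x) \<in> carrier M" using xy by (simp add: g)
    show "g (h x \<oplus>\<^bsub>N\<^esub> h y) = g (h x) \<oplus> g (h y)" "g (c \<odot>\<^bsub>N\<^esub> h x) = c \<odot> g (h x)"
      "g (act_e N (h x)) = act_e M (g (h x))" "g (act_f N (h x)) = act_f M (g (h x))"
      "g (act_k N (h x)) = act_k M (g (h x))"
      using xy by (simp_all add: g uhomD(2-6)[OF h(1), symmetric])
  qed
  moreover have "bij_betw g (carrier N) (carrier M)"
    unfolding g_def by (rule bij_betw_inv_into[OF h(2)])
  ultimately show ?thesis by (auto simp: uiso_iff)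
qed

end

lemma uhom_comp: "uhom M N h \<Longrightarrow> uhom N L g \<Longrightarrow> uhom M L (g \<circ> h)"
  by (simp add: uhom_def)

lemma uiso_trans:
  assumes "uiso M N" "uiso N L" shows "uiso M L"
  using assms unfolding uiso_iff by (meson bij_betw_trans uhom_comp)

text \<open>A submodule of \<open>N\<close> is the image of its preimage, and that preimage is zero
  or everything.\<close>

lemma uirreducible_uiso:
  assumes M: "uirreducible n M" and iso: "uiso M N" and N': "umodule n N"
  shows "uirreducible n N"
proof -
  interpret M: umod n M using M by (simp add: umod_def uirreducible_def)
  interpret N: umod n N using N' by (simp add: umod_def)
  obtain h where h: "uhom M N h" "bij_betw h (carrier M) (carrier N)" using iso by (auto simp: uiso_iff)
  have im: "h ` carrier M = carrier N" and inj: "inj_on h (carrier M)" using h(2) by (auto simp: bij_betw_def)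
  have z: "h \<zero>\<^bsub>M\<^esub> = \<zero>\<^bsub>N\<^esub>" by (rule M.uhom_zero[OF h(1) N'])
  have "W = {\<zero>\<^bsub>N\<^esub>} \<or> W = carrier N" if W: "usubmodule N W" for W
  proof -
    let ?V = "{x \<in> carrier M. h x \<in> W}"
    have WV: "W = h ` ?V" using W im by (auto simp: N.usubmodule_iff)
    have "?V = {\<zero>\<^bsub>M\<^esub>} \<or> ?V = carrier M"
      using M M.usubmodule_vimage[OF h(1) N' W] by (auto simp: uirreducible_def)
    then show ?thesis
    proof
      assume "?V = {\<zero>\<^bsub>M\<^esub>}"
      then have "h ` ?V = {\<zero>\<^bsub>N\<^esub>}" by (simp only: image_insert image_empty z)
      then show ?thesis using WV by simp
    next
      assume "?V = carrier M"
      then show ?thesis using WV im by simp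
    qed
  qed
  moreover have "carrier N \<noteq> {\<zero>\<^bsub>N\<^esub>}"
  proof
    assume N0: "carrier N = {\<zero>\<^bsub>N\<^esub>}"
    have "x = \<zero>\<^bsub>M\<^esub>" if x: "x \<in> carrier M" for x
    proof (rule inj_onD[OF inj _ x])
      show "h x = h \<zero>\<^bsub>M\<^esub>" using uhomD(1)[OF h(1) x] N0 z by simp
    qed simp
    then have "carrier M = {\<zero>\<^bsub>M\<^esub>}" by auto
    then show False using M by (simp add: uirreducible_def)
  qed
  ultimately show ?thesis using N' by (simp add: uirreducible_def)
qed

subsection \<open>Uniqueness of composition multiplicities\<close>

abbreviation factor :: "'v umod \<Rightarrow> 'v set \<Rightarrow> 'v set \<Rightarrow> 'v set umod" where
  "factor M U A \<equiv> uquotient (M\<lparr>carrier := U\<rparr>) A"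

definition chief :: "nat \<Rightarrow> 'v umod \<Rightarrow> 'v set \<Rightarrow> 'v set \<Rightarrow> bool" where
  "chief n M A U \<longleftrightarrow> usubmodule M A \<and> usubmodule M U \<and> A \<subseteq> U \<and> uirreducible n (factor M U A)"

text \<open>Composition series from zero up to a given submodule, in a form that suits induction
  better than indices into a list. The first counter is the length, the second the number of factors
  isomorphic to \<open>S\<close>; the length is the measure for
  \<open>comp_chain_unique\<close>.\<close>

inductive comp_chain :: "nat \<Rightarrow> 'v umod \<Rightarrow> 'w umod \<Rightarrow> 'v set \<Rightarrow> nat \<Rightarrow> nat \<Rightarrow> bool"
  for n M S where
  Nil: "comp_chain n M S {\<zero>\<^bsub>M\<^esub>} 0 0"
| Cons: "comp_chain n M S A k m \<Longrightarrow> chief n M A U \<Longrightarrow>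
    comp_chain n M S U (Suc k) (m + (if uiso (factor M U A) S then 1 else 0))"

context umod
begin

lemma umodule_factor:
  assumes "usubmodule M A" "usubmodule M U" "A \<subseteq> U"
  shows "umodule n (factor M U A)"
  using umod.umodule_quotient[OF umod_sub[OF assms(2)]] usubmodule_sub_iff[OF assms(2)] assms by auto

lemma factor_uhom:
  assumes "usubmodule M A" "usubmodule M U" "A \<subseteq> U"
  shows "uhom (M\<lparr>carrier := U\<rparr>) (factor M U A) (\<lambda>x. A +> x)"
    and "carrier (factor M U A) = (\<lambda>x. A +> x) ` U"
    and "\<zero>\<^bsub>factor M U A\<^esub> = A"
proof -
  interpret U: umod n "M\<lparr>carrier := U\<rparr>" by (rule umod_sub[OF assms(2)])
  have A: "usubmodule (M\<lparr>carrier := U\<rparr>) A" using assms by (simp add: usubmodule_sub_iff)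
  \<comment> \<open>A coset is formed from addition alone, so it does not change when the carrier
    shrinks to \<open>U\<close>.\<close>
  have eq: "a_r_coset (M\<lparr>carrier := U\<rparr>) A = (\<lambda>x. A +> x)" by (auto simp: a_r_coset_def' fun_eq_iff)
  show "uhom (M\<lparr>carrier := U\<rparr>) (factor M U A) (\<lambda>x. A +> x)"
    "carrier (factor M U A) = (\<lambda>x. A +> x) ` U"
    using U.uhom_quotient[OF A] U.quotient_carrier[of A] unfolding eq by simp_all
  show "\<zero>\<^bsub>factor M U A\<^esub> = A" by (simp add: uquotient_def)
qed

text \<open>Correspondence between submodules of U / A and submodules of U that contain A: the image
  of W is zero or everything, and W is recovered from it.\<close>

lemma chief_maximal:
  assumes c: "chief n M A U" and W: "usubmodule M W" "A \<subseteq> W" "W \<subseteq> U"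
  shows "W = A \<or> W = U"
proof -
  have A: "usubmodule M A" "usubmodule M U" "A \<subseteq> U" and irr: "uirreducible n (factor M U A)"
    using c by (auto simp: chief_def)
  note A' = A(1)[unfolded usubmodule_iff] and U' = A(2)[unfolded usubmodule_iff]
    and W' = W(1)[unfolded usubmodule_iff]
  interpret U: umod n "M\<lparr>carrier := U\<rparr>" by (rule umod_sub[OF A(2)])
  have "usubmodule (factor M U A) ((\<lambda>x. A +> x) ` W)"
    using W A usubmodule_sub_iff
    by (intro U.usubmodule_image[OF factor_uhom(1)[OF A] umodule_factor[OF A]]) auto
  then consider "(\<lambda>x. A +> x) ` W = {A}" | "(\<lambda>x. A +> x) ` W = (\<lambda>x. A +> x) ` U"
    using irr factor_uhom[OF A] by (auto simp: uirreducible_def)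
  then show ?thesis
  proof cases
    case 1
    then have "w \<in> A" if "w \<in> W" for w
      using that coset_eq_self_iff[OF A(1), of w] W' by blast
    then show ?thesis using W by blast
  next
    case 2
    have "u \<in> W" if u: "u \<in> U" for u
    proof -
      obtain w where w: "w \<in> W" "A +> u = A +> w" using 2 u by (metis (lifting) image_iff)
      then obtain a where "a \<in> A" "u = a \<oplus> w"
        using coset_eq_iff[OF A(1), of u w] U' W' u by blast
      then show ?thesis using w W W' by blast
    qed
    then show ?thesis using W by blast
  qed
qed

lemma chief_neq:
  assumes "chief n M A U" shows "A \<noteq> U"
proof
  assume e: "A = U"
  have A: "usubmodule M A" "usubmodule M U" "A \<subseteq> U" and irr: "uirreducible n (factor M U A)"
    using assms by (auto simp: chief_def)
  have "A +> x = A" if "x \<in> U" for x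
    using coset_eq_self_iff[OF A(1), of x] that e A by (auto simp: usubmodule_iff)
  moreover have "\<zero> \<in> U" using A by (simp add: usubmodule_iff)
  ultimately have "(\<lambda>x. A +> x) ` U = {A}" by auto
  then show False using irr factor_uhom[OF A] by (simp add: uirreducible_def)
qed

text \<open>Second isomorphism theorem: A + B is strictly larger than A, hence equals U by
  maximality, and the coset map from B onto U / A has kernel A Int B.\<close>

lemma chief_Int:
  assumes c: "chief n M A U" and B: "usubmodule M B" "B \<subseteq> U" "\<not> B \<subseteq> A"
  shows "chief n M (A \<inter> B) B" and "uiso (factor M B (A \<inter> B)) (factor M U A)"
proof -
  have A: "usubmodule M A" "usubmodule M U" "A \<subseteq> U" and irr: "uirreducible n (factor M U A)"
    using c by (auto simp: chief_def)
  note A' = A(1)[unfolded usubmodule_iff] and U' = A(2)[unfolded usubmodule_iff]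
    and B' = B(1)[unfolded usubmodule_iff]
  let ?S = "{a \<oplus> b |a b. a \<in> A \<and> b \<in> B}"
  have "?S \<subseteq> U" using U' A(3) B(2) by blast
  from chief_maximal[OF c usubmodule_sum(1,2)[OF A(1) B(1)] this]
  have S: "?S = U" using usubmodule_sum(3)[OF A(1) B(1)] B(3) by auto
  interpret B: umod n "M\<lparr>carrier := B\<rparr>" by (rule umod_sub[OF B(1)])
  interpret F: umod n "factor M U A" using umodule_factor[OF A] by (simp add: umod_def)
  have h: "uhom (M\<lparr>carrier := B\<rparr>) (factor M U A) (\<lambda>x. A +> x)"
    using factor_uhom(1)[OF A] B(2) unfolding uhom_def by (simp add: subset_iff)
  have surj: "(\<lambda>x. A +> x) ` carrier (M\<lparr>carrier := B\<rparr>) = carrier (factor M U A)"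
  proof -
    have "A +> u \<in> (\<lambda>x. A +> x) ` B" if u: "u \<in> U" for u
    proof -
      obtain a b where ab: "a \<in> A" "b \<in> B" "u = a \<oplus> b" using u unfolding S[symmetric] by blast
      then have "A +> u = A +> b"
        using coset_eq_iff[OF A(1), of u b] U' B' u by blast
      then show ?thesis using ab by blast
    qed
    then show ?thesis using factor_uhom(2)[OF A] B(2) by auto
  qed
  have ker: "{x \<in> carrier (M\<lparr>carrier := B\<rparr>). A +> x = \<zero>\<^bsub>factor M U A\<^esub>} = A \<inter> B"
    using coset_eq_self_iff[OF A(1)] B' unfolding factor_uhom(3)[OF A] by auto
  show iso: "uiso (factor M B (A \<inter> B)) (factor M U A)"
    using B.uiso_quotient_kernel(1)[OF F.umodule h surj] unfolding ker .
  have AB: "usubmodule M (A \<inter> B)" by (rule usubmodule_Int[OF A(1) B(1)])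
  interpret D: umod n "factor M B (A \<inter> B)" using umodule_factor[OF AB B(1)] by (simp add: umod_def)
  show "chief n M (A \<inter> B) B"
    using uirreducible_uiso[OF irr D.uiso_sym[OF iso] D.umodule] AB B
    by (simp add: chief_def)
qed

text \<open>The chain is intersected with D. A link from A to U is dropped if D lies in A and
  otherwise remains a link by \<open>chief_Int\<close>, so the length cannot grow.\<close>

lemma comp_chain_sub:
  assumes "comp_chain n M S U k m" "usubmodule M D" "D \<subseteq> U"
  shows "\<exists>j\<le>k. \<exists>m'. comp_chain n M S D j m'"
  using assms
proof (induction arbitrary: D rule: comp_chain.induct)
  case Nil
  then have "D = {\<zero>}" by (auto simp: usubmodule_iff)
  then show ?case using comp_chain.Nil by blast
next
  case (Cons A k m U)
  show ?case
  proof (cases "D \<subseteq> A")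
    case True
    then show ?thesis using Cons le_Suc_eq by blast
  next
    case False
    have "usubmodule M (A \<inter> D)" using Cons by (intro usubmodule_Int) (auto simp: chief_def)
    then obtain j m' where "j \<le> k" "comp_chain n M S (A \<inter> D) j m'" using Cons.IH by blast
    then show ?thesis
      using comp_chain.Cons[OF _ chief_Int(1)[OF Cons.hyps(2) Cons.prems False]] by (meson Suc_le_mono)
  qed
qed

text \<open>Jordan-Hoelder by induction on the length. If the last links start at different A and B,
  their intersection D satisfies U / A = B / D and U / B = A / D up to isomorphism, so passing
  through D merely exchanges the two top factors.\<close>

lemma comp_chain_unique:
  assumes "comp_chain n M S U k m" "comp_chain n M S U k' m'"
  shows "k = k' \<and> m = m'"
  using assms
proof (induction k arbitrary: U m k' m')
  case 0
  then have U: "U = {\<zero>}" by (auto elim: comp_chain.cases)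
  from 0(2) show ?case
  proof cases
    case Nil
    then show ?thesis using 0(1) by (auto elim: comp_chain.cases)
  next
    case (Cons B l p)
    then have "B = {\<zero>}" using U by (auto simp: chief_def usubmodule_iff)
    then show ?thesis using chief_neq Cons U by blast
  qed
next
  case (Suc k)
  from Suc.prems(1) obtain A m1 where A: "comp_chain n M S A k m1" "chief n M A U"
    "m = m1 + (if uiso (factor M U A) S then 1 else 0)"
    by (auto elim: comp_chain.cases)
  from Suc.prems(2) consider "U = {\<zero>}" | B l m2 where "comp_chain n M S B l m2" "chief n M B U"
    "m' = m2 + (if uiso (factor M U B) S then 1 else 0)" "k' = Suc l"
    by (auto elim: comp_chain.cases)
  then show ?case
  proof cases
    case 1
    then have "A = {\<zero>}" using A by (auto simp: chief_def usubmodule_iff)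
    then show ?thesis using chief_neq A 1 by blast
  next
    case B: 2
    show ?thesis
    proof (cases "A = B")
      case True
      then show ?thesis using Suc.IH[OF A(1)] B A by auto
    next
      case False
      have sub: "usubmodule M A" "usubmodule M B" "A \<subseteq> U" "B \<subseteq> U"
        using A B by (auto simp: chief_def)
      have nAB: "\<not> A \<subseteq> B" "\<not> B \<subseteq> A"
        using chief_maximal[OF A(2) sub(2)] chief_maximal[OF B(2) sub(1)] sub False
          chief_neq[OF A(2)] chief_neq[OF B(2)] by blast+
      let ?D = "A \<inter> B"
      have D: "usubmodule M ?D" by (rule usubmodule_Int[OF sub(1,2)])
      have cB: "chief n M ?D B" "uiso (factor M B ?D) (factor M U A)"
        using chief_Int[OF A(2) sub(2,4) nAB(2)] by auto
      have cA: "chief n M ?D A" "uiso (factor M A ?D) (factor M U B)"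
        using chief_Int[OF B(2) sub(1,3) nAB(1)] by (auto simp: Int_commute)
      obtain j p where j: "comp_chain n M S ?D j p"
        using comp_chain_sub[OF A(1) D] by blast
      have 1: "k = Suc j \<and> m1 = p + (if uiso (factor M A ?D) S then 1 else 0)"
        using Suc.IH[OF A(1) comp_chain.Cons[OF j cA(1)]] .
      \<comment> \<open>The chain of B through D has the length k just obtained for A, so the
        induction hypothesis covers B as well.\<close>
      have "comp_chain n M S B k (p + (if uiso (factor M B ?D) S then 1 else 0))"
        using comp_chain.Cons[OF j cB(1)] 1 by simp
      from Suc.IH[OF this B(1)] have 2: "k = l" "m2 = p + (if uiso (factor M B ?D) S then 1 else 0)"
        by auto
      have iso: "uiso F S \<longleftrightarrow> uiso F' S" if "uiso F F'" "umodule n F" for F F' :: "'v set umod"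
      proof -
        have "uiso F' F" using that umod.uiso_sym[of n F F'] by (simp add: umod_def)
        then show ?thesis using uiso_trans[of F' F S] uiso_trans[OF that(1), of S] by blast
      qed
      have "uiso (factor M A ?D) S = uiso (factor M U B) S" "uiso (factor M B ?D) S = uiso (factor M U A) S"
        using iso cA cB umodule_factor[OF D sub(1)] umodule_factor[OF D sub(2)] by auto
      then show ?thesis using 1 2 A B by simp
    qed
  qed
qed

end

section \<open>Computing multiplicities by adding one irreducible quotient at a time\<close>

definition comp_count :: "nat \<Rightarrow> 'v umod \<Rightarrow> 'w umod \<Rightarrow> nat \<Rightarrow> bool" where
  "comp_count n M S m \<longleftrightarrow> (\<exists>Ws. comp_series n M Ws \<and>
     m = card {i. Suc i < length Ws \<and> uiso (comp_factor M Ws i) S})"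

lemma card_less_Suc_Collect:
  "card {i. i < Suc k \<and> P i} = card {i. i < k \<and> P i} + (if P k then 1 else 0)"
proof -
  have "{i. i < Suc k \<and> P i} = (if P k then insert k {i. i < k \<and> P i} else {i. i < k \<and> P i})"
    by (auto simp: less_Suc_eq)
  then show ?thesis by auto
qed

lemma comp_series_comp_chain:
  assumes Ws: "comp_series n M Ws" and "k < length Ws"
  shows "comp_chain n M S (Ws ! k) k (card {i. i < k \<and> uiso (comp_factor M Ws i) S})"
  using assms(2)
proof (induction k)
  case 0
  have "Ws ! 0 = {\<zero>\<^bsub>M\<^esub>}" using Ws unfolding comp_series_def by (metis hd_conv_nth)
  then show ?case using comp_chain.Nil[of n M S] by simp
next
  case (Suc k)
  have "chief n M (Ws ! k) (Ws ! Suc k)"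
    using Ws Suc.prems by (auto simp: comp_series_def chief_def comp_factor_def)
  from comp_chain.Cons[OF Suc.IH this] Suc.prems show ?case
    by (simp add: card_less_Suc_Collect comp_factor_def)
qed

lemma comp_count_unique:
  assumes "comp_count n M S m" "comp_count n M S m'" shows "m = m'"
proof -
  have "\<exists>k. comp_chain n M S (carrier M) k m" if "comp_count n M S m" for m
  proof -
    from that obtain Ws where Ws: "comp_series n M Ws"
      and m: "m = card {i. Suc i < length Ws \<and> uiso (comp_factor M Ws i) S}"
      by (auto simp: comp_count_def)
    then have "Ws \<noteq> []" "Ws ! (length Ws - 1) = carrier M" by (auto simp: comp_series_def last_conv_nth)
    moreover have "{i. Suc i < length Ws \<and> uiso (comp_factor M Ws i) S}
        = {i. i < length Ws - 1 \<and> uiso (comp_factor M Ws i) S}" by auto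
    ultimately show ?thesis
      using comp_series_comp_chain[OF Ws, of "length Ws - 1" S] m by auto
  qed
  moreover have "umod n M" using assms(1) by (auto simp: comp_count_def comp_series_def umod_def)
  ultimately show ?thesis using umod.comp_chain_unique assms by blast
qed

lemma comp_mult_eq: "comp_count n M S m \<Longrightarrow> comp_mult n M S = m"
  unfolding comp_mult_def comp_count_def[symmetric]
  by (rule the_equality) (auto intro: comp_count_unique)

lemma comp_count_zero:
  assumes "umodule n M" "carrier M = {\<zero>\<^bsub>M\<^esub>}" shows "comp_count n M S 0"
  unfolding comp_count_def
  using assms umod.usubmodule_carrier[of n M]
  by (intro exI[of _ "[carrier M]"]) (auto simp: comp_series_def umod_def)

text \<open>A composition series of the kernel, prolonged by the whole module, is one of
  \<open>M\<close>, and its top factor is isomorphic to \<open>N\<close>.\<close>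

lemma comp_count_kernel:
  assumes M: "umodule n M" and N: "uirreducible n N" and h: "uhom M N h"
    and surj: "h ` carrier M = carrier N"
    and count: "comp_count n (M\<lparr>carrier := {x \<in> carrier M. h x = \<zero>\<^bsub>N\<^esub>}\<rparr>) S m"
  shows "comp_count n M S (m + (if uiso N S then 1 else 0))"
proof -
  interpret M: umod n M using M by (simp add: umod_def)
  have N': "umodule n N" using N by (simp add: uirreducible_def)
  interpret N: umod n N using N' by (simp add: umod_def)
  let ?W = "{x \<in> carrier M. h x = \<zero>\<^bsub>N\<^esub>}"
  have iso: "uiso (uquotient M ?W) N" and W: "usubmodule M ?W"
    using M.uiso_quotient_kernel[OF N' h surj] by auto
  interpret Q: umod n "uquotient M ?W" using M.umodule_quotient[OF W] by (simp add: umod_def)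
  have irr: "uirreducible n (uquotient M ?W)"
    by (rule uirreducible_uiso[OF N Q.uiso_sym[OF iso] Q.umodule])
  have isoS: "uiso (uquotient M ?W) S \<longleftrightarrow> uiso N S"
    using uiso_trans[OF Q.uiso_sym[OF iso]] uiso_trans[OF iso] by blast
  obtain Ws where Ws: "comp_series n (M\<lparr>carrier := ?W\<rparr>) Ws"
    and m: "m = card {i. Suc i < length Ws \<and> uiso (comp_factor (M\<lparr>carrier := ?W\<rparr>) Ws i) S}"
    using count by (auto simp: comp_count_def)
  obtain k where k: "length Ws = Suc k" using Ws by (cases Ws) (auto simp: comp_series_def)
  let ?Vs = "Ws @ [carrier M]"
  have old: "comp_factor M ?Vs i = comp_factor (M\<lparr>carrier := ?W\<rparr>) Ws i" if "i < k" for i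
    using that k by (simp add: comp_factor_def nth_append)
  have "last Ws = Ws ! k" using k by (metis diff_Suc_1 last_conv_nth list.size(3) nat.distinct(1))
  then have "Ws ! k = ?W" using Ws by (simp add: comp_series_def)
  then have new: "comp_factor M ?Vs k = uquotient M ?W"
    using k by (simp add: comp_factor_def nth_append)
  have "comp_series n M ?Vs"
    unfolding comp_series_def
  proof (intro conjI ballI allI impI)
    show "hd ?Vs = {\<zero>\<^bsub>M\<^esub>}" using Ws by (simp add: comp_series_def)
    show "usubmodule M X" if "X \<in> set ?Vs" for X
      using that Ws M.usubmodule_sub_iff[OF W] M.usubmodule_carrier by (auto simp: comp_series_def)
    fix i assume "Suc i < length ?Vs"
    then consider "i < k" | "i = k" using k by fastforce
    then have "?Vs ! i \<subseteq> ?Vs ! Suc i \<and> uirreducible n (comp_factor M ?Vs i)"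
    proof cases
      case 1
      then show ?thesis unfolding old[OF 1] using Ws k by (simp add: comp_series_def nth_append)
    next
      case 2
      then show ?thesis using new irr \<open>Ws ! k = ?W\<close> k by (auto simp: nth_append)
    qed
    then show "?Vs ! i \<subseteq> ?Vs ! Suc i" "uirreducible n (comp_factor M ?Vs i)" by auto
  qed (use M in auto)
  moreover have "m + (if uiso N S then 1 else 0)
      = card {i. Suc i < length ?Vs \<and> uiso (comp_factor M ?Vs i) S}"
  proof -
    have "{i. i < k \<and> uiso (comp_factor M ?Vs i) S} = {i. i < k \<and> uiso (comp_factor (M\<lparr>carrier := ?W\<rparr>) Ws i) S}"
      using old by auto
    then show ?thesis using m k by (simp add: card_less_Suc_Collect new isoS)
  qed
  ultimately show ?thesis unfolding comp_count_def by blast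
qed

section \<open>Quantum integers and the modules $V_r$\<close>

lemma xi_nonzero [simp]: "xi n \<noteq> 0"
  by (simp add: xi_def)

lemma xi_powi_eq_1_iff:
  assumes "0 < n" shows "xi n powi m = 1 \<longleftrightarrow> int n dvd m"
proof -
  have "xi n = cis (2 * pi / real n)"
    by (simp add: xi_def cis_conv_exp mult_ac)
  then have e: "xi n powi m = cis (of_int m * (2 * pi / real n))"
    by (simp add: cis_power_int)
  show ?thesis
  proof
    assume "xi n powi m = 1"
    then have "cos (of_int m * (2 * pi / real n)) = 1" unfolding e by (simp add: complex_eq_iff)
    then obtain x :: int where "of_int m * (2 * pi / real n) = of_int x * 2 * pi"
      by (auto simp: cos_one_2pi_int)
    then have "of_int m = of_int x * real n" using assms by (simp add: field_simps)
    then have "m = x * int n" by (metis of_int_eq_iff of_int_mult of_int_of_nat_eq)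
    then show "int n dvd m" by simp
  next
    assume "int n dvd m"
    then obtain x where "m = int n * x" by auto
    then have "of_int m * (2 * pi / real n) = 2 * pi * of_int x" using assms by (simp add: field_simps)
    then show "xi n powi m = 1" unfolding e using cis_multiple_2pi[of "of_int x"] by simp
  qed
qed

lemma xi_power_n: "0 < n \<Longrightarrow> (xi n powi m) ^ n = 1"
  using xi_powi_eq_1_iff[of n "m * int n"] by (simp add: power_int_mult)

text \<open>A separate name keeps the common denominator atomic while fractions are cleared.\<close>

definition xi_diff :: "nat \<Rightarrow> complex" where
  "xi_diff n = xi n - inverse (xi n)"

lemma qint_eq: "qint n m = (xi n powi m - inverse (xi n powi m)) / xi_diff n"
  by (simp add: qint_def power_int_minus xi_diff_def)

context
  fixes n :: nat
  assumes n: "odd n" "3 \<le> n"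
begin

lemma n_dvd_2: "int n dvd 2 * m \<longleftrightarrow> int n dvd m"
  using n(1) by (intro coprime_dvd_mult_right_iff) simp

lemma xi_diff_nonzero: "xi_diff n \<noteq> 0"
proof
  assume "xi_diff n = 0"
  then have "xi n * xi n = 1" by (simp add: xi_diff_def field_simps)
  then have "xi n powi 2 = 1" by (simp add: power2_eq_square)
  then have "int n dvd 2" using xi_powi_eq_1_iff[of n 2] n by simp
  then show False using n by (auto dest: zdvd_imp_le)
qed

lemma qint_eq_0_iff: "qint n m = 0 \<longleftrightarrow> int n dvd m"
proof -
  have "qint n m = 0 \<longleftrightarrow> xi n powi m * xi n powi m = 1"
    using xi_diff_nonzero by (auto simp: qint_eq field_simps)
  also have "xi n powi m * xi n powi m = xi n powi (2 * m)"
    by (simp add: power_int_add[symmetric])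
  also have "\<dots> = 1 \<longleftrightarrow> int n dvd m"
    using xi_powi_eq_1_iff[of n "2 * m"] n n_dvd_2 by simp
  finally show ?thesis .
qed

lemma qint_nonzero: "0 < m \<Longrightarrow> m < int n \<Longrightarrow> qint n m \<noteq> 0"
  by (auto simp: qint_eq_0_iff dest: zdvd_imp_le)

lemma qint_0 [simp]: "qint n 0 = 0" by (simp add: qint_eq)

lemma qint_1 [simp]: "qint n 1 = 1" using xi_diff_nonzero by (simp add: qint_eq xi_diff_def)

lemma qint_minus: "qint n (- m) = - qint n m"
  using xi_diff_nonzero by (simp add: qint_eq power_int_minus field_simps)

lemma qint_n [simp]: "qint n (int n) = 0" by (simp add: qint_eq_0_iff)

lemma qint_n_minus: "qint n (int n - m) = - qint n m"
proof -
  have "xi n powi (int n - m) = xi n powi (- m)"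
    using xi_powi_eq_1_iff[of n "int n"] n by (simp add: power_int_diff power_int_minus field_simps)
  then have "qint n (int n - m) = qint n (- m)" by (simp add: qint_eq)
  then show ?thesis by (simp add: qint_minus)
qed

text \<open>The two ways of splitting a power of xi off [m + 1]. They mirror the two summands in the
  coproducts of f and e and carry all compatibility checks on the tensor product.\<close>

lemma qint_add_1: "qint n (m + 1) = inverse (xi n powi m) + xi n * qint n m"
  using xi_diff_nonzero
  by (simp add: qint_eq power_int_add divide_simps) (simp add: xi_diff_def field_simps)

lemma qint_add_1': "qint n (m + 1) = xi n powi m + inverse (xi n) * qint n m"
  using xi_diff_nonzero
  by (simp add: qint_eq power_int_add divide_simps) (simp add: xi_diff_def field_simps)

text \<open>The left side is the eigenvalue of ef - fe on \<open>v_i\<close> in \<open>V_r\<close>,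
  the right side that of (k - 1/k) / (xi - 1/xi). It is an identity of Laurent polynomials in xi and
  its powers a, b with exponents r, i, so r and i may be arbitrary integers.\<close>

lemma qint_commutator:
  "qint n (r - i) * qint n (i + 1) - qint n i * qint n (r - i + 1) = qint n (r - 2 * i)"
proof -
  define a b q where "a = xi n powi r" and "b = xi n powi i" and "q = xi n"
  have nz: "a \<noteq> 0" "b \<noteq> 0" "q \<noteq> 0" by (auto simp: a_def b_def q_def)
  have p: "xi n powi (r - i) = a / b" "xi n powi (i + 1) = b * q" "xi n powi (r - i + 1) = a / b * q"
     "xi n powi (r - 2 * i) = a / (b * b)"
    unfolding a_def b_def q_def mult_2 by (simp_all only: power_int_diff power_int_add xi_nonzero
        power_int_1_right simp_thms)
  have "(a / b - inverse (a / b)) * (b * q - inverse (b * q)) - (b - inverse b) * (a / b * q - inverse (a / b * q))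
      = (a / (b * b) - inverse (a / (b * b))) * (q - inverse q)"
    using nz by (simp add: field_simps)
  then have "((a / b - inverse (a / b)) * (b * q - inverse (b * q)) - (b - inverse b) * (a / b * q - inverse (a / b * q)))
      / (xi_diff n * xi_diff n) = (a / (b * b) - inverse (a / (b * b))) / xi_diff n"
    using xi_diff_nonzero by (simp add: xi_diff_def q_def)
  then show ?thesis
    unfolding qint_eq p b_def[symmetric] times_divide_times_eq diff_divide_distrib[symmetric] .
qed

end

section \<open>A criterion for function spaces on which k is diagonal\<close>

lemma funpow_diagonal:
  fixes \<kappa> :: "'i \<Rightarrow> complex"
  assumes "\<And>x. x \<in> C \<Longrightarrow> g x = (\<lambda>i. \<kappa> i * x i)" "\<And>x. x \<in> C \<Longrightarrow> g x \<in> C" "x \<in> C"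
  shows "(g ^^ m) x = (\<lambda>i. \<kappa> i ^ m * x i)" and "(g ^^ m) x \<in> C"
proof -
  have "(g ^^ m) x = (\<lambda>i. \<kappa> i ^ m * x i) \<and> (g ^^ m) x \<in> C"
  proof (induction m)
    case (Suc m)
    have "(g ^^ Suc m) x = (\<lambda>i. \<kappa> i * (g ^^ m) x i)"
      unfolding funpow.simps o_apply by (rule assms(1)[OF conjunct2[OF Suc]])
    also have "\<dots> = (\<lambda>i. \<kappa> i ^ Suc m * x i)" using Suc by (simp add: mult.assoc)
    finally show ?case using assms(2)[OF conjunct2[OF Suc]] by simp
  qed (use assms in simp)
  then show "(g ^^ m) x = (\<lambda>i. \<kappa> i ^ m * x i)" "(g ^^ m) x \<in> C" by auto
qed

lemma act_kinv_diagonal: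
  fixes M :: "('i \<Rightarrow> complex) umod"
  assumes "\<And>x. x \<in> carrier M \<Longrightarrow> act_k M x = (\<lambda>i. \<kappa> i * x i)"
    and "\<And>x. x \<in> carrier M \<Longrightarrow> act_k M x \<in> carrier M" and "x \<in> carrier M"
    and "\<And>i. \<kappa> i ^ n = 1" and "0 < n"
  shows "act_kinv n M x = (\<lambda>i. inverse (\<kappa> i) * x i)" and "act_kinv n M x \<in> carrier M"
proof -
  have "\<kappa> i * \<kappa> i ^ (n - 1) = 1" for i
    using assms(4)[of i] assms(5) by (cases n) auto
  then have "\<kappa> i ^ (n - 1) = inverse (\<kappa> i)" for i
    by (metis inverse_unique)
  then show "act_kinv n M x = (\<lambda>i. inverse (\<kappa> i) * x i)" "act_kinv n M x \<in> carrier M"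
    using funpow_diagonal[of "carrier M" "act_k M" \<kappa> x "n - 1"] assms(1-3)
    by (auto simp: act_kinv_def)
qed

text \<open>If k is diagonal with entries that are n-th roots of unity, its inverse is diagonal too.
  The conjugation relations can then be checked without the inverse, and the commutator relation
  becomes a scalar identity at each coordinate.\<close>

lemma function_umoduleI:
  fixes M :: "('i \<Rightarrow> complex) umod"
  assumes ops: "zero M = 0" "add M = (+)" "smult M = fscale"
    and closed: "0 \<in> carrier M" "\<And>x y. x \<in> carrier M \<Longrightarrow> y \<in> carrier M \<Longrightarrow> x + y \<in> carrier M"
      "\<And>c x. x \<in> carrier M \<Longrightarrow> fscale c x \<in> carrier M"
    and lin: "linear_endo M (act_e M)" "linear_endo M (act_f M)"
    and K: "\<And>x. x \<in> carrier M \<Longrightarrow> act_k M x = (\<lambda>i. \<kappa> i * x i)"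
      "\<And>x. x \<in> carrier M \<Longrightarrow> act_k M x \<in> carrier M" "\<And>i. \<kappa> i ^ n = 1"
    and nil: "\<And>x. x \<in> carrier M \<Longrightarrow> (act_e M ^^ n) x = 0" "\<And>x. x \<in> carrier M \<Longrightarrow> (act_f M ^^ n) x = 0"
    and ke: "\<And>x. x \<in> carrier M \<Longrightarrow> act_k M (act_e M x) = fscale (xi n powi 2) (act_e M (act_k M x))"
    and kf: "\<And>x. x \<in> carrier M \<Longrightarrow> act_k M (act_f M x) = fscale (xi n powi (- 2)) (act_f M (act_k M x))"
    and comm: "\<And>x i. x \<in> carrier M \<Longrightarrow> act_e M (act_f M x) i - act_f M (act_e M x) i
       = (\<kappa> i - inverse (\<kappa> i)) / xi_diff n * x i"
    and n: "0 < n"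
  shows "umodule n M"
proof -
  have ops': "x \<oplus>\<^bsub>M\<^esub> y = x + y" "\<zero>\<^bsub>M\<^esub> = 0" "c \<odot>\<^bsub>M\<^esub> x = fscale c x" for x y c
    using ops by simp_all
  have "abelian_group M"
  proof (rule abelian_groupI)
    show "\<exists>y\<in>carrier M. y \<oplus>\<^bsub>M\<^esub> x = \<zero>\<^bsub>M\<^esub>" if "x \<in> carrier M" for x
      unfolding ops' using closed(3)[OF that, of "- 1"] by (intro bexI) (auto simp: fscale_def fun_eq_iff)
  qed (use closed in \<open>auto simp: ops' add_ac\<close>)
  then have "module complex_ring M"
    by (rule moduleI[OF cring_complex_ring]) (use closed in \<open>auto simp: ops' fscale_def fun_eq_iff algebra_simps\<close>)
  moreover have "linear_endo M (act_k M)"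
    unfolding linear_endo_def ops' using K closed by (auto simp: fscale_def fun_eq_iff algebra_simps)
  moreover have kinv: "act_kinv n M x = (\<lambda>i. inverse (\<kappa> i) * x i)" "act_kinv n M x \<in> carrier M"
    if "x \<in> carrier M" for x
    using act_kinv_diagonal[of M \<kappa> x n] K n that by auto
  moreover have "(act_k M ^^ n) x = x" if "x \<in> carrier M" for x
    using funpow_diagonal(1)[of "carrier M" "act_k M" \<kappa> x n] K that by simp
  \<comment> \<open>This converts \<open>ke\<close> and \<open>kf\<close>, applied to the vector
    \<open>act_kinv n M x\<close>, into the conjugation relations.\<close>
  moreover have "act_k M (act_kinv n M x) = x" if "x \<in> carrier M" for x
  proof -
    have "\<kappa> i \<noteq> 0" for i using K(3)[of i] n by (intro notI) (simp add: power_0_left)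
    then show ?thesis using kinv[OF that] K(1)[of "act_kinv n M x"] by (auto simp: fun_eq_iff)
  qed
  ultimately show ?thesis
    unfolding umodule_iff ops' using lin nil
    by (auto simp: ke kf)
       (auto simp: fun_eq_iff fscale_def K(1) kinv(1) comm[unfolded xi_diff_def] algebra_simps diff_divide_distrib)
qed

section \<open>The modules \<open>V_r\<close> in coordinates\<close>

lemma sum_fun_apply: "(\<Sum>j\<in>A. F j) i = (\<Sum>j\<in>A. F j i)"
  by (induction A rule: infinite_finite_induct) auto

lemma V_carrier: "v \<in> carrier (V n r) \<longleftrightarrow> (\<forall>j>r. v j = 0)"
  by (simp add: V_def)

lemma V_ops [simp]:
  "zero (V n r) = 0" "add (V n r) = (+)" "smult (V n r) = fscale"
  by (simp_all add: V_def)

lemma act_e_V: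
  assumes "v \<in> carrier (V n r)"
  shows "act_e (V n r) v = (\<lambda>i. qint n (int r - int i) * v (Suc i))"
proof
  fix i
  have "act_e (V n r) v i = (\<Sum>j\<le>r. v j * (qint n (int r - int j + 1) * vbasis r (int j - 1) i))"
    by (simp add: V_def lin_ext_def sum_fun_apply fscale_def)
  also have "\<dots> = (\<Sum>j\<le>r. if j = Suc i then qint n (int r - int i) * v (Suc i) else 0)"
    by (intro sum.cong refl) (auto simp: vbasis_def of_nat_diff)
  finally show "act_e (V n r) v i = qint n (int r - int i) * v (Suc i)"
    using assms by (simp add: V_carrier)
qed

lemma act_f_V:
  assumes "v \<in> carrier (V n r)"
  shows "act_f (V n r) v = (\<lambda>i. if 0 < i \<and> i \<le> r then qint n (int i) * v (i - 1) else 0)"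
proof
  fix i
  have "act_f (V n r) v i = (\<Sum>j\<le>r. v j * (qint n (int j + 1) * vbasis r (int j + 1) i))"
    by (simp add: V_def lin_ext_def sum_fun_apply fscale_def)
  also have "\<dots> = (\<Sum>j\<le>r. if j = i - 1 then (if 0 < i \<and> i \<le> r then qint n (int i) * v (i - 1) else 0) else 0)"
    by (intro sum.cong refl) (auto simp: vbasis_def of_nat_diff)
  finally show "act_f (V n r) v i = (if 0 < i \<and> i \<le> r then qint n (int i) * v (i - 1) else 0)"
    by auto
qed

lemma act_k_V:
  assumes "v \<in> carrier (V n r)"
  shows "act_k (V n r) v = (\<lambda>i. xi n powi (int r - 2 * int i) * v i)"
proof
  fix i
  have "act_k (V n r) v i = (\<Sum>j\<le>r. v j * (xi n powi (int r - 2 * int j) * vbasis r (int j) i))"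
    by (simp add: V_def lin_ext_def sum_fun_apply fscale_def)
  also have "\<dots> = (\<Sum>j\<le>r. if j = i then xi n powi (int r - 2 * int i) * v i else 0)"
    by (intro sum.cong refl) (auto simp: vbasis_def of_nat_diff)
  finally show "act_k (V n r) v i = xi n powi (int r - 2 * int i) * v i"
    using assms by (simp add: V_carrier)
qed

lemma acts_V_closed:
  assumes "v \<in> carrier (V n r)"
  shows "act_e (V n r) v \<in> carrier (V n r)" "act_f (V n r) v \<in> carrier (V n r)"
    "act_k (V n r) v \<in> carrier (V n r)"
  unfolding act_e_V[OF assms] act_f_V[OF assms] act_k_V[OF assms] using assms
  by (auto simp: V_carrier)

lemma V_closed:
  "0 \<in> carrier (V n r)" "x \<in> carrier (V n r) \<Longrightarrow> y \<in> carrier (V n r) \<Longrightarrow> x + y \<in> carrier (V n r)"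
  "x \<in> carrier (V n r) \<Longrightarrow> fscale c x \<in> carrier (V n r)"
  by (auto simp: V_carrier fscale_def)

lemma linear_endo_V: "linear_endo (V n r) (act_e (V n r))" "linear_endo (V n r) (act_f (V n r))"
proof -
  show "linear_endo (V n r) (act_e (V n r))"
    unfolding linear_endo_def
    by (intro conjI ballI allI acts_V_closed; simp add: act_e_V V_closed fun_eq_iff)
       (simp_all add: fscale_def algebra_simps)
  show "linear_endo (V n r) (act_f (V n r))"
    unfolding linear_endo_def
    by (intro conjI ballI allI acts_V_closed; simp add: act_f_V V_closed fun_eq_iff)
       (simp_all add: fscale_def algebra_simps)
qed

lemma act_e_V_funpow:
  assumes "v \<in> carrier (V n r)"
  shows "(act_e (V n r) ^^ m) v = (\<lambda>i. (\<Prod>s<m. qint n (int r - int i - int s)) * v (i + m))"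
    and "(act_e (V n r) ^^ m) v \<in> carrier (V n r)"
proof -
  show c: "(act_e (V n r) ^^ m) v \<in> carrier (V n r)" for m
    by (rule linear_endo_funpow_closed[OF linear_endo_V(1) assms])
  show "(act_e (V n r) ^^ m) v = (\<lambda>i. (\<Prod>s<m. qint n (int r - int i - int s)) * v (i + m))"
  proof (induction m)
    case (Suc m)
    have eq: "(\<Prod>s<Suc m. qint n (int r - int i - int s))
        = qint n (int r - int i) * (\<Prod>s<m. qint n (int r - int (Suc i) - int s))" for i
      unfolding prod.lessThan_Suc_shift by (simp add: algebra_simps)
    have "(act_e (V n r) ^^ Suc m) v = (\<lambda>i. qint n (int r - int i) * (act_e (V n r) ^^ m) v (Suc i))"
      using act_e_V[OF c[of m]] by simp
    then show ?case unfolding Suc.IH eq by (simp add: mult.assoc)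
  qed simp
qed

lemma act_f_V_funpow:
  assumes "v \<in> carrier (V n r)"
  shows "(act_f (V n r) ^^ m) v =
      (\<lambda>i. if m \<le> i \<and> i \<le> r then (\<Prod>s<m. qint n (int i - int s)) * v (i - m) else 0)"
    and "(act_f (V n r) ^^ m) v \<in> carrier (V n r)"
proof -
  show c: "(act_f (V n r) ^^ m) v \<in> carrier (V n r)" for m
    by (rule linear_endo_funpow_closed[OF linear_endo_V(2) assms])
  show "(act_f (V n r) ^^ m) v =
      (\<lambda>i. if m \<le> i \<and> i \<le> r then (\<Prod>s<m. qint n (int i - int s)) * v (i - m) else 0)"
  proof (induction m)
    case 0
    then show ?case using assms by (auto simp: fun_eq_iff V_carrier)
  next
    case (Suc m)
    have eq: "(\<Prod>s<Suc m. qint n (int i - int s)) = qint n (int i) * (\<Prod>s<m. qint n (int (i - 1) - int s))"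
      if "0 < i" for i
      unfolding prod.lessThan_Suc_shift using that by (simp add: of_nat_diff algebra_simps)
    have "(act_f (V n r) ^^ Suc m) v =
        (\<lambda>i. if 0 < i \<and> i \<le> r then qint n (int i) * (act_f (V n r) ^^ m) v (i - 1) else 0)"
      using act_f_V[OF c[of m]] by simp
    also have "\<dots> = (\<lambda>i. if Suc m \<le> i \<and> i \<le> r then (\<Prod>s<Suc m. qint n (int i - int s)) * v (i - Suc m) else 0)"
      unfolding Suc.IH using eq by (auto simp: fun_eq_iff mult.assoc simp del: prod.lessThan_Suc)
    finally show ?case .
  qed
qed

context
  fixes n :: nat
  assumes n: "odd n" "3 \<le> n"
begin

text \<open>The case \<open>r = n\<close> is needed for \<open>V\<^sub>1 \<otimes> V\<^bsub>n-1\<^esub>\<close>.\<close>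

lemma umodule_V:
  assumes "r \<le> n" shows "umodule n (V n r)"
proof (rule function_umoduleI[where \<kappa> = "\<lambda>i. xi n powi (int r - 2 * int i)"])
  fix x assume x: "x \<in> carrier (V n r)"
  show "act_k (V n r) x = (\<lambda>i. xi n powi (int r - 2 * int i) * x i)" by (rule act_k_V[OF x])
  show "(act_e (V n r) ^^ n) x = 0"
  proof
    fix i
    show "(act_e (V n r) ^^ n) x i = 0 i"
    \<comment> \<open>Coordinate i + n lies in range only for r = n and i = 0, and then the factor s
      = 0 of the product is [n] = 0. The same happens for f at i = n.\<close>
    proof (cases "i + n \<le> r")
      case True
      then have "int r - int i = int n" using assms by simp
      then have "qint n (int r - int i - int 0) = 0" using qint_n[OF n] by simp
      then have "(\<Prod>s<n. qint n (int r - int i - int s)) = 0"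
        using n by (intro prod_zero bexI[of _ 0]) auto
      then show ?thesis unfolding act_e_V_funpow[OF x] by simp
    next
      case False
      then show ?thesis unfolding act_e_V_funpow[OF x] using x by (simp add: V_carrier)
    qed
  qed
  show "(act_f (V n r) ^^ n) x = 0"
  proof
    fix i
    show "(act_f (V n r) ^^ n) x i = 0 i"
    proof (cases "n \<le> i \<and> i \<le> r")
      case True
      then have "i = n" using assms by simp
      then have "qint n (int i - int 0) = 0" using qint_n[OF n] by simp
      then have "(\<Prod>s<n. qint n (int i - int s)) = 0"
        using n by (intro prod_zero bexI[of _ 0]) auto
      then show ?thesis unfolding act_f_V_funpow[OF x] by simp
    next
      case False
      then show ?thesis unfolding act_f_V_funpow[OF x] by auto
    qed
  qed
  have k: "xi n powi (int r - 2 * int i) = xi n powi 2 * xi n powi (int r - 2 * int (Suc i))"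
    "xi n powi (int r - 2 * int (Suc i)) = xi n powi (- 2) * xi n powi (int r - 2 * int i)" for i
    using power_int_add[of "xi n" 2 "int r - 2 * int (Suc i)"]
      power_int_add[of "xi n" "- 2" "int r - 2 * int i"] by (simp_all add: algebra_simps)
  note outer = act_e_V[OF acts_V_closed(2)[OF x]] act_e_V[OF acts_V_closed(3)[OF x]]
    act_f_V[OF acts_V_closed(1)[OF x]] act_f_V[OF acts_V_closed(3)[OF x]]
    act_k_V[OF acts_V_closed(1)[OF x]] act_k_V[OF acts_V_closed(2)[OF x]]
  note inner = act_e_V[OF x] act_f_V[OF x] act_k_V[OF x]
  show "act_k (V n r) (act_e (V n r) x) = fscale (xi n powi 2) (act_e (V n r) (act_k (V n r) x))"
    unfolding outer unfolding inner fscale_def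
      proof
    fix i
    show "xi n powi (int r - 2 * int i) * (qint n (int r - int i) * x (Suc i)) =
        xi n powi 2 * (qint n (int r - int i) * (xi n powi (int r - 2 * int (Suc i)) * x (Suc i)))"
      unfolding k(1)[of i] by (simp only: mult_ac)
  qed
  show "act_k (V n r) (act_f (V n r) x) = fscale (xi n powi - 2) (act_f (V n r) (act_k (V n r) x))"
    unfolding outer unfolding inner fscale_def
  proof
    fix i
    show "xi n powi (int r - 2 * int i) * (if 0 < i \<and> i \<le> r then qint n (int i) * x (i - 1) else 0) =
        xi n powi - 2 * (if 0 < i \<and> i \<le> r then qint n (int i) * (xi n powi (int r - 2 * int (i - 1)) * x (i - 1)) else 0)"
      using k(2)[of "i - 1"] by (cases "0 < i") auto
  qed
  fix i
  have "act_e (V n r) (act_f (V n r) x) i - act_f (V n r) (act_e (V n r) x) i =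
     (qint n (int r - int i) * qint n (int i + 1) - qint n (int i) * qint n (int r - int i + 1)) * x i"
  proof -
    have "act_e (V n r) (act_f (V n r) x) i = qint n (int r - int i) * qint n (int i + 1) * x i"
    proof -
      consider "i < r" | "i = r" | "r < i" by linarith
      then show ?thesis
        unfolding outer unfolding inner using x n by cases (simp_all add: V_carrier add.commute)
    qed
    moreover have "act_f (V n r) (act_e (V n r) x) i = qint n (int i) * qint n (int r - int i + 1) * x i"
    proof -
      have 1: "int r - int (i - 1) = int r - int i + 1" if "0 < i" using that by simp
      consider "i = 0" | "0 < i" "i \<le> r" | "r < i" by linarith
      then show ?thesis
      proof cases
        case 2
        then show ?thesis unfolding outer unfolding inner 1[OF 2(1)] by simp
      qed (unfold outer, unfold inner, use x n in \<open>simp_all add: V_carrier\<close>)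
    qed
    ultimately show ?thesis by (simp only: left_diff_distrib)
  qed
  then show "act_e (V n r) (act_f (V n r) x) i - act_f (V n r) (act_e (V n r) x) i =
    (xi n powi (int r - 2 * int i) - inverse (xi n powi (int r - 2 * int i))) / xi_diff n * x i"
    unfolding qint_commutator[OF n] unfolding qint_eq .
qed (use n xi_power_n in \<open>auto simp: V_closed acts_V_closed linear_endo_V\<close>)

lemma V_eq_sum_basis:
  assumes "v \<in> carrier (V n r)" shows "v = (\<Sum>j\<le>r. fscale (v j) (vbasis r (int j)))"
proof
  fix i
  have "(\<Sum>j\<le>r. fscale (v j) (vbasis r (int j))) i = (\<Sum>j\<le>r. if j = i then v i else 0)"
    unfolding sum_fun_apply by (intro sum.cong refl) (auto simp: fscale_def vbasis_def)
  then show "v i = (\<Sum>j\<le>r. fscale (v j) (vbasis r (int j))) i"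
    using assms by (auto simp: V_carrier)
qed

text \<open>If m is the last index in the support of a nonzero w, the m-th power of e maps w to a
  multiple of \<open>v_0\<close>, and powers of f lead from \<open>v_0\<close> to all
  \<open>v_j\<close>. The coefficients are products of [i] with 0 < i <= r < n, hence
  nonzero.\<close>

lemma uirreducible_V:
  assumes "r < n" shows "uirreducible n (V n r)"
proof -
  interpret umod n "V n r" using umodule_V[of r] assms by (simp add: umod_def)
  have "W = carrier (V n r)" if W: "usubmodule (V n r) W" and W0: "W \<noteq> {\<zero>\<^bsub>V n r\<^esub>}" for W
  proof -
    note W' = W[unfolded usubmodule_iff]
    have fp: "(act_e (V n r) ^^ m) x \<in> W" "(act_f (V n r) ^^ m) x \<in> W" if "x \<in> W" for m x
      by (induction m) (use W' that in auto)
    obtain w where w: "w \<in> W" "w \<noteq> 0" using W0 W' by auto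
    then have wV: "w \<in> carrier (V n r)" using W' by auto
    obtain j0 where "w j0 \<noteq> 0" using w by (auto simp: fun_eq_iff)
    define m where "m = (GREATEST j. w j \<noteq> 0)"
    have bd: "\<And>j. w j \<noteq> 0 \<Longrightarrow> j \<le> r" using wV by (auto simp: V_carrier not_less[symmetric])
    have m: "w m \<noteq> 0" unfolding m_def using \<open>w j0 \<noteq> 0\<close> bd by (rule GreatestI_nat)
    have gt: "w j = 0" if "m < j" for j
      using that Greatest_le_nat[of "\<lambda>j. w j \<noteq> 0" j r] bd unfolding m_def by fastforce
    have mr: "m \<le> r" using bd m .
    define c where "c = (\<Prod>s<m. qint n (int r - int s)) * w m"
    have c: "c \<noteq> 0"
      unfolding c_def using m mr assms by (auto simp: qint_eq_0_iff[OF n] dest: zdvd_imp_le)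
    have "(act_e (V n r) ^^ m) w = fscale c (vbasis r 0)"
    proof
      fix i
      show "(act_e (V n r) ^^ m) w i = fscale c (vbasis r 0) i"
        unfolding act_e_V_funpow(1)[OF wV] by (cases "i = 0") (auto simp: c_def fscale_def vbasis_def gt)
    qed
    then have "fscale c (vbasis r 0) \<in> W" using fp w by metis
    then have "inverse c \<odot>\<^bsub>V n r\<^esub> fscale c (vbasis r 0) \<in> W" using W' by blast
    moreover have "inverse c \<odot>\<^bsub>V n r\<^esub> fscale c (vbasis r 0) = vbasis r 0"
      using c by (auto simp: fscale_def fun_eq_iff)
    ultimately have v0: "vbasis r 0 \<in> W" by simp
    have vj: "vbasis r (int j) \<in> W" if "j \<le> r" for j
    proof -
      define d where "d = (\<Prod>s<j. qint n (int j - int s))"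
      have d: "d \<noteq> 0"
        unfolding d_def using that assms by (auto simp: qint_eq_0_iff[OF n] dest: zdvd_imp_le)
      have v0c: "vbasis r 0 \<in> carrier (V n r)" using v0 W' by auto
      have "(act_f (V n r) ^^ j) (vbasis r 0) = fscale d (vbasis r (int j))"
      proof
        fix i
        show "(act_f (V n r) ^^ j) (vbasis r 0) i = fscale d (vbasis r (int j)) i"
          unfolding act_f_V_funpow(1)[OF v0c] using that by (cases "i = j") (auto simp: d_def fscale_def vbasis_def)
      qed
      then have "fscale d (vbasis r (int j)) \<in> W" using fp v0 by metis
      then have "inverse d \<odot>\<^bsub>V n r\<^esub> fscale d (vbasis r (int j)) \<in> W" using W' by blast
      moreover have "inverse d \<odot>\<^bsub>V n r\<^esub> fscale d (vbasis r (int j)) = vbasis r (int j)"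
        using d by (auto simp: fscale_def fun_eq_iff)
      ultimately show ?thesis by simp
    qed
    have sumW: "(\<Sum>j\<in>J. fscale (v j) (vbasis r (int j))) \<in> W" if "finite J" "J \<subseteq> {..r}" for J v
      using that
    proof (induction rule: finite_induct)
      case empty
      have "0 \<in> W" using W' by simp
      then show ?case by (simp only: sum.empty)
    next
      case (insert j J)
      then have "(v j) \<odot>\<^bsub>V n r\<^esub> vbasis r (int j) \<in> W" "(\<Sum>j\<in>J. fscale (v j) (vbasis r (int j))) \<in> W"
        using vj W' by auto
      then have "((v j) \<odot>\<^bsub>V n r\<^esub> vbasis r (int j)) \<oplus>\<^bsub>V n r\<^esub> (\<Sum>j\<in>J. fscale (v j) (vbasis r (int j))) \<in> W"
        using W' by blast
      moreover have "(\<Sum>i\<in>insert j J. fscale (v i) (vbasis r (int i)))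
          = fscale (v j) (vbasis r (int j)) + (\<Sum>i\<in>J. fscale (v i) (vbasis r (int i)))"
        by (rule sum.insert[OF insert(1,2)])
      ultimately show ?case by (simp only: V_ops)
    qed
    have "v \<in> W" if "v \<in> carrier (V n r)" for v
      using sumW[of "{..r}" v] V_eq_sum_basis[OF that] by simp
    then show ?thesis using W' by auto
  qed
  moreover have "carrier (V n r) \<noteq> {\<zero>\<^bsub>V n r\<^esub>}"
  proof
    assume "carrier (V n r) = {\<zero>\<^bsub>V n r\<^esub>}"
    moreover have "vbasis r 0 \<in> carrier (V n r)" by (simp add: V_carrier vbasis_def)
    ultimately have "vbasis r 0 0 = 0" by simp
    then show False by (simp add: vbasis_def)
  qed
  ultimately show ?thesis using umodule by (auto simp: uirreducible_def)
qed

lemma udim_V: "udim (V n r) = r + 1"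
proof -
  interpret vector_space fscale
    by unfold_locales (auto simp: fscale_def fun_eq_iff algebra_simps)
  let ?b = "\<lambda>j. vbasis r (int j)"
  have inj: "inj_on ?b {..r}"
    by (rule inj_onI) (auto simp: vbasis_def fun_eq_iff dest: spec split: if_splits)
  have "independent (?b ` {..r})"
  proof (rule independent_if_scalars_zero)
    fix g x assume s: "(\<Sum>x\<in>?b ` {..r}. fscale (g x) x) = 0" and "x \<in> ?b ` {..r}"
    then obtain i where i: "i \<le> r" "x = ?b i" by auto
    have "(\<Sum>j\<le>r. fscale (g (?b j)) (?b j)) = 0" using s inj by (simp add: sum.reindex)
    then have "(\<Sum>j\<le>r. fscale (g (?b j)) (?b j)) i = 0" by simp
    moreover have "(\<Sum>j\<le>r. fscale (g (?b j)) (?b j)) i = (\<Sum>j\<le>r. if j = i then g (?b i) else 0)"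
      unfolding sum_fun_apply using i by (intro sum.cong) (auto simp: fscale_def vbasis_def)
    ultimately show "g x = 0" using i by simp
  qed simp
  moreover have "?b ` {..r} \<subseteq> carrier (V n r)" by (auto simp: V_carrier vbasis_def)
  moreover have "carrier (V n r) \<subseteq> span (?b ` {..r})"
  proof
    fix v assume "v \<in> carrier (V n r)"
    then have "v = (\<Sum>j\<le>r. fscale (v j) (?b j))" by (rule V_eq_sum_basis)
    also have "\<dots> \<in> span (?b ` {..r})" by (intro span_sum span_scale span_base) auto
    finally show "v \<in> span (?b ` {..r})" .
  qed
  moreover have "card (?b ` {..r}) = r + 1" using inj by (simp add: card_image)
  ultimately show ?thesis unfolding udim_def by (intro dim_unique)
qed

text \<open>The b-th power of f is zero on \<open>V_a\<close> but sends \<open>v_0\<close> to a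
  nonzero multiple of \<open>v_b\<close> in \<open>V_b\<close>.\<close>

lemma not_uiso_V_less:
  assumes "a < b" "b < n" shows "\<not> uiso (V n a) (V n b)"
proof
  assume "uiso (V n a) (V n b)"
  then obtain h where h: "uhom (V n a) (V n b) h" "bij_betw h (carrier (V n a)) (carrier (V n b))"
    by (auto simp: uiso_iff)
  interpret umod n "V n a" using umodule_V[of a] assms by (simp add: umod_def)
  have b0: "vbasis b 0 \<in> carrier (V n b)" by (simp add: V_carrier vbasis_def)
  then obtain v where v: "v \<in> carrier (V n a)" "vbasis b 0 = h v" using h(2) by (auto simp: bij_betw_def)
  have "(act_f (V n a) ^^ b) v = 0"
    unfolding act_f_V_funpow(1)[OF v(1)] using assms by (auto simp: fun_eq_iff)
  then have "(act_f (V n b) ^^ b) (vbasis b 0) = 0"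
    using uhom_funpow(2)[OF h(1) v(1), of b] v(2) uhom_zero[OF h(1) umodule_V[of b]] assms by simp
  then have "(act_f (V n b) ^^ b) (vbasis b 0) b = 0" by simp
  then have "(\<Prod>s<b. qint n (int b - int s)) = 0"
    unfolding act_f_V_funpow(1)[OF b0] by (simp add: vbasis_def)
  then show False using assms by (auto simp: qint_eq_0_iff[OF n] dest: zdvd_imp_le) 
qed

lemma uiso_V_iff:
  assumes "a < n" "b < n" shows "uiso (V n a) (V n b) \<longleftrightarrow> a = b"
proof
  assume iso: "uiso (V n a) (V n b)"
  have "umod n (V n a)" using umodule_V[of a] assms by (simp add: umod_def)
  then have "uiso (V n b) (V n a)" using iso by (rule umod.uiso_sym)
  then show "a = b" using iso not_uiso_V_less assms by (metis linorder_neqE_nat)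
next
  have "uhom (V n a) (V n a) id" by (auto simp: uhom_def acts_V_closed)
  then show "a = b \<Longrightarrow> uiso (V n a) (V n b)" by (auto simp: uiso_iff intro!: exI[of _ id])
qed

end

section \<open>The tensor product with $V_1$\<close>

definition V1_tensor :: "nat \<Rightarrow> nat \<Rightarrow> (nat \<times> nat \<Rightarrow> complex) umod" where
  "V1_tensor n a = utensor n (V n 1) (V n a)"

lemma V1_tensor_carrier: "t \<in> carrier (V1_tensor n a) \<longleftrightarrow> (\<forall>i j. 1 < i \<or> a < j \<longrightarrow> t (i, j) = 0)"
  by (auto simp: V1_tensor_def utensor_def V_carrier)

lemma V1_tensor_ops [simp]:
  "zero (V1_tensor n a) = 0" "add (V1_tensor n a) = (+)" "smult (V1_tensor n a) = fscale"
  by (simp_all add: V1_tensor_def utensor_def)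

lemma V1_tensor_row:
  assumes "t \<in> carrier (V1_tensor n a)"
  shows "(\<lambda>j. t (i, j)) \<in> carrier (V n a)" and "(\<lambda>i. t (i, j)) \<in> carrier (V n 1)"
    and "(\<lambda>i. c * t (i, j)) \<in> carrier (V n 1)"
  using assms by (auto simp: V1_tensor_carrier V_carrier)

text \<open>The coefficient \<open>qint n 1\<close> is left in place because its value 1 requires a
  nonzero denominator, which is established for odd n >= 3; \<open>acts_V1_tensor\<close> removes it
  there.\<close>

lemma act_e_V1_tensor:
  assumes t: "t \<in> carrier (V1_tensor n a)"
  shows "act_e (V1_tensor n a) t = (\<lambda>(i, j). if i = 0
      then qint n 1 * (xi n powi (int a - 2 * int j) * t (1, j)) + qint n (int a - int j) * t (0, Suc j)
      else qint n (int a - int j) * t (i, Suc j))"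
proof (rule ext, clarify)
  fix i j
  have "act_e (V1_tensor n a) t (i, j) = qint n (1 - int i) * (xi n powi (int a - 2 * int j) * t (Suc i, j))
     + qint n (int a - int j) * t (i, Suc j)"
    by (simp add: V1_tensor_def utensor_def op_tensor_def act_k_V[OF V1_tensor_row(1)[OF t]] act_e_V[OF V1_tensor_row(1)[OF t]]
        act_e_V[OF V1_tensor_row(3)[OF t]] del: One_nat_def)
  then show "act_e (V1_tensor n a) t (i, j) = (if i = 0
      then qint n 1 * (xi n powi (int a - 2 * int j) * t (1, j)) + qint n (int a - int j) * t (0, Suc j)
      else qint n (int a - int j) * t (i, Suc j))"
    using t by (simp add: V1_tensor_carrier)
qed

lemma act_k_V1_tensor:
  assumes t: "t \<in> carrier (V1_tensor n a)"
  shows "act_k (V1_tensor n a) t =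
    (\<lambda>i. (xi n powi (1 - 2 * int (fst i)) * xi n powi (int a - 2 * int (snd i))) * t i)"
  by (auto simp: V1_tensor_def utensor_def op_tensor_def act_k_V[OF V1_tensor_row(1)[OF t]] act_k_V[OF V1_tensor_row(3)[OF t]] fun_eq_iff
      simp del: One_nat_def)

lemma act_f_V1_tensor:
  assumes t: "t \<in> carrier (V1_tensor n a)" and n: "0 < n"
  shows "act_f (V1_tensor n a) t = (\<lambda>(i, j). if j \<le> a \<and> i = 0 then inverse (xi n) * (qint n (int j) * t (0, j - 1))
      else if j \<le> a \<and> i = 1 then qint n 1 * t (0, j) + xi n * (qint n (int j) * t (1, j - 1)) else 0)"
proof (rule ext, clarify)
  fix i j
  let ?u = "\<lambda>i'. act_f (V n a) (\<lambda>j'. t (i', j')) j"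
  have u: "act_f (V n a) (\<lambda>j'. t (i', j')) j = (if 0 < j \<and> j \<le> a then qint n (int j) * t (i', j - 1) else 0)" for i'
    by (simp add: act_f_V[OF V1_tensor_row(1)[OF t]])
  have q0: "qint n 0 = 0" by (simp add: qint_def)
  have uV: "?u \<in> carrier (V n 1)" unfolding u using t by (auto simp: V1_tensor_carrier V_carrier)
  have "act_kinv n (V n 1) ?u = (\<lambda>i. inverse (xi n powi (int 1 - 2 * int i)) * ?u i)"
    by (rule act_kinv_diagonal(1)[OF act_k_V acts_V_closed(3) uV]) (use n xi_power_n in auto)
  then have "act_f (V1_tensor n a) t (i, j) = act_f (V n 1) (\<lambda>i. t (i, j)) i + inverse (xi n powi (1 - 2 * int i)) * ?u i"
    by (simp add: V1_tensor_def utensor_def op_tensor_def del: One_nat_def)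
  also have "\<dots> = (if j \<le> a \<and> i = 0 then inverse (xi n) * (qint n (int j) * t (0, j - 1))
      else if j \<le> a \<and> i = 1 then qint n 1 * t (0, j) + xi n * (qint n (int j) * t (1, j - 1)) else 0)"
    unfolding u act_f_V[OF V1_tensor_row(2)[OF t]] using t
    by (cases "i = 0"; cases "i = 1"; cases "j = 0") (auto simp: V1_tensor_carrier q0 power_int_minus)
  finally show "act_f (V1_tensor n a) t (i, j) = \<dots>" .
qed

lemma V1_tensor_closed:
  "0 \<in> carrier (V1_tensor n a)" "x \<in> carrier (V1_tensor n a) \<Longrightarrow> y \<in> carrier (V1_tensor n a) \<Longrightarrow> x + y \<in> carrier (V1_tensor n a)"
  "x \<in> carrier (V1_tensor n a) \<Longrightarrow> fscale c x \<in> carrier (V1_tensor n a)"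
  by (auto simp: V1_tensor_carrier fscale_def)

lemma acts_V1_tensor_closed:
  assumes "t \<in> carrier (V1_tensor n a)"
  shows "act_e (V1_tensor n a) t \<in> carrier (V1_tensor n a)" "act_k (V1_tensor n a) t \<in> carrier (V1_tensor n a)"
    and "0 < n \<Longrightarrow> act_f (V1_tensor n a) t \<in> carrier (V1_tensor n a)"
  unfolding act_e_V1_tensor[OF assms] act_k_V1_tensor[OF assms]
  using assms act_f_V1_tensor[OF assms] by (auto simp: V1_tensor_carrier)

lemma linear_endo_V1_tensor:
  assumes "0 < n"
  shows "linear_endo (V1_tensor n a) (act_e (V1_tensor n a))" "linear_endo (V1_tensor n a) (act_f (V1_tensor n a))"
proof -
  show "linear_endo (V1_tensor n a) (act_e (V1_tensor n a))"
    unfolding linear_endo_def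
    by (intro conjI ballI allI acts_V1_tensor_closed; simp add: act_e_V1_tensor V1_tensor_closed fun_eq_iff)
       (simp_all add: fscale_def algebra_simps)
  show "linear_endo (V1_tensor n a) (act_f (V1_tensor n a))"
    unfolding linear_endo_def
    by (intro conjI ballI allI acts_V1_tensor_closed[OF _] assms; simp add: act_f_V1_tensor assms V1_tensor_closed fun_eq_iff)
       (simp_all add: fscale_def algebra_simps)
qed

text \<open>The vector \<open>u\<^sub>0 \<otimes> v\<^sub>0\<close> generates a copy of \<open>V\<^bsub>a+1\<^esub>\<close>, in which \<open>f\<^sup>j / [j]!\<close> applied to it is
  \<open>\<xi>\<^sup>-\<^sup>j u\<^sub>0 \<otimes> v\<^sub>j + u\<^sub>1 \<otimes> v\<^bsub>j-1\<^esub>\<close>.\<close>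

definition weyl_embed :: "nat \<Rightarrow> nat \<Rightarrow> (nat \<Rightarrow> complex) \<Rightarrow> nat \<times> nat \<Rightarrow> complex" where
  "weyl_embed n a v = (\<lambda>(i, j). if j \<le> a \<and> i = 0 then inverse (xi n powi int j) * v j
     else if j \<le> a \<and> i = 1 then v (Suc j) else 0)"

context
  fixes n :: nat
  assumes n: "odd n" "3 \<le> n"
begin

lemma n_pos: "0 < n" using n by simp

lemmas acts_V1_tensor =
  act_e_V1_tensor[where n = n, unfolded qint_1[OF n] mult_1_left]
  act_f_V1_tensor[OF _ n_pos, unfolded qint_1[OF n] mult_1_left]
  act_k_V1_tensor[where n = n]

text \<open>Comparing coefficients leaves \<open>e1\<close> and \<open>f1\<close>: the power of xi
  in each stems from e or f acting on \<open>V_1\<close>, the remaining term from its action on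
  \<open>V_a\<close>.\<close>

lemma weyl_embed_uhom: "uhom (V n (Suc a)) (V1_tensor n a) (weyl_embed n a)"
proof -
  have c: "weyl_embed n a v \<in> carrier (V1_tensor n a)" for v by (auto simp: weyl_embed_def V1_tensor_carrier)
  have e: "weyl_embed n a (act_e (V n (Suc a)) v) = act_e (V1_tensor n a) (weyl_embed n a v)"
    and f: "weyl_embed n a (act_f (V n (Suc a)) v) = act_f (V1_tensor n a) (weyl_embed n a v)"
    and k: "weyl_embed n a (act_k (V n (Suc a)) v) = act_k (V1_tensor n a) (weyl_embed n a v)"
    if v: "v \<in> carrier (V n (Suc a))" for v
  proof -
    have e1: "inverse (xi n powi int j) * qint n (int a - int j + 1) =
      xi n powi (int a - 2 * int j) + qint n (int a - int j) * inverse (xi n powi (int j + 1))" for j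
    proof -
      have "xi n powi (int a - 2 * int j) = inverse (xi n powi int j) * xi n powi (int a - int j)"
        using power_int_add[of "xi n" "- int j" "int a - int j"] by (simp add: power_int_minus algebra_simps)
      then show ?thesis unfolding qint_add_1'[OF n] by (simp add: power_int_add algebra_simps)
    qed
    show "weyl_embed n a (act_e (V n (Suc a)) v) = act_e (V1_tensor n a) (weyl_embed n a v)"
      unfolding acts_V1_tensor(1)[OF c] act_e_V[OF v]
    proof (rule ext, clarify)
      fix i j
      show "weyl_embed n a (\<lambda>i. qint n (int (Suc a) - int i) * v (Suc i)) (i, j) =
       (if i = 0 then xi n powi (int a - 2 * int j) * weyl_embed n a v (1, j) + qint n (int a - int j) * weyl_embed n a v (0, Suc j)
        else qint n (int a - int j) * weyl_embed n a v (i, Suc j))"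
      proof -
        have 1: "int (Suc a) - int j = int a - int j + 1" "int (Suc j) = int j + 1"
          "int (Suc a) - (int j + 1) = int a - int j" "int (Suc a) - int a = 1" by simp_all
        have 2: "inverse (xi n powi int j) * (qint n (int a - int j + 1) * x) =
          xi n powi (int a - 2 * int j) * x + qint n (int a - int j) * (inverse (xi n powi (int j + 1)) * x)" for x
          using arg_cong[OF e1[of j], of "\<lambda>y. y * x"] by (simp only: distrib_right mult.assoc)
        consider "j < a" | "j = a" | "a < j" by linarith
        then show ?thesis
          by cases (use v n 2 in \<open>simp_all add: weyl_embed_def V_carrier 1 power_int_minus del: of_nat_Suc\<close>)
      qed
    qed
    have f1: "qint n (int j + 1) = inverse (xi n powi int j) + xi n * qint n (int j)" for j
      by (rule qint_add_1[OF n])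
    show "weyl_embed n a (act_f (V n (Suc a)) v) = act_f (V1_tensor n a) (weyl_embed n a v)"
      unfolding acts_V1_tensor(2)[OF c] act_f_V[OF v]
    proof (rule ext, clarify)
      fix i j
      show "weyl_embed n a (\<lambda>i. if 0 < i \<and> i \<le> Suc a then qint n (int i) * v (i - 1) else 0) (i, j) =
         (if j \<le> a \<and> i = 0 then inverse (xi n) * (qint n (int j) * weyl_embed n a v (0, j - 1))
          else if j \<le> a \<and> i = 1 then weyl_embed n a v (0, j) + xi n * (qint n (int j) * weyl_embed n a v (1, j - 1)) else 0)"
      proof (cases j)
        case 0
        then show ?thesis using n f1[of 0] by (simp add: weyl_embed_def)
      next
        case (Suc l)
        have 1: "int (Suc j) = int j + 1" by simp
        have 2: "int (Suc l) = int l + 1" by simp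
        have 3: "inverse (xi n powi (int l + 1)) = inverse (xi n) * inverse (xi n powi int l)"
          by (simp add: power_int_add)
        have 4: "qint n (int (Suc j)) * x = inverse (xi n powi int j) * x + xi n * (qint n (int j) * x)" for x
          unfolding 1 f1 by (simp only: distrib_right mult.assoc)
        show ?thesis
          using Suc 3 4[of "v j"] by (simp add: weyl_embed_def 2 del: of_nat_Suc) 
      qed
    qed
    have k1: "xi n powi (int (Suc a) - 2 * int j) = xi n powi 1 * xi n powi (int a - 2 * int j)"
      "xi n powi (int (Suc a) - 2 * int (Suc j)) = xi n powi (- 1) * xi n powi (int a - 2 * int j)" for j
      unfolding power_int_add[OF disjI1, OF xi_nonzero, symmetric] by (simp_all add: algebra_simps)
    show "weyl_embed n a (act_k (V n (Suc a)) v) = act_k (V1_tensor n a) (weyl_embed n a v)"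
      unfolding acts_V1_tensor(3)[OF c] act_k_V[OF v]
    proof (rule ext, clarify)
      fix i j
      show "weyl_embed n a (\<lambda>i. xi n powi (int (Suc a) - 2 * int i) * v i) (i, j) =
          xi n powi (1 - 2 * int (fst (i, j))) * xi n powi (int a - 2 * int (snd (i, j))) * weyl_embed n a v (i, j)"
        using k1(1)[of j] k1(2)[of j] by (auto simp: weyl_embed_def)
    qed
  qed
  show ?thesis
    unfolding uhom_def using c e f k by (auto simp: weyl_embed_def fscale_def fun_eq_iff algebra_simps)
qed

lemma linear_endo_funpow_add:
  assumes "linear_endo M g" "x \<in> carrier M" "y \<in> carrier M"
  shows "(g ^^ m) (x \<oplus>\<^bsub>M\<^esub> y) = (g ^^ m) x \<oplus>\<^bsub>M\<^esub> (g ^^ m) y"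
  using assms linear_endo_funpow_closed[OF assms(1)] by (induction m) (auto simp: linear_endo_def)

text \<open>A q-binomial expansion of the coproduct is avoided by subtracting a suitable embedded
  vector of \<open>V_(a+1)\<close>. On the embedded part nilpotency is inherited, since a + 1 <= n.
  The remainder lies over one vector of \<open>V_1\<close> that e (respectively f) kills, so the
  operator acts on the second factor only, up to a scalar, and shifts its index until nothing is
  left.\<close>

lemma V1_tensor_nilpotent:
  assumes a: "a < n" and t: "t \<in> carrier (V1_tensor n a)"
  shows "(act_e (V1_tensor n a) ^^ n) t = 0" and "(act_f (V1_tensor n a) ^^ n) t = 0"
proof -
  interpret umod n "V n (Suc a)" using umodule_V[OF n, of "Suc a"] a by (simp add: umod_def)
  have decomp: "(g ^^ n) t = 0"
    if g: "linear_endo (V1_tensor n a) g" and v: "v \<in> carrier (V n (Suc a))"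
      and w: "(g ^^ n) (weyl_embed n a v) = 0" and r: "(g ^^ n) (t + fscale (- 1) (weyl_embed n a v)) = 0" for g v
  proof -
    have c: "weyl_embed n a v \<in> carrier (V1_tensor n a)" by (auto simp: weyl_embed_def V1_tensor_carrier)
    have "(g ^^ n) ((t + fscale (- 1) (weyl_embed n a v)) \<oplus>\<^bsub>V1_tensor n a\<^esub> weyl_embed n a v)
      = (g ^^ n) (t + fscale (- 1) (weyl_embed n a v)) \<oplus>\<^bsub>V1_tensor n a\<^esub> (g ^^ n) (weyl_embed n a v)"
      using g t c V1_tensor_closed by (intro linear_endo_funpow_add) auto
    also have "(t + fscale (- 1) (weyl_embed n a v)) \<oplus>\<^bsub>V1_tensor n a\<^esub> weyl_embed n a v = t"
      by (auto simp: fscale_def fun_eq_iff)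
    finally show ?thesis unfolding w r by (simp only: V1_tensor_ops add_0_left)
  qed
  have w: "(act_e (V1_tensor n a) ^^ n) (weyl_embed n a v) = 0" "(act_f (V1_tensor n a) ^^ n) (weyl_embed n a v) = 0"
    if v: "v \<in> carrier (V n (Suc a))" for v
  proof -
    have 0: "(act_e (V n (Suc a)) ^^ n) v = 0" "(act_f (V n (Suc a)) ^^ n) v = 0"
      using umodule v unfolding umodule_def V_ops by blast+
    have "weyl_embed n a 0 = 0" by (rule ext) (auto simp: weyl_embed_def)
    then show "(act_e (V1_tensor n a) ^^ n) (weyl_embed n a v) = 0" "(act_f (V1_tensor n a) ^^ n) (weyl_embed n a v) = 0"
      using uhom_funpow(1,2)[OF weyl_embed_uhom v, of n] unfolding 0 by metis+
  qed
  have ne: "(act_e (V1_tensor n a) ^^ m) u \<in> carrier (V1_tensor n a) \<and>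
      (\<forall>j. (act_e (V1_tensor n a) ^^ m) u (1, j) = 0) \<and> (\<forall>j. a < j + m \<longrightarrow> (act_e (V1_tensor n a) ^^ m) u (0, j) = 0)"
    if u: "u \<in> carrier (V1_tensor n a)" "\<And>j. u (1, j) = 0" for u m
  proof (induction m)
    case (Suc m)
    then have c: "(act_e (V1_tensor n a) ^^ m) u \<in> carrier (V1_tensor n a)" by blast
    show ?case
      using Suc acts_V1_tensor_closed(1)[OF c] by (simp add: acts_V1_tensor(1)[OF c])
  qed (use u in \<open>auto simp: V1_tensor_carrier\<close>)
  have nf: "(act_f (V1_tensor n a) ^^ m) u \<in> carrier (V1_tensor n a) \<and>
      (\<forall>j. (act_f (V1_tensor n a) ^^ m) u (0, j) = 0) \<and> (\<forall>j<m. (act_f (V1_tensor n a) ^^ m) u (1, j) = 0)"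
    if u: "u \<in> carrier (V1_tensor n a)" "\<And>j. u (0, j) = 0" for u m
  proof (induction m)
    case (Suc m)
    then have c: "(act_f (V1_tensor n a) ^^ m) u \<in> carrier (V1_tensor n a)" by blast
    have "qint n (int j) * (act_f (V1_tensor n a) ^^ m) u (1, j - 1) = 0" if "j < Suc m" for j
      using Suc that n by (cases "j = 0") auto
    then show ?case
      using Suc acts_V1_tensor_closed(3)[OF c n_pos] by (simp add: acts_V1_tensor(2)[OF c])
  qed (use u in \<open>auto simp: V1_tensor_carrier\<close>)
  have zero: "y = 0" if "y \<in> carrier (V1_tensor n a)" "\<And>j. j \<le> a \<Longrightarrow> y (0, j) = 0" "\<And>j. j \<le> a \<Longrightarrow> y (1, j) = 0" for y
  proof (rule ext, clarify)
    fix i j show "y (i, j) = 0 (i, j)"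
      using that by (cases "1 < i \<or> a < j"; cases "i = 0") (auto simp: V1_tensor_carrier not_less le_Suc_eq)
  qed
  have ne0: "(act_e (V1_tensor n a) ^^ n) u = 0" if "u \<in> carrier (V1_tensor n a)" "\<And>j. u (1, j) = 0" for u
    using ne[OF that, of n] a by (intro zero) auto
  have nf0: "(act_f (V1_tensor n a) ^^ n) u = 0" if "u \<in> carrier (V1_tensor n a)" "\<And>j. u (0, j) = 0" for u
    using nf[OF that, of n] a by (intro zero) auto
  have wc: "t + fscale (- 1) (weyl_embed n a v) \<in> carrier (V1_tensor n a)" for v
    using t by (intro V1_tensor_closed) (auto simp: weyl_embed_def V1_tensor_carrier)
  show "(act_e (V1_tensor n a) ^^ n) t = 0"
  proof (rule decomp[OF linear_endo_V1_tensor(1)[OF n_pos]])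
    \<comment> \<open>Chosen to agree with t over \<open>u_1\<close>; the difference lies over
      \<open>u_0\<close>, which e kills.\<close>
    let ?v = "\<lambda>j. case j of 0 \<Rightarrow> 0 | Suc l \<Rightarrow> t (1, l)"
    show v: "?v \<in> carrier (V n (Suc a))" using t by (auto simp: V_carrier V1_tensor_carrier split: nat.split)
    show "(act_e (V1_tensor n a) ^^ n) (weyl_embed n a ?v) = 0" by (rule w(1)[OF v])
    have "(t + fscale (- 1) (weyl_embed n a ?v)) (1, j) = 0" for j
      using t by (auto simp: weyl_embed_def fscale_def V1_tensor_carrier)
    then show "(act_e (V1_tensor n a) ^^ n) (t + fscale (- 1) (weyl_embed n a ?v)) = 0"
      by (rule ne0[OF wc])
  qed
  show "(act_f (V1_tensor n a) ^^ n) t = 0"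
  proof (rule decomp[OF linear_endo_V1_tensor(2)[OF n_pos]])
    \<comment> \<open>Chosen to agree with t over \<open>u_0\<close>; the difference lies over
      \<open>u_1\<close>, which f kills.\<close>
    let ?v = "\<lambda>j. if j \<le> a then xi n powi int j * t (0, j) else 0"
    show v: "?v \<in> carrier (V n (Suc a))" by (auto simp: V_carrier)
    show "(act_f (V1_tensor n a) ^^ n) (weyl_embed n a ?v) = 0" by (rule w(2)[OF v])
    have "(t + fscale (- 1) (weyl_embed n a ?v)) (0, j) = 0" for j
      using t by (auto simp: weyl_embed_def fscale_def V1_tensor_carrier)
    then show "(act_f (V1_tensor n a) ^^ n) (t + fscale (- 1) (weyl_embed n a ?v)) = 0"
      by (rule nf0[OF wc])
  qed
qed

end

lemma (in umod) uhom_inverse: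
  assumes h: "uhom M N h" and l: "\<And>x. x \<in> carrier M \<Longrightarrow> g (h x) = x"
    and r: "\<And>y. y \<in> carrier N \<Longrightarrow> h (g y) = y" and c: "\<And>y. y \<in> carrier N \<Longrightarrow> g y \<in> carrier M"
  shows "uhom N M g"
proof -
  have all: "(\<forall>y\<in>carrier N. P y) \<longleftrightarrow> (\<forall>x\<in>carrier M. P (h x))" for P
    using r c uhomD(1)[OF h] by metis
  show ?thesis
    unfolding uhom_def all
    by (intro conjI ballI allI) (simp_all add: l uhomD(2-6)[OF h, symmetric])
qed

text \<open>One link of a filtration of \<open>N\<close>, pulled back along c: the preimage of B
  maps onto L with kernel the preimage of the kernel of g. Repeated use lets the factors of
  \<open>V_n\<close> be counted inside the tensor product.\<close>

lemma comp_count_pullback: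
  assumes M: "umodule n M" and N: "umodule n N" and c: "uhom M N c" "c ` carrier M = carrier N"
    and B: "usubmodule N B" and L: "uirreducible n L"
    and g: "uhom (N\<lparr>carrier := B\<rparr>) L g" "g ` B = carrier L"
    and count: "comp_count n (M\<lparr>carrier := {x \<in> carrier M. c x \<in> {y \<in> B. g y = \<zero>\<^bsub>L\<^esub>}}\<rparr>) S m"
  shows "comp_count n (M\<lparr>carrier := {x \<in> carrier M. c x \<in> B}\<rparr>) S (m + (if uiso L S then 1 else 0))"
proof -
  interpret M: umod n M using M by (simp add: umod_def)
  interpret N: umod n N using N by (simp add: umod_def)
  let ?A = "{x \<in> carrier M. c x \<in> B}"
  have A: "usubmodule M ?A" by (rule M.usubmodule_vimage[OF c(1) N B])
  have "uhom (M\<lparr>carrier := ?A\<rparr>) (N\<lparr>carrier := B\<rparr>) c" using c(1) by (simp add: uhom_def)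
  then have h: "uhom (M\<lparr>carrier := ?A\<rparr>) L (g \<circ> c)" by (rule uhom_comp[OF _ g(1)])
  have "B \<subseteq> carrier N" using B by (simp add: N.usubmodule_iff)
  then have "c ` ?A = B" using c(2) by auto
  then have surj: "(g \<circ> c) ` carrier (M\<lparr>carrier := ?A\<rparr>) = carrier L"
    using g(2) by (simp only: image_comp[symmetric]) simp
  have "{x \<in> ?A. (g \<circ> c) x = \<zero>\<^bsub>L\<^esub>} = {x \<in> carrier M. c x \<in> {y \<in> B. g y = \<zero>\<^bsub>L\<^esub>}}" by auto
  then show ?thesis
    using comp_count_kernel[OF M.umodule_sub[OF A] L h surj, of S m] count by simp
qed

context
  fixes n :: nat
  assumes n: "odd n" "3 \<le> n"
begin

lemmas n_gt_0 = n_pos[OF n]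

text \<open>The vector at (i, j) has weight a + 1 - 2 i - 2 j. In both rows the terms involving the
  other row cancel; what remains is \<open>qint_commutator\<close> for \<open>V_a\<close>, corrected
  by one power of xi through \<open>up\<close> for i = 0 and \<open>down\<close> for i = 1.\<close>

lemma V1_tensor_commutator:
  assumes x: "x \<in> carrier (V1_tensor n a)"
  shows "act_e (V1_tensor n a) (act_f (V1_tensor n a) x) (i, j) - act_f (V1_tensor n a) (act_e (V1_tensor n a) x) (i, j)
    = qint n (int a + 1 - 2 * int i - 2 * int j) * x (i, j)"
proof (cases "i \<le> 1 \<and> j \<le> a")
  case False
  have "act_e (V1_tensor n a) (act_f (V1_tensor n a) x) \<in> carrier (V1_tensor n a)" "act_f (V1_tensor n a) (act_e (V1_tensor n a) x) \<in> carrier (V1_tensor n a)"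
    using x by (auto intro!: acts_V1_tensor_closed n_gt_0)
  then show ?thesis using False x by (auto simp: V1_tensor_carrier not_le)
next
  case True
  define A J w where "A = qint n (int a - int j)" and "J = qint n (int j)" and "w = xi n powi (int a - 2 * int j)"
  note outer = acts_V1_tensor(1)[OF n acts_V1_tensor_closed(3)[OF x n_gt_0]] acts_V1_tensor(2)[OF n acts_V1_tensor_closed(1)[OF x]]
  note inner = acts_V1_tensor(1)[OF n x] acts_V1_tensor(2)[OF n x]
  have Jp: "0 < j \<Longrightarrow> Suc (j - 1) = j" by simp
  \<comment> \<open>[j] vanishes at j = 0, where j - 1 is truncated, and [a - j] vanishes at j = a,
    where j + 1 leaves the range. Hence the generic formulas also hold at the ends.\<close>
  have J0: "j = 0 \<Longrightarrow> J = 0" using n by (simp add: J_def)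
  have A0: "\<not> Suc j \<le> a \<Longrightarrow> A = 0"
  proof -
    assume "\<not> Suc j \<le> a"
    then have "j = a" using True by simp
    then show "A = 0" using n by (simp add: A_def)
  qed
  have Sj: "qint n (int (Suc j)) = qint n (int j + 1)" by (simp add: add.commute)
  have pj: "0 < j \<Longrightarrow> qint n (int a - int (j - 1)) = qint n (int a - int j + 1)"
    by (simp add: of_nat_diff algebra_simps)
  have wj: "0 < j \<Longrightarrow> xi n powi (int a - 2 * int (j - 1)) = xi n powi 2 * w"
    unfolding w_def power_int_add[OF disjI1, OF xi_nonzero, symmetric] by (simp add: of_nat_diff algebra_simps)
  have comm: "A * qint n (int j + 1) - J * qint n (int a - int j + 1) = qint n (int a - 2 * int j)"
    unfolding A_def J_def by (rule qint_commutator[OF n])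
  have up: "qint n (int a - 2 * int j + 1) = w + inverse (xi n) * qint n (int a - 2 * int j)"
    unfolding w_def by (rule qint_add_1'[OF n])
  have down: "xi n * qint n (int a - 2 * int j) = w + qint n (int a - 2 * int j - 1)"
    using qint_add_1'[OF n, of "int a - 2 * int j - 1"] power_int_add[of "xi n" 1 "int a - 2 * int j - 1"]
    by (simp add: w_def distrib_left)
  consider "i = 0" | "i = 1" using True by linarith
  then show ?thesis
  proof cases
    case 1
    have ef: "act_e (V1_tensor n a) (act_f (V1_tensor n a) x) (0, j) =
        w * (x (0, j) + xi n * (J * x (1, j - 1))) + A * (inverse (xi n) * (qint n (int j + 1) * x (0, j)))"
      unfolding outer unfolding inner using True A0 by (auto simp: A_def J_def w_def Sj simp del: of_nat_Suc)
    have fe: "act_f (V1_tensor n a) (act_e (V1_tensor n a) x) (0, j) =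
        inverse (xi n) * (J * (xi n powi 2 * w * x (1, j - 1) + qint n (int a - int j + 1) * x (0, j)))"
    proof (cases "j = 0")
      case False
      then have 0: "0 < j" by simp
      show ?thesis
        unfolding outer unfolding inner unfolding split_conv wj[OF 0] pj[OF 0] Jp[OF 0]
        using True by (simp add: J_def)
    qed (unfold outer, unfold inner, use J0 n in simp)
    have "act_e (V1_tensor n a) (act_f (V1_tensor n a) x) (0, j) - act_f (V1_tensor n a) (act_e (V1_tensor n a) x) (0, j)
       = (w + inverse (xi n) * (A * qint n (int j + 1) - J * qint n (int a - int j + 1))) * x (0, j)"
      unfolding ef fe by (simp add: algebra_simps power2_eq_square)
    also have "\<dots> = qint n (int a - 2 * int j + 1) * x (0, j)" unfolding comm up ..
    finally show ?thesis using 1 by (simp add: algebra_simps)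
  next
    case 2
    have ef: "act_e (V1_tensor n a) (act_f (V1_tensor n a) x) (1, j) =
        A * (x (0, Suc j) + xi n * (qint n (int j + 1) * x (1, j)))"
      unfolding outer unfolding inner using True A0 by (auto simp: A_def J_def w_def Sj simp del: of_nat_Suc)
    have fe: "act_f (V1_tensor n a) (act_e (V1_tensor n a) x) (1, j) =
        w * x (1, j) + A * x (0, Suc j) + xi n * (J * (qint n (int a - int j + 1) * x (1, j)))"
    proof (cases "j = 0")
      case False
      then have 0: "0 < j" by simp
      show ?thesis
        unfolding outer unfolding inner unfolding split_conv wj[OF 0] pj[OF 0] Jp[OF 0]
        using True by (simp add: J_def A_def w_def)
    qed (unfold outer, unfold inner, use J0 n in \<open>simp add: A_def w_def\<close>)
    have "act_e (V1_tensor n a) (act_f (V1_tensor n a) x) (1, j) - act_f (V1_tensor n a) (act_e (V1_tensor n a) x) (1, j)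
       = (xi n * (A * qint n (int j + 1) - J * qint n (int a - int j + 1)) - w) * x (1, j)"
      unfolding ef fe by (simp add: algebra_simps)
    also have "\<dots> = qint n (int a - 2 * int j - 1) * x (1, j)" unfolding comm down by simp
    finally show ?thesis using 2 by (simp add: algebra_simps)
  qed
qed

lemma umodule_V1_tensor:
  assumes "a < n" shows "umodule n (V1_tensor n a)"
proof (rule function_umoduleI[where \<kappa> = "\<lambda>i. xi n powi (1 - 2 * int (fst i)) * xi n powi (int a - 2 * int (snd i))"])
  fix x assume x: "x \<in> carrier (V1_tensor n a)"
  show "act_k (V1_tensor n a) x = (\<lambda>i. xi n powi (1 - 2 * int (fst i)) * xi n powi (int a - 2 * int (snd i)) * x i)"
    by (rule act_k_V1_tensor[OF x])
  show "(act_e (V1_tensor n a) ^^ n) x = 0" "(act_f (V1_tensor n a) ^^ n) x = 0"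
    using V1_tensor_nilpotent[OF n assms x] by auto
  note outer = acts_V1_tensor[OF n acts_V1_tensor_closed(1)[OF x]] acts_V1_tensor[OF n acts_V1_tensor_closed(2)[OF x]]
    acts_V1_tensor[OF n acts_V1_tensor_closed(3)[OF x n_gt_0]]
  note inner = acts_V1_tensor[OF n x]
  have k: "xi n powi (int a - 2 * int j) = xi n powi 2 * xi n powi (int a - 2 * int (Suc j))" for j
    using power_int_add[of "xi n" 2 "int a - 2 * int (Suc j)"] by (simp add: algebra_simps)
  have k2: "xi n powi (int a - 2 * int (Suc j)) = xi n powi (- 2) * xi n powi (int a - 2 * int j)" for j
    using power_int_add[of "xi n" "- 2" "int a - 2 * int j"] by (simp add: algebra_simps)
  have m: "xi n powi (1 - 2 * int 1) = inverse (xi n)" "xi n powi (1 - 2 * int 0) = xi n"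
    by (simp_all add: power_int_minus)
  show "act_k (V1_tensor n a) (act_e (V1_tensor n a) x) = fscale (xi n powi 2) (act_e (V1_tensor n a) (act_k (V1_tensor n a) x))"
    unfolding outer unfolding inner fscale_def
  proof (rule ext, clarify, goal_cases)
    case (1 i j)
    show ?case using k[of j] m by (cases "i = 0") (simp_all add: algebra_simps power2_eq_square)
  qed
  show "act_k (V1_tensor n a) (act_f (V1_tensor n a) x) = fscale (xi n powi - 2) (act_f (V1_tensor n a) (act_k (V1_tensor n a) x))"
    unfolding outer unfolding inner fscale_def
  proof (rule ext, clarify, goal_cases)
    case (1 i j)
    show ?case
      using k2[of "j - 1"] m n by (cases "j = 0"; cases "i = 0")
        (auto simp: algebra_simps power2_eq_square power_int_minus)
  qed
  fix p :: "nat \<times> nat"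
  obtain i j where p: "p = (i, j)" by (cases p)
  have e: "xi n powi (1 - 2 * int i) * xi n powi (int a - 2 * int j) = xi n powi (int a + 1 - 2 * int i - 2 * int j)"
    unfolding power_int_add[OF disjI1, OF xi_nonzero, symmetric] by (simp add: algebra_simps)
  show "act_e (V1_tensor n a) (act_f (V1_tensor n a) x) p - act_f (V1_tensor n a) (act_e (V1_tensor n a) x) p =
      (xi n powi (1 - 2 * int (fst p)) * xi n powi (int a - 2 * int (snd p)) -
       inverse (xi n powi (1 - 2 * int (fst p)) * xi n powi (int a - 2 * int (snd p)))) / xi_diff n * x p"
    unfolding p fst_conv snd_conv e V1_tensor_commutator[OF x] qint_eq ..
qed (use n_gt_0 xi_power_n in \<open>auto simp: V1_tensor_closed acts_V1_tensor_closed linear_endo_V1_tensor power_mult_distrib\<close>)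

section \<open>The submodule \<open>V_(a+1)\<close> of the tensor product and the quotient
  \<open>V_(a-1)\<close>\<close>

definition weyl_range :: "nat \<Rightarrow> (nat \<times> nat \<Rightarrow> complex) set" where
  "weyl_range a =
  {t \<in> carrier (V1_tensor n a). \<forall>j<a. t (0, Suc j) = inverse (xi n powi int (Suc j)) * t (1, j)}"

text \<open>The defects in the equations that cut out the image of \<open>weyl_embed\<close>; they
  serve as coordinates on the quotient.\<close>

definition weyl_project :: "nat \<Rightarrow> (nat \<times> nat \<Rightarrow> complex) \<Rightarrow> nat \<Rightarrow> complex" where
  "weyl_project b t = (\<lambda>j. if j \<le> b then t (0, Suc j) - inverse (xi n powi int (Suc j)) * t (1, j) else 0)"

text \<open>Inverts \<open>weyl_embed\<close> on \<open>weyl_range\<close>: the entries not read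
  here are determined by the defining equations.\<close>

definition weyl_coords :: "(nat \<times> nat \<Rightarrow> complex) \<Rightarrow> nat \<Rightarrow> complex" where
  "weyl_coords t = (\<lambda>s. case s of 0 \<Rightarrow> t (0, 0) | Suc j \<Rightarrow> t (1, j))"

lemma weyl_project_uhom: "uhom (V1_tensor n (Suc b)) (V n b) (weyl_project b)"
proof -
  have c: "weyl_project b t \<in> carrier (V n b)" for t by (simp add: weyl_project_def V_carrier)
  have acts: "weyl_project b (act_e (V1_tensor n (Suc b)) t) = act_e (V n b) (weyl_project b t) \<and>
      weyl_project b (act_f (V1_tensor n (Suc b)) t) = act_f (V n b) (weyl_project b t) \<and>
      weyl_project b (act_k (V1_tensor n (Suc b)) t) = act_k (V n b) (weyl_project b t)"
    if t: "t \<in> carrier (V1_tensor n (Suc b))" for t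
  proof (intro conjI)
    show "weyl_project b (act_e (V1_tensor n (Suc b)) t) = act_e (V n b) (weyl_project b t)"
      unfolding act_e_V[OF c] acts_V1_tensor(1)[OF n t]
    proof
      fix j
      define X where "X = inverse (xi n powi int (Suc j))"
      have X2: "inverse (xi n powi int (Suc (Suc j))) = inverse (xi n) * X"
        unfolding X_def using power_int_add[of "xi n" 1 "int (Suc j)"] by (simp add: field_simps)
      have 1: "int (Suc b) - int (Suc j) = int b - int j" "int (Suc b) - int j = int b - int j + 1" by simp_all
      have 2: "X * qint n (int b - int j + 1)
          = xi n powi (int (Suc b) - 2 * int (Suc j)) + qint n (int b - int j) * (inverse (xi n) * X)"
      proof -
        have "xi n powi (int (Suc b) - 2 * int (Suc j)) = X * xi n powi (int b - int j)"
          unfolding X_def power_int_minus[symmetric] power_int_add[OF disjI1, OF xi_nonzero, symmetric]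
          by (simp add: algebra_simps)
        then show ?thesis unfolding qint_add_1'[OF n] by (simp add: algebra_simps)
      qed
      consider "j < b" | "j = b" | "b < j" by linarith
      then show "weyl_project b (\<lambda>(i, j). if i = 0 then xi n powi (int (Suc b) - 2 * int j) * t (1, j)
             + qint n (int (Suc b) - int j) * t (0, Suc j) else qint n (int (Suc b) - int j) * t (i, Suc j)) j
          = qint n (int b - int j) * weyl_project b t (Suc j)"
      proof cases
        case 3
        then show ?thesis by (simp add: weyl_project_def)
      next
        case 1
        have "X * (qint n (int b - int j + 1) * t (1, Suc j))
          = xi n powi (int (Suc b) - 2 * int (Suc j)) * t (1, Suc j) + qint n (int b - int j) * (inverse (xi n) * (X * t (1, Suc j)))"
          using arg_cong[OF 2, of "\<lambda>z. z * t (1, Suc j)"] by (simp only: distrib_right mult.assoc)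
        then show ?thesis
          using 1 unfolding weyl_project_def split_conv X2 X_def[symmetric] \<open>int (Suc b) - int (Suc j) = _\<close> \<open>int (Suc b) - int j = _\<close>
          by (simp add: algebra_simps del: of_nat_Suc)
      next
        case 2
        have "X * (qint n (int b - int j + 1) * t (1, Suc j))
          = xi n powi (int (Suc b) - 2 * int (Suc j)) * t (1, Suc j) + qint n (int b - int j) * (inverse (xi n) * (X * t (1, Suc j)))"
          using arg_cong[OF \<open>X * _ = _\<close>, of "\<lambda>z. z * t (1, Suc j)"] by (simp only: distrib_right mult.assoc)
        then show ?thesis
          using 2 n unfolding weyl_project_def split_conv X2 X_def[symmetric] \<open>int (Suc b) - int (Suc j) = _\<close> \<open>int (Suc b) - int j = _\<close>
          by (auto simp del: of_nat_Suc)
      qed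
    qed
    show "weyl_project b (act_f (V1_tensor n (Suc b)) t) = act_f (V n b) (weyl_project b t)"
      unfolding act_f_V[OF c] acts_V1_tensor(2)[OF n t]
    proof
      fix j
      have s: "inverse (xi n powi int (Suc j)) = inverse (xi n) * inverse (xi n powi int j)" for j
        by (simp add: power_int_add)
      have q: "inverse (xi n) * (qint n (int (Suc j)) * y) =
          inverse (xi n powi int (Suc j)) * y + qint n (int j) * y" for y
      proof -
        have "qint n (int (Suc j)) = inverse (xi n powi int j) + xi n * qint n (int j)"
          using qint_add_1[OF n, of "int j"] by (simp add: add.commute)
        then show ?thesis unfolding s by (simp add: algebra_simps del: of_nat_Suc)
      qed
      have x: "inverse (xi n powi int (Suc j)) * (xi n * y) = inverse (xi n powi int j) * y" for y
        unfolding s by simp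
      show "weyl_project b (\<lambda>(i, j). if j \<le> Suc b \<and> i = 0 then inverse (xi n) * (qint n (int j) * t (0, j - 1))
         else if j \<le> Suc b \<and> i = 1 then t (0, j) + xi n * (qint n (int j) * t (1, j - 1)) else 0) j
        = (if 0 < j \<and> j \<le> b then qint n (int j) * weyl_project b t (j - 1) else 0)"
      proof (cases j)
        case 0
        then show ?thesis using n q[of "t (0, 0)"] by (simp add: weyl_project_def)
      next
        case (Suc l)
        then show ?thesis using q[of "t (0, j)"] x
          by (simp add: weyl_project_def distrib_left right_diff_distrib del: of_nat_Suc)
      qed
    qed
    show "weyl_project b (act_k (V1_tensor n (Suc b)) t) = act_k (V n b) (weyl_project b t)"
      unfolding act_k_V[OF c] acts_V1_tensor(3)[OF n t]
    proof
      fix j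
      have "xi n powi (1 - 2 * int 0) * xi n powi (int (Suc b) - 2 * int (Suc j)) = xi n powi (int b - 2 * int j)"
        "xi n powi (1 - 2 * int 1) * xi n powi (int (Suc b) - 2 * int j) = xi n powi (int b - 2 * int j)"
        unfolding power_int_add[OF disjI1, OF xi_nonzero, symmetric] by (simp_all add: algebra_simps)
      then show "weyl_project b (\<lambda>i. xi n powi (1 - 2 * int (fst i)) * xi n powi (int (Suc b) - 2 * int (snd i)) * t i) j
          = xi n powi (int b - 2 * int j) * weyl_project b t j"
        unfolding weyl_project_def fst_conv snd_conv
        by (simp only: right_diff_distrib mult.left_commute if_distrib[of "\<lambda>z. _ * z"] mult_zero_right)
    qed
  qed
  show ?thesis
    unfolding uhom_def using c acts
    by (auto simp: weyl_project_def fscale_def fun_eq_iff algebra_simps)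
qed

lemma weyl_range_eq_kernel:
  "weyl_range (Suc b) = {t \<in> carrier (V1_tensor n (Suc b)). weyl_project b t = \<zero>\<^bsub>V n b\<^esub>}"
  by (auto simp: weyl_range_def weyl_project_def fun_eq_iff less_Suc_eq_le)

lemma weyl_project_surj:
  "weyl_project b ` carrier (V1_tensor n (Suc b)) = carrier (V n b)"
proof
  show "weyl_project b ` carrier (V1_tensor n (Suc b)) \<subseteq> carrier (V n b)"
    by (auto simp: weyl_project_def V_carrier)
  show "carrier (V n b) \<subseteq> weyl_project b ` carrier (V1_tensor n (Suc b))"
  proof
    fix v assume v: "v \<in> carrier (V n b)"
    let ?t = "\<lambda>(i, j). if i = 0 then (case j of 0 \<Rightarrow> 0 | Suc l \<Rightarrow> v l) else 0 :: complex"
    have "?t \<in> carrier (V1_tensor n (Suc b))" using v by (auto simp: V1_tensor_carrier V_carrier split: nat.split)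
    moreover have "weyl_project b ?t = v" using v by (auto simp: weyl_project_def V_carrier fun_eq_iff)
    ultimately show "v \<in> weyl_project b ` carrier (V1_tensor n (Suc b))" by (metis image_eqI)
  qed
qed

text \<open>For a > 0 this is the kernel of the projection to \<open>V_(a-1)\<close>; for a = 0
  there is no such quotient and no equation, and the submodule is everything.\<close>

lemma usubmodule_weyl_range:
  assumes "a < n" shows "usubmodule (V1_tensor n a) (weyl_range a)"
proof (cases a)
  case 0
  interpret umod n "V1_tensor n 0" using umodule_V1_tensor[of 0] n by (simp add: umod_def)
  have "weyl_range 0 = carrier (V1_tensor n 0)" by (auto simp: weyl_range_def)
  then show ?thesis using usubmodule_carrier 0 by simp
next
  case (Suc b)
  have "umod n (V1_tensor n (Suc b))" using umodule_V1_tensor[of "Suc b"] Suc assms by (simp add: umod_def)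
  from umod.uiso_quotient_kernel(2)[OF this umodule_V[OF n, of b] weyl_project_uhom weyl_project_surj]
  show ?thesis unfolding Suc weyl_range_eq_kernel using Suc assms by simp
qed

lemma weyl_coords_embed:
  "v \<in> carrier (V n (Suc a)) \<Longrightarrow> weyl_coords (weyl_embed n a v) = v"
  by (auto simp: weyl_coords_def weyl_embed_def V_carrier fun_eq_iff split: nat.split)

lemma weyl_embed_0: "weyl_embed n a 0 = 0"
  by (rule ext) (auto simp: weyl_embed_def)

lemma weyl_embed_coords:
  assumes "t \<in> weyl_range a" shows "weyl_embed n a (weyl_coords t) = t"
proof (rule ext, clarify)
  fix i j
  show "weyl_embed n a (weyl_coords t) (i, j) = t (i, j)"
    using assms by (cases j) (auto simp: weyl_coords_def weyl_embed_def weyl_range_def V1_tensor_carrier)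
qed

lemma weyl_coords_uhom:
  assumes "a < n"
  shows "uhom ((V1_tensor n a)\<lparr>carrier := weyl_range a\<rparr>) (V n (Suc a)) weyl_coords"
    and "weyl_coords ` weyl_range a = carrier (V n (Suc a))"
proof -
  have e: "weyl_embed n a v \<in> weyl_range a" for v
    by (auto simp: weyl_range_def V1_tensor_carrier weyl_embed_def del: of_nat_Suc)
  have c: "weyl_coords t \<in> carrier (V n (Suc a))" if "t \<in> weyl_range a" for t
    using that by (auto simp: weyl_range_def V1_tensor_carrier V_carrier weyl_coords_def split: nat.split)
  show "weyl_coords ` weyl_range a = carrier (V n (Suc a))"
  proof
    show "carrier (V n (Suc a)) \<subseteq> weyl_coords ` weyl_range a"
      using weyl_coords_embed e by (metis image_eqI subsetI)
  qed (use c in auto)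
  interpret umod n "V n (Suc a)" using umodule_V[OF n, of "Suc a"] assms by (simp add: umod_def)
  have "uhom (V n (Suc a)) ((V1_tensor n a)\<lparr>carrier := weyl_range a\<rparr>) (weyl_embed n a)"
    using weyl_embed_uhom[OF n, of a] e by (simp add: uhom_def)
  then show "uhom ((V1_tensor n a)\<lparr>carrier := weyl_range a\<rparr>) (V n (Suc a)) weyl_coords"
    by (rule uhom_inverse) (simp_all add: weyl_coords_embed weyl_embed_coords c)
qed

lemma comp_count_weyl_range:
  assumes a: "Suc a < n"
  shows "comp_count n ((V1_tensor n a)\<lparr>carrier := weyl_range a\<rparr>) S (if uiso (V n (Suc a)) S then 1 else 0)"
proof -
  let ?M = "(V1_tensor n a)\<lparr>carrier := weyl_range a\<rparr>"
  have an: "a < n" using a by simp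
  interpret T: umod n "V1_tensor n a" using umodule_V1_tensor[of a] a by (simp add: umod_def)
  have M: "umodule n ?M" by (rule T.umodule_sub[OF usubmodule_weyl_range[OF an]])
  have "x = 0" if "x \<in> weyl_range a" "weyl_coords x = 0" for x
    using weyl_embed_coords[OF that(1)] unfolding that(2) weyl_embed_0 by simp
  moreover have "0 \<in> weyl_range a" "weyl_coords 0 = 0"
    by (auto simp: weyl_range_def V1_tensor_carrier weyl_coords_def fun_eq_iff split: nat.split)
  ultimately have ker: "{x \<in> carrier ?M. weyl_coords x = \<zero>\<^bsub>V n (Suc a)\<^esub>} = {\<zero>\<^bsub>V1_tensor n a\<^esub>}" by auto
  have "comp_count n (?M\<lparr>carrier := {\<zero>\<^bsub>V1_tensor n a\<^esub>}\<rparr>) S 0"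
    using T.umodule_sub[OF T.usubmodule_zero] by (intro comp_count_zero) simp_all
  from comp_count_kernel[OF M uirreducible_V[OF n a] weyl_coords_uhom(1)[OF an], unfolded ker, OF _ this]
  show ?thesis using weyl_coords_uhom(2)[OF an] by simp
qed

section \<open>The filtration of \<open>V_n\<close> with factors \<open>V_(n-2)\<close>,
  \<open>V_0\<close>, \<open>V_0\<close>\<close>

definition weyl_bottom :: "(nat \<Rightarrow> complex) \<Rightarrow> nat \<Rightarrow> complex" where
  "weyl_bottom v = (\<lambda>i. if i = 0 then v n else 0)"

definition weyl_top :: "(nat \<Rightarrow> complex) \<Rightarrow> nat \<Rightarrow> complex" where
  "weyl_top v = (\<lambda>i. if i = 0 then v 0 else 0)"

text \<open>The divisor rescales the basis: f has coefficient [s + 2] on \<open>v_(s+1)\<close> of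
  \<open>V_n\<close> but [s + 1] on \<open>v_s\<close> of \<open>V_(n-2)\<close>. The same divisor
  works for e because [n - m] = - [m].\<close>

definition weyl_middle :: "(nat \<Rightarrow> complex) \<Rightarrow> nat \<Rightarrow> complex" where
  "weyl_middle v = (\<lambda>s. if s \<le> n - 2 then v (Suc s) / qint n (int (Suc s)) else 0)"

lemma xi_powi_n: "xi n powi (int n) = 1"
  using xi_powi_eq_1_iff[of n "int n"] n by simp

text \<open>Only f could reach \<open>v_n\<close> from another basis vector, namely from
  \<open>v_(n-1)\<close> with coefficient [n] = 0. As k fixes \<open>v_n\<close>, the last
  coordinate is a map onto the trivial module.\<close>

lemma weyl_bottom_uhom: "uhom (V n n) (V n 0) weyl_bottom"
proof -
  have c: "weyl_bottom v \<in> carrier (V n 0)" for v by (simp add: weyl_bottom_def V_carrier)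
  have "xi n powi (int n - 2 * int n) = 1" using xi_powi_n by (simp add: power_int_minus)
  then have "weyl_bottom (act_e (V n n) v) = act_e (V n 0) (weyl_bottom v) \<and>
      weyl_bottom (act_f (V n n) v) = act_f (V n 0) (weyl_bottom v) \<and>
      weyl_bottom (act_k (V n n) v) = act_k (V n 0) (weyl_bottom v)" if "v \<in> carrier (V n n)" for v
    unfolding act_e_V[OF that] act_f_V[OF that] act_k_V[OF that] act_e_V[OF c] act_f_V[OF c] act_k_V[OF c]
    using n by (auto simp: weyl_bottom_def fun_eq_iff)
  then show ?thesis
    unfolding uhom_def using c by (auto simp: weyl_bottom_def fscale_def fun_eq_iff)
qed

text \<open>Only e could reach \<open>v_0\<close> from another basis vector, namely from
  \<open>v_1\<close> with coefficient [n] = 0. The domain is the second member of the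
  filtration.\<close>

lemma weyl_top_uhom:
  "uhom ((V n n)\<lparr>carrier := {v \<in> carrier (V n n). weyl_bottom v = \<zero>\<^bsub>V n 0\<^esub>}\<rparr>) (V n 0) weyl_top"
proof -
  have c: "weyl_top v \<in> carrier (V n 0)" for v by (simp add: weyl_top_def V_carrier)
  have "weyl_top (act_e (V n n) v) = act_e (V n 0) (weyl_top v) \<and>
      weyl_top (act_f (V n n) v) = act_f (V n 0) (weyl_top v) \<and>
      weyl_top (act_k (V n n) v) = act_k (V n 0) (weyl_top v)" if "v \<in> carrier (V n n)" for v
    unfolding act_e_V[OF that] act_f_V[OF that] act_k_V[OF that] act_e_V[OF c] act_f_V[OF c] act_k_V[OF c]
    using n xi_powi_n by (auto simp: weyl_top_def fun_eq_iff)
  then show ?thesis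
    unfolding uhom_def using c by (auto simp: weyl_top_def fscale_def fun_eq_iff)
qed

definition weyl_core :: "(nat \<Rightarrow> complex) set" where
  "weyl_core = {v \<in> {v \<in> carrier (V n n). weyl_bottom v = \<zero>\<^bsub>V n 0\<^esub>}. weyl_top v = \<zero>\<^bsub>V n 0\<^esub>}"

lemma weyl_core_iff: "v \<in> weyl_core \<longleftrightarrow> v \<in> carrier (V n n) \<and> v 0 = 0 \<and> v n = 0"
  by (auto simp: weyl_core_def weyl_bottom_def weyl_top_def fun_eq_iff)

lemma weyl_middle_uhom: "uhom ((V n n)\<lparr>carrier := weyl_core\<rparr>) (V n (n - 2)) weyl_middle"
proof -
  have c: "weyl_middle v \<in> carrier (V n (n - 2))" for v by (simp add: weyl_middle_def V_carrier)
  have nz: "qint n (int (Suc s)) \<noteq> 0" if "s \<le> n - 2" for s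
    using that n by (intro qint_nonzero[OF n]) auto
  have "weyl_middle (act_e (V n n) v) = act_e (V n (n - 2)) (weyl_middle v) \<and>
      weyl_middle (act_f (V n n) v) = act_f (V n (n - 2)) (weyl_middle v) \<and>
      weyl_middle (act_k (V n n) v) = act_k (V n (n - 2)) (weyl_middle v)" if v: "v \<in> weyl_core" for v
  proof -
    have vV: "v \<in> carrier (V n n)" and v0: "v 0 = 0" "v n = 0" using v by (auto simp: weyl_core_iff)
    show ?thesis
      unfolding act_e_V[OF vV] act_f_V[OF vV] act_k_V[OF vV] act_e_V[OF c] act_f_V[OF c] act_k_V[OF c]
    proof (intro conjI ext)
      fix s
      have e: "qint n (int n - int (Suc s)) = - qint n (int (Suc s))" for s
        by (rule qint_n_minus[OF n])
      have e2: "qint n (int (n - 2) - int s) = - qint n (int (Suc (Suc s)))"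
        using qint_n_minus[OF n, of "int (Suc (Suc s))"] n by (simp add: of_nat_diff algebra_simps)
      consider "s \<le> n - 3" | "s = n - 2" | "n - 2 < s" by linarith
      then show "weyl_middle (\<lambda>i. qint n (int n - int i) * v (Suc i)) s
          = qint n (int (n - 2) - int s) * weyl_middle v (Suc s)"
      proof cases
        case 1
        then have "s \<le> n - 2" "Suc s \<le> n - 2" using n by auto
        then show ?thesis using nz[of s] nz[of "Suc s"] unfolding weyl_middle_def e e2
          by (simp del: of_nat_Suc)
      next
        case 2
        then have "Suc (Suc s) = n" using n by simp
        then show ?thesis using 2 v0 unfolding weyl_middle_def by simp
      qed (simp add: weyl_middle_def)
      show "weyl_middle (\<lambda>i. if 0 < i \<and> i \<le> n then qint n (int i) * v (i - 1) else 0) s =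
         (if 0 < s \<and> s \<le> n - 2 then qint n (int s) * weyl_middle v (s - 1) else 0)"
        using nz[of s] nz[of "s - 1"] v0 n by (cases s) (auto simp: weyl_middle_def simp del: of_nat_Suc)
      have "int n - 2 * int (Suc s) = int (n - 2) - 2 * int s" using n by (simp add: of_nat_diff)
      then show "weyl_middle (\<lambda>i. xi n powi (int n - 2 * int i) * v i) s =
          xi n powi (int (n - 2) - 2 * int s) * weyl_middle v s"
        by (simp add: weyl_middle_def del: of_nat_Suc)
    qed
  qed
  then show ?thesis
    unfolding uhom_def using c
    by (auto simp: weyl_middle_def fscale_def fun_eq_iff add_divide_distrib)
qed

text \<open>The filtration by zero, \<open>weyl_core\<close>, the kernel of
  \<open>weyl_bottom\<close> and \<open>V_n\<close> is pulled back along \<open>weyl_coords\<close>,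
  one link at a time from below.\<close>

lemma comp_count_weyl_range_last:
  "comp_count n ((V1_tensor n (n - 1))\<lparr>carrier := weyl_range (n - 1)\<rparr>) S
     (0 + (if uiso (V n (n - 2)) S then 1 else 0) + (if uiso (V n 0) S then 1 else 0)
      + (if uiso (V n 0) S then 1 else 0))"
proof -
  have n1: "n - 1 < n" "Suc (n - 1) = n" using n by auto
  let ?T = "V1_tensor n (n - 1)"
  let ?M = "?T\<lparr>carrier := weyl_range (n - 1)\<rparr>"
  interpret T: umod n ?T using umodule_V1_tensor[of "n - 1"] n by (simp add: umod_def)
  have M: "umodule n ?M" by (rule T.umodule_sub[OF usubmodule_weyl_range[OF n1(1)]])
  interpret V: umod n "V n n" using umodule_V[OF n, of n] by (simp add: umod_def)
  note co = weyl_coords_uhom[OF n1(1), unfolded n1(2)]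
  have co2: "weyl_coords ` carrier ?M = carrier (V n n)" using co(2) by simp
  have V0: "umodule n (V n 0)" by (rule umodule_V[OF n]) simp
  let ?B = "{v \<in> carrier (V n n). weyl_bottom v = \<zero>\<^bsub>V n 0\<^esub>}"
  have in0: "v \<in> carrier (V n 0) \<Longrightarrow> v = (\<lambda>i. if i = 0 then v 0 else 0)" for v
    by (auto simp: V_carrier fun_eq_iff)
  have surj1: "weyl_bottom ` carrier (V n n) = carrier (V n 0)"
  proof
    show "carrier (V n 0) \<subseteq> weyl_bottom ` carrier (V n n)"
    proof
      fix v assume "v \<in> carrier (V n 0)"
      then have "weyl_bottom (\<lambda>i. if i = n then v 0 else 0) = v" using in0 by (simp add: weyl_bottom_def)
      then show "v \<in> weyl_bottom ` carrier (V n n)"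
        by (intro image_eqI[where x = "\<lambda>i. if i = n then v 0 else 0"]) (auto simp: V_carrier)
    qed
  qed (auto simp: weyl_bottom_def V_carrier)
  have B: "usubmodule (V n n) ?B"
    by (rule V.uiso_quotient_kernel(2)[OF V0 weyl_bottom_uhom surj1])
  interpret B: umod n "(V n n)\<lparr>carrier := ?B\<rparr>" by (rule V.umod_sub[OF B])
  have surj2: "weyl_top ` ?B = carrier (V n 0)"
  proof
    show "carrier (V n 0) \<subseteq> weyl_top ` ?B"
    proof
      fix v assume "v \<in> carrier (V n 0)"
      then have "weyl_top v = v" "v \<in> ?B" using in0[of v] n
        by (auto simp: weyl_top_def weyl_bottom_def V_carrier fun_eq_iff)
      then show "v \<in> weyl_top ` ?B" by (rule image_eqI[OF sym])
    qed
  qed (auto simp: weyl_top_def V_carrier)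
  have C: "usubmodule (V n n) weyl_core"
    using B.uiso_quotient_kernel(2)[OF V0 weyl_top_uhom] surj2 V.usubmodule_sub_iff[OF B]
    by (simp add: weyl_core_def)
  have surj3: "weyl_middle ` weyl_core = carrier (V n (n - 2))"
  proof
    show "carrier (V n (n - 2)) \<subseteq> weyl_middle ` weyl_core"
    proof
      fix v assume v: "v \<in> carrier (V n (n - 2))"
      define w where "w i = (case i of 0 \<Rightarrow> 0 | Suc s \<Rightarrow> qint n (int (Suc s)) * v s)" for i
      have "qint n (int (Suc s)) \<noteq> 0" if "s \<le> n - 2" for s
        using that n by (intro qint_nonzero[OF n]) auto
      then have "weyl_middle w = v" using v by (auto simp: weyl_middle_def w_def V_carrier fun_eq_iff simp del: of_nat_Suc)
      moreover have "w \<in> weyl_core" using v n by (auto simp: weyl_core_iff V_carrier w_def split: nat.split)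
      ultimately show "v \<in> weyl_middle ` weyl_core" by (rule image_eqI[OF sym])
    qed
  qed (auto simp: weyl_middle_def V_carrier)
  \<comment> \<open>Elements of \<open>weyl_core\<close> vanish at the coordinates 0 and n, and
    \<open>weyl_middle\<close> detects the others; so the pulled-back filtration starts at
    zero.\<close>
  have z: "x = 0" if "x \<in> weyl_range (n - 1)" "weyl_coords x \<in> weyl_core" "weyl_middle (weyl_coords x) = 0" for x
  proof -
    have "weyl_coords x i = 0" for i
    proof -
      have nz: "qint n (int (Suc s)) \<noteq> 0" if "s \<le> n - 2" for s
        using that n by (intro qint_nonzero[OF n]) auto
      consider "i = 0" | "i = n" | "n < i" | s where "i = Suc s" "s \<le> n - 2"
      proof -
        have "i = 0 \<or> i = n \<or> n < i \<or> (i = Suc (i - 1) \<and> i - 1 \<le> n - 2)" by linarith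
        then show thesis using that by blast
      qed
      then show ?thesis
      proof cases
        case 4
        have "weyl_middle (weyl_coords x) s = 0" using that(3) by simp
        then show ?thesis using 4 nz[of s] by (simp add: weyl_middle_def)
      qed (use that(2) in \<open>auto simp: weyl_core_iff V_carrier\<close>)
    qed
    then have "weyl_coords x = 0" by (simp add: fun_eq_iff)
    then show ?thesis using weyl_embed_coords[OF that(1)] by (simp add: weyl_embed_0)
  qed
  have z0: "0 \<in> weyl_range (n - 1)" "weyl_coords 0 = 0" "0 \<in> weyl_core" "weyl_middle 0 = 0"
    by (auto simp: weyl_range_def V1_tensor_carrier weyl_coords_def weyl_core_iff V_carrier weyl_middle_def fun_eq_iff split: nat.split)
  have "{x \<in> carrier ?M. weyl_coords x \<in> {y \<in> weyl_core. weyl_middle y = \<zero>\<^bsub>V n (n - 2)\<^esub>}} = {\<zero>\<^bsub>?T\<^esub>}"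
    using z z0 by auto
  moreover have "comp_count n (?M\<lparr>carrier := {\<zero>\<^bsub>?T\<^esub>}\<rparr>) S 0"
    using T.umodule_sub[OF T.usubmodule_zero] by (intro comp_count_zero) simp_all
  ultimately have c0: "comp_count n (?M\<lparr>carrier :=
      {x \<in> carrier ?M. weyl_coords x \<in> {y \<in> weyl_core. weyl_middle y = \<zero>\<^bsub>V n (n - 2)\<^esub>}}\<rparr>) S 0"
    by (simp only:)
  have irr: "uirreducible n (V n (n - 2))" "uirreducible n (V n 0)"
    using n by (auto intro!: uirreducible_V)
  note c1 = comp_count_pullback[OF M V.umodule co(1) co2 C irr(1) weyl_middle_uhom surj3 c0]
  note c2 = comp_count_pullback[OF M V.umodule co(1) co2 B irr(2) weyl_top_uhom surj2 c1[unfolded weyl_core_def]]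
  have h3: "uhom ((V n n)\<lparr>carrier := carrier (V n n)\<rparr>) (V n 0) weyl_bottom" using weyl_bottom_uhom by simp
  note c3 = comp_count_pullback[OF M V.umodule co(1) co2 V.usubmodule_carrier irr(2) h3 surj1 c2]
  have "{x \<in> carrier ?M. weyl_coords x \<in> carrier (V n n)} = weyl_range (n - 1)" using co(2) by auto
  then show ?thesis using c3 by simp
qed

section \<open>Multiplicities in the tensor product and the transition probabilities\<close>

lemma comp_count_V1_tensor:
  assumes a: "a < n" and W: "comp_count n ((V1_tensor n a)\<lparr>carrier := weyl_range a\<rparr>) S m"
  shows "comp_count n (V1_tensor n a) S (m + (if 0 < a \<and> uiso (V n (a - 1)) S then 1 else 0))"
proof (cases a)
  case 0
  have "(V1_tensor n a)\<lparr>carrier := weyl_range a\<rparr> = V1_tensor n a" using 0 by (auto simp: weyl_range_def)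
  then show ?thesis using W 0 by simp
next
  case (Suc b)
  from comp_count_kernel[OF umodule_V1_tensor[OF a[unfolded Suc]] uirreducible_V[OF n, of b] weyl_project_uhom weyl_project_surj
      W[unfolded Suc weyl_range_eq_kernel]]
  show ?thesis using a Suc by simp
qed

lemma tensor_chain_eq_K:
  assumes "a < n" "b < n" shows "tensor_chain n a b = K n a b"
proof -
  have T: "utensor n (V n 1) (V n a) = V1_tensor n a" by (simp add: V1_tensor_def)
  have iso: "uiso (V n c) (V n b) \<longleftrightarrow> c = b" if "c < n" for c
    using uiso_V_iff[OF n that assms(2)] .
  show ?thesis
  proof (cases "Suc a < n")
    case True
    note cm = comp_mult_eq[OF comp_count_V1_tensor[OF assms(1) comp_count_weyl_range[OF True]]]
    have cmp: "comp_mult n (utensor n (V n 1) (V n a)) (V n b) =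
      (if Suc a = b then 1 else 0) + (if 0 < a \<and> a - 1 = b then 1 else 0)"
      unfolding T cm using iso[OF True] iso[of "a - 1"] assms by simp
    have tc: "tensor_chain n a b =
        real ((if Suc a = b then 1 else 0) + (if 0 < a \<and> a - 1 = b then 1 else 0)) * real (b + 1) / (2 * real (a + 1))"
      unfolding tensor_chain_def udim_V[OF n] cmp ..
    define x where "x = real a + 1"
    have x: "x \<noteq> 0" by (simp add: x_def)
    consider "b = Suc a" | "0 < a" "b = a - 1" | "b \<noteq> Suc a" "\<not> (0 < a \<and> b = a - 1)" by blast
    then show ?thesis
    proof cases
      case 1
      then have "a - 1 \<noteq> b" by arith
      then have "(if Suc a = b then 1 else 0) + (if 0 < a \<and> a - 1 = b then 1 else 0) = (1 :: nat)"
        using 1 by simp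
      then have "tensor_chain n a b = (x + 1) / (2 * x)" unfolding tc using 1 by (simp add: x_def)
      also have "\<dots> = 1 / 2 * (1 + 1 / x)" using x by (simp add: field_simps)
      also have "\<dots> = K n a b" using 1 True by (auto simp: K_def x_def)
      finally show ?thesis .
    next
      case 2
      then have "Suc a \<noteq> b" by arith
      then have "(if Suc a = b then 1 else 0) + (if 0 < a \<and> a - 1 = b then 1 else 0) = (1 :: nat)"
        using 2 by simp
      then have "tensor_chain n a b = (x - 1) / (2 * x)" unfolding tc using 2 by (simp add: x_def of_nat_diff)
      also have "\<dots> = 1 / 2 * (1 - 1 / x)" using x by (simp add: field_simps)
      also have "\<dots> = K n a b" using 2 True by (auto simp: K_def x_def)
      finally show ?thesis .
    next
      case 3
      then show ?thesis unfolding tc using True by (auto simp: K_def)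
    qed
  next
    case False
    then have a: "a = n - 1" using assms by simp
    note cm = comp_mult_eq[OF comp_count_V1_tensor[OF assms(1)], unfolded a, OF comp_count_weyl_range_last]
    \<comment> \<open>\<open>V_(n-2)\<close> occurs once inside \<open>V_n\<close> and once as the
      quotient \<open>V_(a-1)\<close>, while \<open>V_0\<close> occurs twice inside
      \<open>V_n\<close>. With dimensions n - 1 and 1 this is the last row of
      \<open>K\<close>.\<close>
    have "comp_mult n (utensor n (V n 1) (V n a)) (V n b) =
      2 * (if b = n - 2 then 1 else 0) + 2 * (if b = 0 then 1 else 0)"
      unfolding T unfolding a cm using iso[of "n - 2"] iso[of 0] n by (auto simp: numeral_2_eq_2)
    then show ?thesis
      unfolding tensor_chain_def udim_V[OF n] using a n
      by (auto simp: K_def of_nat_diff field_simps)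
  qed
qed

end

theorem theorem7p2:
  shows "(\<forall>n. odd n \<and> n \<ge> 3 \<longrightarrow>
            (\<forall>a<n. uirreducible n (V n a) \<and> udim (V n a) = a + 1) \<and>
            (\<forall>a<n. \<forall>b<n. tensor_chain n a b = K n a b) \<and>
            stochastic n (K n) \<and>
            stationary n (K n) (stat n)) \<and>
         (\<exists>f1 f2 :: real \<Rightarrow> real.
            continuous_on {0..} f1 \<and> (\<forall>x\<ge>0. f1 x \<ge> 0) \<and>
            antimono_on {0..} f1 \<and> f1 0 > 0 \<and>
            continuous_on {0..} f2 \<and> (\<forall>x\<ge>0. f2 x > 0) \<and>
            strict_antimono_on {0..} f2 \<and> (f2 \<longlongrightarrow> 0) at_top \<and>
            (\<forall>n l. odd n \<and> n \<ge> 3 \<longrightarrow>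
               f1 (real l / (real n)\<^sup>2) \<le> tv_dist n (chain_power n (K n) l 0) (stat n)) \<and>
            (\<forall>n l. odd n \<and> n \<ge> 3 \<and> l \<ge> n\<^sup>2 \<longrightarrow>
               tv_dist n (chain_power n (K n) l 0) (stat n) \<le> f2 (real l / (real n)\<^sup>2)))"
proof (rule conjI)
  show "\<forall>n. odd n \<and> n \<ge> 3 \<longrightarrow>
      (\<forall>a<n. uirreducible n (V n a) \<and> udim (V n a) = a + 1) \<and>
      (\<forall>a<n. \<forall>b<n. tensor_chain n a b = K n a b) \<and>
      stochastic n (K n) \<and>
      stationary n (K n) (stat n)"
    by (auto simp: uirreducible_V udim_V tensor_chain_eq_K stochastic_K stationary_stat)
  \<comment> \<open>Truncation at 0 keeps \<open>?f1\<close> nonnegative and decreasing, and it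
    remains a lower bound because \<open>tv_dist\<close> is nonnegative.\<close>
  let ?f1 = "\<lambda>x::real. max 0 (4 / 9 - 3 * x)" and ?f2 = "\<lambda>x::real. 288 * exp (- (x / 8))"
  have "0 \<le> tv_dist n p q" for n p q
    by (simp add: tv_dist_def sum_nonneg)
  then have low: "\<forall>n l. odd n \<and> n \<ge> 3 \<longrightarrow>
      ?f1 (real l / (real n)\<^sup>2) \<le> tv_dist n (chain_power n (K n) l 0) (stat n)"
    using tv_dist_lower by simp
  have up: "\<forall>n l. odd n \<and> n \<ge> 3 \<and> l \<ge> n\<^sup>2 \<longrightarrow>
      tv_dist n (chain_power n (K n) l 0) (stat n) \<le> ?f2 (real l / (real n)\<^sup>2)"
    using tv_dist_upper by simp
  have lim: "(?f2 \<longlongrightarrow> 0) at_top"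
  proof -
    have "filterlim (\<lambda>x::real. x * (1 / 8)) at_top at_top"
      by (rule filterlim_at_top_mult_tendsto_pos[OF tendsto_const]) (auto simp: filterlim_ident)
    then have "filterlim (\<lambda>x::real. - (x / 8)) at_bot at_top"
      by (simp add: filterlim_uminus_at_bot)
    then have "((\<lambda>x::real. exp (- (x / 8))) \<longlongrightarrow> 0) at_top"
      by (rule filterlim_compose[OF exp_at_bot])
    then show ?thesis by (rule tendsto_mult_right_zero)
  qed
  have "continuous_on {0..} ?f1" "continuous_on {0..} ?f2"
    by (auto intro!: continuous_intros)
  moreover have "antimono_on {0..} ?f1" "strict_antimono_on {0..} ?f2"
    by (auto simp: monotone_on_def)
  ultimately show "\<exists>f1 f2 :: real \<Rightarrow> real.
      continuous_on {0..} f1 \<and> (\<forall>x\<ge>0. f1 x \<ge> 0) \<and>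
      antimono_on {0..} f1 \<and> f1 0 > 0 \<and>
      continuous_on {0..} f2 \<and> (\<forall>x\<ge>0. f2 x > 0) \<and>
      strict_antimono_on {0..} f2 \<and> (f2 \<longlongrightarrow> 0) at_top \<and>
      (\<forall>n l. odd n \<and> n \<ge> 3 \<longrightarrow>
         f1 (real l / (real n)\<^sup>2) \<le> tv_dist n (chain_power n (K n) l 0) (stat n)) \<and>
      (\<forall>n l. odd n \<and> n \<ge> 3 \<and> l \<ge> n\<^sup>2 \<longrightarrow>
         tv_dist n (chain_power n (K n) l 0) (stat n) \<le> f2 (real l / (real n)\<^sup>2))"
    using low up lim by (intro exI[of _ ?f1] exI[of _ ?f2]) auto
qed

end
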